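(* Suppose that $\mathcal{H}$ is a group of automorphisms of a totally disconnected, locally compact group $G$ that is virtually flat of finite rank. Then the subset $\mathcal{H}_{FC_d}:=\{\varphi\in\mathcal{H}: \varphi^{\mathcal{H}}\text{ is bounded}\}$ is a flat, normal subgroup of $\mathcal{H}$ of finite index that contains each flat subgroup of $\mathcal{H}$ of finite index.
   Context: Automorphisms are continuous with continuous inverse. $\mathcal{B}(G)$ is the set of compact, open subgroups of $G$ with metric $d(V,W)=\log\bigl(|V:V\cap W|\cdot|W:W\cap V|\bigr)$. A set $B$ of automorphisms of $G$ is bounded if $B.V=\{\beta(V):\beta\in B\}$ has bounded diameter in $\mathcal{B}(G)$ for some (equivalently every) $V\in\mathcal{B}(G)$. $\varphi^{\mathcal{H}}=\{\psi\varphi\psi^{-1}:\psi\in\mathcal{H}\}$ is the conjugacy class. The scale of $\varphi$ is $s_G(\varphi)=\min\{|\varphi(V):\varphi(V)\cap V|:V\in\mathcal{B}(G)\}$. A group $\mathcal{H}$ of automorphisms is flat if there is $O\in\mathcal{B}(G)$ with $|\varphi(O):\varphi(O)\cap O|=s_G(\varphi)$ for all $\varphi\in\mathcal{H}$. For flat $\mathcal{H}$, $\mathcal{H}(1)=\{\varphi:s_G(\varphi)=1=s_G(\varphi^{-1})\}$ is normal with $\mathcal{H}/\mathcal{H}(1)$ free abelian, whose $\mathbb{Z}$-rank is the rank of $\mathcal{H}$. A group is virtually flat of finite rank if it has a finite index subgroup that is flat of finite rank. *)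

theory Defs
  imports "HOL-Analysis.Analysis" "HOL-Algebra.Algebra"
begin

definition tdlc_group :: "('a,'b) monoid_scheme \<Rightarrow> 'a topology \<Rightarrow> bool" where
  "tdlc_group G T \<longleftrightarrow> group G \<and> topspace T = carrier G
     \<and> continuous_map (prod_topology T T) T (\<lambda>(x,y). x \<otimes>\<^bsub>G\<^esub> y)
     \<and> continuous_map T T (\<lambda>x. inv\<^bsub>G\<^esub> x)
     \<and> locally_compact_space T
     \<and> (\<forall>x\<in>topspace T. connected_component_of_set T x = {x})"

definition Aut :: "('a,'b) monoid_scheme \<Rightarrow> 'a topology \<Rightarrow> ('a \<Rightarrow> 'a) set" where
  "Aut G T = {\<phi>. \<phi> \<in> iso G G \<and> homeomorphic_map T T \<phi> \<and> \<phi> \<in> extensional (carrier G)}"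

definition aut_group :: "('a,'b) monoid_scheme \<Rightarrow> 'a topology \<Rightarrow> ('a \<Rightarrow> 'a) monoid" where
  "aut_group G T = \<lparr>carrier = Aut G T, mult = (\<lambda>\<psi> \<phi>. compose (carrier G) \<psi> \<phi>),
                    one = restrict id (carrier G)\<rparr>"

definition COS :: "('a,'b) monoid_scheme \<Rightarrow> 'a topology \<Rightarrow> 'a set set" where
  "COS G T = {V. subgroup V G \<and> openin T V \<and> compactin T V}"

definition rel_index :: "('a,'b) monoid_scheme \<Rightarrow> 'a set \<Rightarrow> 'a set \<Rightarrow> nat" where
  "rel_index G A B = card (rcosets\<^bsub>G\<lparr>carrier := A\<rparr>\<^esub> (A \<inter> B))"

definition cos_dist :: "('a,'b) monoid_scheme \<Rightarrow> 'a set \<Rightarrow> 'a set \<Rightarrow> real" where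
  "cos_dist G V W = ln (real (rel_index G V W * rel_index G W V))"

definition bounded_auts :: "('a,'b) monoid_scheme \<Rightarrow> 'a topology \<Rightarrow> ('a \<Rightarrow> 'a) set \<Rightarrow> bool" where
  "bounded_auts G T B \<longleftrightarrow>
     (\<exists>V\<in>COS G T. \<exists>M::real. \<forall>\<beta>\<in>B. \<forall>\<gamma>\<in>B. cos_dist G (\<beta> ` V) (\<gamma> ` V) \<le> M)"

definition conj_class :: "('a,'b) monoid_scheme \<Rightarrow> 'a topology \<Rightarrow> ('a \<Rightarrow> 'a) set \<Rightarrow> ('a \<Rightarrow> 'a) \<Rightarrow> ('a \<Rightarrow> 'a) set" where
  "conj_class G T H \<phi> = {\<psi> \<otimes>\<^bsub>aut_group G T\<^esub> \<phi> \<otimes>\<^bsub>aut_group G T\<^esub> inv\<^bsub>aut_group G T\<^esub> \<psi> | \<psi>. \<psi> \<in> H}"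

definition aut_scale :: "('a,'b) monoid_scheme \<Rightarrow> 'a topology \<Rightarrow> ('a \<Rightarrow> 'a) \<Rightarrow> nat" where
  "aut_scale G T \<phi> = (LEAST n. \<exists>V\<in>COS G T. n = rel_index G (\<phi> ` V) V)"

definition flat :: "('a,'b) monoid_scheme \<Rightarrow> 'a topology \<Rightarrow> ('a \<Rightarrow> 'a) set \<Rightarrow> bool" where
  "flat G T H \<longleftrightarrow> (\<exists>U\<in>COS G T. \<forall>\<phi>\<in>H. rel_index G (\<phi> ` U) U = aut_scale G T \<phi>)"

definition flat_one :: "('a,'b) monoid_scheme \<Rightarrow> 'a topology \<Rightarrow> ('a \<Rightarrow> 'a) set \<Rightarrow> ('a \<Rightarrow> 'a) set" where
  "flat_one G T H = {\<phi>\<in>H. aut_scale G T \<phi> = 1 \<and> aut_scale G T (inv\<^bsub>aut_group G T\<^esub> \<phi>) = 1}"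

definition flat_finite_rank :: "('a,'b) monoid_scheme \<Rightarrow> 'a topology \<Rightarrow> ('a \<Rightarrow> 'a) set \<Rightarrow> bool" where
  "flat_finite_rank G T H \<longleftrightarrow> flat G T H \<and>
     (\<exists>S::nat set. finite S \<and>
        ((aut_group G T)\<lparr>carrier := H\<rparr> Mod flat_one G T H) \<cong> free_Abelian_group S)"

definition virtually_flat_finite_rank :: "('a,'b) monoid_scheme \<Rightarrow> 'a topology \<Rightarrow> ('a \<Rightarrow> 'a) set \<Rightarrow> bool" where
  "virtually_flat_finite_rank G T H \<longleftrightarrow>
     (\<exists>K. subgroup K ((aut_group G T)\<lparr>carrier := H\<rparr>)
          \<and> finite (rcosets\<^bsub>(aut_group G T)\<lparr>carrier := H\<rparr>\<^esub> K)
          \<and> flat_finite_rank G T K)"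

definition FCd :: "('a,'b) monoid_scheme \<Rightarrow> 'a topology \<Rightarrow> ('a \<Rightarrow> 'a) set \<Rightarrow> ('a \<Rightarrow> 'a) set" where
  "FCd G T H = {\<phi>\<in>H. bounded_auts G T (conj_class G T H \<phi>)}"

end

theory Submission
  imports Defs
begin

text \<open>
  If \<open>K\<close> is flat, the displacement of a common minimizing subgroup by \<open>\<phi> \<in> K\<close> is read off from the scales of \<open>\<phi>\<close> and
  \<open>\<phi>\<^sup>-\<^sup>1\<close>, which are invariant under conjugation; hence flat subgroups of finite index lie in \<open>F = \<H>\<^sub>F\<^sub>C\<^sub>d\<close>.

  The main point is that \<open>F\<close> is flat. Let \<open>K\<close> be flat of finite rank, normal and of finite index in \<open>F\<close>. Since conjugacy
  classes are bounded and scales are multiplicative on powers, \<open>F\<close> centralizes \<open>K/K(1)\<close>, so the transfer is a homomorphism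
  from \<open>F\<close> to \<open>K/K(1)\<close> whose kernel \<open>P\<close> is a finite extension of \<open>K(1)\<close>. Thus \<open>P\<close> fixes a compact open subgroup \<open>V\<close> that is
  minimizing for \<open>K\<close>, and \<open>F/P\<close> is abelian.

  Minimizing subgroups are exactly Willis's tidy subgroups. Intersections of tidy subgroups are tidy, and if \<open>V\<close> is tidy
  for \<open>\<phi>\<^sup>n\<close> then \<open>V \<inter> \<phi>(V) \<inter> \<dots> \<inter> \<phi>\<^sup>n\<^sup>-\<^sup>1(V)\<close> is tidy for \<open>\<phi>\<close>, so \<open>V\<close> can be made tidy for any finite subset of \<open>F\<close>. Finitely
  many elements suffice: \<open>V\<close> is a product of finitely many groups \<open>V\<^sub>C = \<Inter>\<^sub>c\<^sub>\<in>\<^sub>C c(V)\<close> that every element of \<open>K\<close> either expands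
  or contracts, and for each of them and each coset of \<open>K\<close> only the least expanding element has to be controlled.
\<close>

section \<open>Automorphisms\<close>

text \<open>A subgroup that is tidy for \<open>K\<close> need not be tidy for an element \<phi> of
  \<open>F\<close>, even though a power of \<phi> is in \<open>K\<close>, and each correction serves
  a single \<phi>. The transfer is there to make corrections compatible: on
  \<open>P\<close>-invariant sets all elements of \<open>F\<close> commute, so the image of a group
  tidy for one element under another one is still tidy, and what has been achieved survives the next
  intersection. Infinitely many elements remain. On \<open>V\<^sub>C\<close> the group
  \<open>K\<close> acts by a total preorder, so a positive \<open>a\<close> in a coset of
  \<open>K\<close> is b k with \<open>k\<close> positive and \<open>b\<close> of least index, and
  the past of a point under \<open>a\<close> is controlled by its past under \<open>b\<close>. The
  recurring topological tool is that a point of a tidy subgroup whose backward orbit lies in some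
  compact set belongs to the positive part, and likewise forwards. Multiplicativity of the scale on
  powers needs a tidy subgroup for every single automorphism, hence Willis's tidying
  procedure.\<close>

lemma card_image_cong_rel:
  assumes "\<And>a b. a \<in> A \<Longrightarrow> b \<in> A \<Longrightarrow> f a = f b \<longleftrightarrow> g a = g b"
  shows "card (f ` A) = card (g ` A)"
proof -
  have "bij_betw (\<lambda>y. g (inv_into A f y)) (f ` A) (g ` A)"
  proof (rule bij_betw_imageI)
    have *: "g (inv_into A f (f a)) = g a" if "a \<in> A" for a
      using assms[OF inv_into_into[of "f a" f A] that] that by (simp add: f_inv_into_f)
    show "inj_on (\<lambda>y. g (inv_into A f y)) (f ` A)"
      using assms * by (auto simp: inj_on_def)
    show "(\<lambda>y. g (inv_into A f y)) ` f ` A = g ` A"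
      using * by (simp add: image_image)
  qed
  then show ?thesis by (rule bij_betw_same_card)
qed

locale tdlc = group G for G (structure) + fixes T
  assumes tdlc: "tdlc_group G T"
begin

abbreviation AG where "AG \<equiv> aut_group G T"
abbreviation amult (infixl "\<cdot>" 70) where "\<phi> \<cdot> \<psi> \<equiv> \<phi> \<otimes>\<^bsub>AG\<^esub> \<psi>"
abbreviation ainv where "ainv \<phi> \<equiv> inv\<^bsub>AG\<^esub> \<phi>"

lemma topspace_eq [simp]: "topspace T = carrier G"
  using tdlc by (simp add: tdlc_group_def)

lemma continuous_mult: "continuous_map (prod_topology T T) T (\<lambda>(x,y). x \<otimes> y)"
  using tdlc by (simp add: tdlc_group_def)

lemma continuous_inv: "continuous_map T T (\<lambda>x. inv x)"
  using tdlc by (simp add: tdlc_group_def)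

lemma continuous_mult_fun:
  assumes "continuous_map T T f" "continuous_map T T g"
  shows "continuous_map T T (\<lambda>x. f x \<otimes> g x)"
proof -
  have "continuous_map T (prod_topology T T) (\<lambda>x. (f x, g x))"
    using assms by (simp add: continuous_map_pairwise o_def)
  from continuous_map_compose[OF this continuous_mult] show ?thesis by (simp add: o_def)
qed

lemma carrier_Aut: "carrier AG = Aut G T" by (simp add: aut_group_def)

lemma Aut_closed: "\<phi> \<in> Aut G T \<Longrightarrow> x \<in> carrier G \<Longrightarrow> \<phi> x \<in> carrier G"
  unfolding Aut_def iso_def hom_def by blast

lemma Aut_mult: "\<phi> \<in> Aut G T \<Longrightarrow> x \<in> carrier G \<Longrightarrow> y \<in> carrier G \<Longrightarrow> \<phi> (x \<otimes> y) = \<phi> x \<otimes> \<phi> y"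
  unfolding Aut_def iso_def hom_def by blast

lemma Aut_bij: "\<phi> \<in> Aut G T \<Longrightarrow> bij_betw \<phi> (carrier G) (carrier G)"
  unfolding Aut_def iso_def by blast

lemma Aut_continuous: "\<phi> \<in> Aut G T \<Longrightarrow> continuous_map T T \<phi>"
  unfolding Aut_def using homeomorphic_imp_continuous_map by blast

lemma Aut_group_hom: "\<phi> \<in> Aut G T \<Longrightarrow> group_hom G G \<phi>"
  unfolding group_hom_def group_hom_axioms_def Aut_def iso_def using is_group by blast

lemma Aut_one: "\<phi> \<in> Aut G T \<Longrightarrow> \<phi> \<one> = \<one>"
  by (rule group_hom.hom_one[OF Aut_group_hom])

lemma Aut_inv: "\<phi> \<in> Aut G T \<Longrightarrow> x \<in> carrier G \<Longrightarrow> \<phi> (inv x) = inv (\<phi> x)"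
  by (rule group_hom.hom_inv[OF Aut_group_hom])

lemma AutI:
  assumes "bij_betw f (carrier G) (carrier G)" "homeomorphic_map T T f" "f \<in> extensional (carrier G)"
    "\<And>x y. x \<in> carrier G \<Longrightarrow> y \<in> carrier G \<Longrightarrow> f (x \<otimes> y) = f x \<otimes> f y"
  shows "f \<in> Aut G T"
  using assms by (auto simp: Aut_def iso_def hom_def bij_betw_def)

lemma mult_AG: "\<phi> \<cdot> \<psi> = compose (carrier G) \<phi> \<psi>" by (simp add: aut_group_def)
lemma one_AG: "\<one>\<^bsub>AG\<^esub> = restrict id (carrier G)" by (simp add: aut_group_def)

lemma compose_Aut: assumes "\<phi> \<in> Aut G T" "\<psi> \<in> Aut G T" shows "compose (carrier G) \<phi> \<psi> \<in> Aut G T"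
proof (rule AutI)
  show "bij_betw (compose (carrier G) \<phi> \<psi>) (carrier G) (carrier G)"
    using assms by (auto intro: bij_betw_compose Aut_bij)
  have "homeomorphic_map T T (\<phi> \<circ> \<psi>)" using assms by (auto simp: Aut_def intro: homeomorphic_map_compose)
  then show "homeomorphic_map T T (compose (carrier G) \<phi> \<psi>)"
    by (rule homeomorphic_map_eq) (auto simp: compose_def)
qed (use assms in \<open>auto simp: compose_def Aut_closed Aut_mult\<close>)

lemma inverse_Aut:
  assumes "\<phi> \<in> Aut G T"
  shows "restrict (inv_into (carrier G) \<phi>) (carrier G) \<in> Aut G T"
    "compose (carrier G) (restrict (inv_into (carrier G) \<phi>) (carrier G)) \<phi> = restrict id (carrier G)"
proof -
  let ?g = "restrict (inv_into (carrier G) \<phi>) (carrier G)"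
  note b = Aut_bij[OF assms]
  have inj: "inj_on \<phi> (carrier G)" and im: "\<phi> ` carrier G = carrier G" using b by (auto simp: bij_betw_def)
  have gc: "?g x \<in> carrier G" "\<phi> (?g x) = x" if "x \<in> carrier G" for x
    using that im by (auto intro: inv_into_into f_inv_into_f)
  have fg: "?g (\<phi> x) = x" if "x \<in> carrier G" for x
    using that inj assms by (simp add: Aut_closed)
  obtain g where g: "homeomorphic_maps T T \<phi> g" using assms by (auto simp: Aut_def homeomorphic_map_maps)
  \<comment> \<open>Elements of \<open>Aut\<close> are extensional, so the inverse has to be the
    restricted \<open>?g\<close>. The continuous inverse \<open>g\<close> is arbitrary off the
    carrier and agrees with \<open>?g\<close> on it.\<close>
  have gg: "g x = ?g x" if x: "x \<in> carrier G" for x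
  proof -
    have "\<forall>z\<in>carrier G. g (\<phi> z) = z" using g by (simp add: homeomorphic_maps_def)
    then have "g (\<phi> (?g x)) = ?g x" using gc(1)[OF x] by blast
    then show ?thesis using gc[OF x] by metis
  qed
  have "homeomorphic_map T T g" using g homeomorphic_maps_map by blast
  then have h: "homeomorphic_map T T ?g" by (rule homeomorphic_map_eq) (simp add: gg)
  show "?g \<in> Aut G T"
  proof (rule AutI[OF _ h])
    show "bij_betw ?g (carrier G) (carrier G)" using bij_betw_inv_into[OF b]
      using bij_betw_restrict_eq by blast
    fix x y assume xy: "x \<in> carrier G" "y \<in> carrier G"
    have "\<phi> (?g x \<otimes> ?g y) = x \<otimes> y" using Aut_mult[OF assms gc(1)[OF xy(1)] gc(1)[OF xy(2)]] gc(2) xy by simp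
    then show "?g (x \<otimes> y) = ?g x \<otimes> ?g y" using fg gc xy by (metis m_closed)
  qed auto
  show "compose (carrier G) ?g \<phi> = restrict id (carrier G)"
    using fg by (auto simp: compose_def fun_eq_iff)
qed

sublocale AG: group AG
proof (rule groupI; unfold carrier_Aut mult_AG one_AG)
  show "restrict id (carrier G) \<in> Aut G T"
  proof (rule AutI)
    show "bij_betw (restrict id (carrier G)) (carrier G) (carrier G)" by (simp add: bij_betw_def)
    show "homeomorphic_map T T (restrict id (carrier G))"
      by (rule homeomorphic_map_eq[of _ _ id]) auto
  qed auto
next
  fix \<phi> \<psi> \<theta> assume "\<phi> \<in> Aut G T" "\<psi> \<in> Aut G T" "\<theta> \<in> Aut G T"
  then show "compose (carrier G) (compose (carrier G) \<phi> \<psi>) \<theta> = compose (carrier G) \<phi> (compose (carrier G) \<psi> \<theta>)"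
    by (auto simp: compose_def fun_eq_iff Aut_closed)
next
  fix \<phi> assume "\<phi> \<in> Aut G T"
  then show "compose (carrier G) (restrict id (carrier G)) \<phi> = \<phi>"
    by (auto simp: compose_def fun_eq_iff Aut_def extensional_def hom_def iso_def)
qed (auto intro: compose_Aut dest: inverse_Aut)

lemma Aut_m_closed [simp]: "\<phi> \<in> Aut G T \<Longrightarrow> \<psi> \<in> Aut G T \<Longrightarrow> \<phi> \<cdot> \<psi> \<in> Aut G T"
  using AG.m_closed by (simp add: carrier_Aut)
lemma Aut_inv_closed [simp]: "\<phi> \<in> Aut G T \<Longrightarrow> ainv \<phi> \<in> Aut G T"
  using AG.inv_closed by (simp add: carrier_Aut)
lemma Aut_one_closed [simp]: "\<one>\<^bsub>AG\<^esub> \<in> Aut G T"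
  using AG.one_closed by (simp add: carrier_Aut)
lemma Aut_int_pow_closed [simp]: "\<phi> \<in> Aut G T \<Longrightarrow> \<phi> [^]\<^bsub>AG\<^esub> (n::int) \<in> Aut G T"
  using AG.int_pow_closed by (simp add: carrier_Aut)

lemma mult_apply [simp]: "x \<in> carrier G \<Longrightarrow> (\<phi> \<cdot> \<psi>) x = \<phi> (\<psi> x)"
  by (simp add: mult_AG compose_def)
lemma one_apply [simp]: "x \<in> carrier G \<Longrightarrow> \<one>\<^bsub>AG\<^esub> x = x"
  by (simp add: one_AG)
lemma inv_apply:
  assumes "\<phi> \<in> Aut G T" "x \<in> carrier G"
  shows "(ainv \<phi>) (\<phi> x) = x" "\<phi> ((ainv \<phi>) x) = x"
  using assms mult_apply[of x "ainv \<phi>" \<phi>] mult_apply[of x \<phi> "ainv \<phi>"]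
  by (simp_all add: carrier_Aut del: mult_apply)

lemma mult_image: "S \<subseteq> carrier G \<Longrightarrow> (\<phi> \<cdot> \<psi>) ` S = \<phi> ` \<psi> ` S"
  by (force simp: image_iff)
lemma one_image [simp]: "S \<subseteq> carrier G \<Longrightarrow> \<one>\<^bsub>AG\<^esub> ` S = S"
  by (force simp: image_iff)
lemma Aut_image_subset: "\<phi> \<in> Aut G T \<Longrightarrow> S \<subseteq> carrier G \<Longrightarrow> \<phi> ` S \<subseteq> carrier G"
  by (auto simp: Aut_closed)
lemma image_iff_inv:
  assumes "\<phi> \<in> Aut G T" "x \<in> carrier G" "S \<subseteq> carrier G"
  shows "x \<in> \<phi> ` S \<longleftrightarrow> (ainv \<phi>) x \<in> S"
proof
  assume "x \<in> \<phi> ` S"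
  then obtain y where "y \<in> S" "x = \<phi> y" by blast
  then show "(ainv \<phi>) x \<in> S" using assms inv_apply(1)[OF assms(1), of y] by auto
next
  assume "(ainv \<phi>) x \<in> S"
  then have "\<phi> ((ainv \<phi>) x) \<in> \<phi> ` S" by (rule imageI)
  then show "x \<in> \<phi> ` S" using inv_apply(2)[OF assms(1,2)] by simp
qed
lemma inv_image:
  assumes "\<phi> \<in> Aut G T" "S \<subseteq> carrier G"
  shows "(ainv \<phi>) ` \<phi> ` S = S" "\<phi> ` (ainv \<phi>) ` S = S"
proof -
  have i: "ainv \<phi> \<in> Aut G T" using assms by simp
  have "(ainv \<phi> \<cdot> \<phi>) ` S = S" "(\<phi> \<cdot> ainv \<phi>) ` S = S"
    using assms by (simp_all add: carrier_Aut)
  then show "(ainv \<phi>) ` \<phi> ` S = S" "\<phi> ` (ainv \<phi>) ` S = S"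
    using assms by (simp_all add: mult_image)
qed
lemma Aut_inj: "\<phi> \<in> Aut G T \<Longrightarrow> S \<subseteq> carrier G \<Longrightarrow> inj_on \<phi> S"
  using Aut_bij bij_betw_def inj_on_subset by metis
abbreviation ev where "ev \<phi> j \<equiv> \<phi> [^]\<^bsub>AG\<^esub> (j::int)"

lemma ev_closed [simp]: "\<phi> \<in> Aut G T \<Longrightarrow> x \<in> carrier G \<Longrightarrow> ev \<phi> j x \<in> carrier G"
  by (simp add: Aut_closed)
lemma ev_hom [simp]: "\<phi> \<in> Aut G T \<Longrightarrow> x \<in> carrier G \<Longrightarrow> y \<in> carrier G \<Longrightarrow> ev \<phi> j (x \<otimes> y) = ev \<phi> j x \<otimes> ev \<phi> j y"
  by (simp add: Aut_mult)
lemma ev_inv_hom [simp]: "\<phi> \<in> Aut G T \<Longrightarrow> x \<in> carrier G \<Longrightarrow> ev \<phi> j (inv x) = inv (ev \<phi> j x)"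
  by (simp add: Aut_inv)
lemma ev_one [simp]: "\<phi> \<in> Aut G T \<Longrightarrow> ev \<phi> j \<one> = \<one>"
  by (simp add: Aut_one)
lemma ev_add: "\<phi> \<in> Aut G T \<Longrightarrow> ev \<phi> (i + j) = ev \<phi> i \<cdot> ev \<phi> j"
  by (simp add: AG.int_pow_mult carrier_Aut)
lemma ev_ev: "\<phi> \<in> Aut G T \<Longrightarrow> x \<in> carrier G \<Longrightarrow> ev \<phi> i (ev \<phi> j x) = ev \<phi> (i + j) x"
  by (simp add: ev_add)
lemma ev_1 [simp]: "\<phi> \<in> Aut G T \<Longrightarrow> ev \<phi> 1 = \<phi>" by (simp add: AG.int_pow_1 carrier_Aut)
lemma ev_minus: "\<phi> \<in> Aut G T \<Longrightarrow> ev \<phi> (-j) = ainv (ev \<phi> j)"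
  by (simp add: AG.int_pow_neg carrier_Aut)
lemma ev_inv: "\<phi> \<in> Aut G T \<Longrightarrow> ev (ainv \<phi>) j = ev \<phi> (-j)"
  by (simp add: AG.int_pow_inv AG.int_pow_neg carrier_Aut)
lemma ev_mult: "\<phi> \<in> Aut G T \<Longrightarrow> ev (ev \<phi> i) j = ev \<phi> (i * j)"
  by (simp add: AG.int_pow_pow carrier_Aut)
lemma ev_image: "\<phi> \<in> Aut G T \<Longrightarrow> S \<subseteq> carrier G \<Longrightarrow> ev \<phi> i ` ev \<phi> j ` S = ev \<phi> (i + j) ` S"
  by (simp add: ev_add mult_image)
lemma mem_ev_image:
  assumes "\<phi> \<in> Aut G T" "x \<in> carrier G" "S \<subseteq> carrier G"
  shows "x \<in> ev \<phi> j ` S \<longleftrightarrow> ev \<phi> (-j) x \<in> S"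
  using assms by (simp add: image_iff_inv ev_minus)

section \<open>Compact open subgroups and their indices\<close>

lemma COS_D:
  assumes "V \<in> COS G T"
  shows "subgroup V G" "openin T V" "compactin T V" "V \<subseteq> carrier G"
  using assms by (auto simp: COS_def subgroup_def)

lemma openin_rcos:
  assumes "openin T V" "a \<in> carrier G" shows "openin T (V #> a)"
proof -
  have sub: "V \<subseteq> carrier G" using openin_subset[OF assms(1)] by simp
  have c: "continuous_map T T (\<lambda>x. x \<otimes> inv a)"
    using assms by (intro continuous_mult_fun) (auto)
  have "V #> a = {x \<in> topspace T. x \<otimes> inv a \<in> V}"
    using sub assms(2) by (auto simp: r_coset_def subset_iff m_assoc)
  then show ?thesis using openin_continuous_map_preimage[OF c assms(1)] by simp
qed

lemma open_subgroup_closed: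
  assumes "subgroup V G" "openin T V" shows "closedin T V"
proof -
  have "carrier G - V = \<Union>{V #> a | a. a \<in> carrier G - V}"
  proof (intro Set.set_eqI iffI)
    fix x assume "x \<in> carrier G - V"
    moreover from this have "x \<in> V #> x" using rcos_self[OF _ assms(1)] by simp
    ultimately show "x \<in> \<Union>{V #> a | a. a \<in> carrier G - V}" by blast
  next
    fix x assume "x \<in> \<Union>{V #> a | a. a \<in> carrier G - V}"
    then obtain a v where a: "a \<in> carrier G" "a \<notin> V" "v \<in> V" "x = v \<otimes> a" by (auto simp: r_coset_def)
    have v: "v \<in> carrier G" using subgroup.mem_carrier[OF assms(1) a(3)] .
    have "x \<notin> V"
    proof
      assume "x \<in> V"
      then have "inv v \<otimes> x \<in> V" using assms a by (meson subgroup.m_closed subgroup.m_inv_closed)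
      then show False using a v by (simp add: m_assoc[symmetric])
    qed
    then show "x \<in> carrier G - V" using a v by simp
  qed
  moreover have "openin T (\<Union>{V #> a | a. a \<in> carrier G - V})"
    using openin_rcos[OF assms(2)] by (intro openin_Union) auto
  ultimately have "openin T (carrier G - V)" by (rule ssubst)
  then show ?thesis using assms by (simp add: closedin_def subgroup.subset)
qed

lemma COS_closed: "V \<in> COS G T \<Longrightarrow> closedin T V"
  by (auto simp: COS_def open_subgroup_closed)

text \<open>An open subgroup is closed, so a compact set containing it makes it compact. For a new
  open subgroup it remains to bound it.\<close>

lemma COS_I:
  assumes "subgroup V G" "openin T V" "compactin T C" "V \<subseteq> C"
  shows "V \<in> COS G T"
  using assms closed_compactin[OF assms(3,4) open_subgroup_closed[OF assms(1,2)]] by (simp add: COS_def)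

lemma COS_Int: "V \<in> COS G T \<Longrightarrow> W \<in> COS G T \<Longrightarrow> V \<inter> W \<in> COS G T"
  by (rule COS_I[of _ V]) (auto simp: COS_def subgroups_Inter_pair)

lemma COS_INT: "finite I \<Longrightarrow> I \<noteq> {} \<Longrightarrow> (\<And>i. i \<in> I \<Longrightarrow> V i \<in> COS G T) \<Longrightarrow> (\<Inter>i\<in>I. V i) \<in> COS G T"
  by (induction I rule: finite_ne_induct) (auto intro: COS_Int)

lemma subgroup_image: "\<phi> \<in> Aut G T \<Longrightarrow> subgroup V G \<Longrightarrow> subgroup (\<phi> ` V) G"
  using group_hom.subgroup_img_is_subgroup[OF Aut_group_hom] by simp

lemma COS_image: assumes "\<phi> \<in> Aut G T" "V \<in> COS G T" shows "\<phi> ` V \<in> COS G T"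
proof -
  note V = COS_D[OF assms(2)]
  have "open_map T T \<phi>" using assms(1) homeomorphic_imp_open_map[of T T \<phi>] unfolding Aut_def by blast
  then have "openin T (\<phi> ` V)" using V(2) unfolding open_map_def by blast
  moreover have "compactin T (\<phi> ` V)" by (rule image_compactin[OF V(3) Aut_continuous[OF assms(1)]])
  ultimately show ?thesis using subgroup_image[OF assms(1) V(1)] by (simp add: COS_def)
qed

lemma Aut_closedin_image: "\<phi> \<in> Aut G T \<Longrightarrow> closedin T S \<Longrightarrow> closedin T (\<phi> ` S)"
  using homeomorphic_imp_closed_map[of T T \<phi>] unfolding Aut_def closed_map_def by blast

lemma compact_set_mult: assumes "compactin T A" "compactin T B" shows "compactin T (A <#> B)"
proof -
  have "A <#> B = (\<lambda>(x,y). x \<otimes> y) ` (A \<times> B)" by (auto simp: set_mult_def)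
  then show ?thesis using image_compactin[OF _ continuous_mult, of "A \<times> B"] assms by (simp add: compactin_Times)
qed

text \<open>Relative compactness without closures. It passes to subsets, so orbits and subgroups
  that are not known to be closed can be bounded by products and images of compact sets.\<close>

definition bdd :: "'a set \<Rightarrow> bool" where
  "bdd S \<longleftrightarrow> (\<exists>C. compactin T C \<and> S \<subseteq> C)"

lemma bdd_subset: "bdd S \<Longrightarrow> R \<subseteq> S \<Longrightarrow> bdd R" by (auto simp: bdd_def)
lemma bdd_Un: "bdd S \<Longrightarrow> bdd R \<Longrightarrow> bdd (S \<union> R)"
  unfolding bdd_def by (meson Un_mono compactin_Un)
lemma bdd_finite_UN: "finite I \<Longrightarrow> (\<And>i. i \<in> I \<Longrightarrow> bdd (S i)) \<Longrightarrow> bdd (\<Union>i\<in>I. S i)"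
proof (induction I rule: finite_induct)
  case empty
  have "compactin T {}" by simp
  then show ?case unfolding bdd_def by blast
next
  case (insert i I)
  then show ?case by (simp add: bdd_Un)
qed
lemma bdd_COS: "V \<in> COS G T \<Longrightarrow> bdd V" by (auto simp: bdd_def COS_def)
lemma bdd_mult: "bdd S \<Longrightarrow> bdd R \<Longrightarrow> bdd (S <#> R)"
proof -
  assume "bdd S" "bdd R"
  then obtain C D where "compactin T C" "S \<subseteq> C" "compactin T D" "R \<subseteq> D" unfolding bdd_def by blast
  then show "bdd (S <#> R)" unfolding bdd_def
    using compact_set_mult[of C D] mono_set_mult[of S C R D G] by blast
qed
lemma bdd_image: "\<phi> \<in> Aut G T \<Longrightarrow> bdd S \<Longrightarrow> bdd (\<phi> ` S)"
proof -
  assume p: "\<phi> \<in> Aut G T" and "bdd S"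
  then obtain C where "compactin T C" "S \<subseteq> C" unfolding bdd_def by blast
  then show "bdd (\<phi> ` S)" unfolding bdd_def
    using image_compactin[OF _ Aut_continuous[OF p], of C] image_mono[of S C \<phi>] by blast
qed

section \<open>Counting cosets\<close>

lemma rcos_eq_iff:
  assumes "subgroup B G" "a \<in> carrier G" "b \<in> carrier G"
  shows "B #> a = B #> b \<longleftrightarrow> a \<otimes> inv b \<in> B"
proof
  assume "B #> a = B #> b"
  then have "a \<in> B #> b" using rcos_self[OF assms(2,1)] by simp
  then obtain h where "h \<in> B" "a = h \<otimes> b" by (auto simp: r_coset_def)
  moreover from this have "h \<in> carrier G" using subgroup.mem_carrier[OF assms(1)] by simp
  ultimately show "a \<otimes> inv b \<in> B" using assms(3) by (simp add: m_assoc)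
next
  assume "a \<otimes> inv b \<in> B"
  then have "(a \<otimes> inv b) \<otimes> b \<in> B #> b" by (auto simp: r_coset_def)
  then have "a \<in> B #> b" using assms by (simp add: m_assoc)
  then show "B #> a = B #> b" using repr_independence[OF _ assms(3,1)] by simp
qed

text \<open>Cosets of an open subgroup form an open cover by disjoint sets, so a finite subcover of
  a compact set already contains every coset that meets it.\<close>

lemma finite_rcos_image:
  assumes "V \<in> COS G T" "bdd C" "C \<subseteq> carrier G"
  shows "finite ((\<lambda>a. V #> a) ` C)"
proof -
  obtain D where D: "compactin T D" "C \<subseteq> D" using assms by (auto simp: bdd_def)
  then have Dc: "D \<subseteq> carrier G" using compactin_subset_topspace by fastforce
  note V = COS_D[OF assms(1)]
  have "D \<subseteq> \<Union>((\<lambda>a. V #> a) ` D)" 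
  proof
    fix d assume "d \<in> D"
    then have "d \<in> V #> d" using rcos_self[OF _ V(1)] Dc by blast
    then show "d \<in> \<Union>((\<lambda>a. V #> a) ` D)" using \<open>d \<in> D\<close> by blast
  qed
  moreover have "\<forall>U\<in>(\<lambda>a. V #> a) ` D. openin T U" using openin_rcos[OF V(2)] Dc by blast
  ultimately obtain \<F> where F: "finite \<F>" "\<F> \<subseteq> (\<lambda>a. V #> a) ` D" "D \<subseteq> \<Union>\<F>"
    using D(1)[unfolded compactin_def, THEN conjunct2, rule_format, of "(\<lambda>a. V #> a) ` D"] by blast
  have "(\<lambda>a. V #> a) ` C \<subseteq> \<F>"
  proof
    fix S assume "S \<in> (\<lambda>a. V #> a) ` C"
    then obtain c where c: "c \<in> C" "S = V #> c" by auto
    then obtain Y where Y: "Y \<in> \<F>" "c \<in> Y" using F D by blast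
    then obtain d where d: "d \<in> D" "Y = V #> d" using F by blast
    then have "V #> d = V #> c" using repr_independence[OF _ _ V(1), of c d] Y Dc by auto
    then show "S \<in> \<F>" using c Y d by simp
  qed
  then show ?thesis using finite_subset F(1) by metis
qed

text \<open>Indices are computed from the right cosets of \<open>B\<close> that \<open>A\<close> meets, so that \<open>B\<close> need not be contained in \<open>A\<close>.\<close>

lemma rel_index_eq:
  assumes "subgroup A G" "subgroup B G"
  shows "rel_index G A B = card ((\<lambda>a. B #> a) ` A)"
proof -
  have sub: "A \<subseteq> carrier G" using assms subgroup.subset by blast
  have i: "subgroup (A \<inter> B) G" using assms subgroups_Inter_pair by blast
  have e: "rcosets\<^bsub>G\<lparr>carrier := A\<rparr>\<^esub> (A \<inter> B) = (\<lambda>a. (A \<inter> B) #> a) ` A"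
    by (auto simp: RCOSETS_def r_coset_def)
  have "(A \<inter> B) #> a = (A \<inter> B) #> b \<longleftrightarrow> B #> a = B #> b" if "a \<in> A" "b \<in> A" for a b
    using rcos_eq_iff[OF i] rcos_eq_iff[OF assms(2)] that sub assms(1)
    by (meson IntE IntI subgroup.m_closed subgroup.m_inv_closed subsetD)
  then have "card ((\<lambda>a. (A \<inter> B) #> a) ` A) = card ((\<lambda>a. B #> a) ` A)"
    by (rule card_image_cong_rel)
  then show ?thesis unfolding rel_index_def e .
qed

lemma finite_rcos_COS:
  assumes "V \<in> COS G T" "A \<in> COS G T" shows "finite ((\<lambda>a. V #> a) ` A)"
  using finite_rcos_image[OF assms(1) bdd_COS[OF assms(2)]] COS_D(4)[OF assms(2)] .

text \<open>A coset of \<open>C\<close> in \<open>A\<close> is determined by the coset of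
  \<open>B\<close> containing it and, after translation by a chosen representative of the latter, by
  a coset of \<open>C\<close> in \<open>B\<close>. The bijection proves the formula also for
  infinite indices, where \<open>card\<close> is 0.\<close>

lemma card_tower:
  assumes "subgroup A G" "subgroup B G" "subgroup C G" "C \<subseteq> B" "B \<subseteq> A"
  shows "card ((\<lambda>a. C #> a) ` A) = card ((\<lambda>a. B #> a) ` A) * card ((\<lambda>a. C #> a) ` B)"
proof -
  have Ac: "A \<subseteq> carrier G" and Bc: "B \<subseteq> carrier G" and Cc: "C \<subseteq> carrier G"
    using assms subgroup.subset by blast+
  \<comment> \<open>The representative is taken in \<open>A\<close>, so that its products with
    elements of \<open>B\<close> stay in \<open>A\<close>.\<close>
  define r where "r S = (SOME a. a \<in> A \<and> S = B #> a)" for S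
  have r: "r S \<in> A" "S = B #> r S" if S: "S \<in> (\<lambda>a. B #> a) ` A" for S
  proof -
    have "\<exists>a. a \<in> A \<and> S = B #> a" using S by auto
    from someI_ex[OF this] show "r S \<in> A" "S = B #> r S" by (auto simp: r_def)
  qed
  have key: "bij_betw (\<lambda>(S,Y). Y #> r S) ((\<lambda>a. B #> a) ` A \<times> (\<lambda>a. C #> a) ` B) ((\<lambda>a. C #> a) ` A)"
  proof (rule bij_betw_imageI)
    show "inj_on (\<lambda>(S,Y). Y #> r S) ((\<lambda>a. B #> a) ` A \<times> (\<lambda>a. C #> a) ` B)"
    proof (rule inj_onI, clarify)
      fix a b a' b' assume h: "a \<in> A" "b \<in> B" "a' \<in> A" "b' \<in> B"
        and e: "C #> b #> r (B #> a) = C #> b' #> r (B #> a')"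
      let ?x = "r (B #> a)" and ?y = "r (B #> a')"
      have x: "?x \<in> A" "B #> a = B #> ?x" "?y \<in> A" "B #> a' = B #> ?y" using r h by blast+
      have c: "b \<in> carrier G" "b' \<in> carrier G" "?x \<in> carrier G" "?y \<in> carrier G" using h x Ac Bc by auto
      have "C #> (b \<otimes> ?x) = C #> (b' \<otimes> ?y)" using e c Cc by (simp add: coset_mult_assoc)
      then have m: "(b \<otimes> ?x) \<otimes> inv (b' \<otimes> ?y) \<in> C" using rcos_eq_iff[OF assms(3)] c by simp
      have "B #> ?x = B #> (b \<otimes> ?x)" using c h assms(2) Bc
        by (metis coset_join2 coset_mult_assoc)
      also have "\<dots> = B #> (b' \<otimes> ?y)" using m assms(2,4) c by (subst rcos_eq_iff) auto
      also have "\<dots> = B #> ?y" using c h assms(2) Bc by (metis coset_join2 coset_mult_assoc)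
      finally have 1: "B #> a = B #> a'" using x by simp
      then have "(b \<otimes> ?x) \<otimes> inv (b' \<otimes> ?x) \<in> C" using m by simp
      moreover have "(b \<otimes> ?x) \<otimes> inv (b' \<otimes> ?x) = b \<otimes> (?x \<otimes> inv ?x) \<otimes> inv b'"
        using c by (simp only: inv_mult_group m_assoc inv_closed m_closed)
      ultimately have "b \<otimes> inv b' \<in> C" using c by simp
      then have "C #> b = C #> b'" using rcos_eq_iff[OF assms(3)] c by simp
      with 1 show "B #> a = B #> a' \<and> C #> b = C #> b'" by simp
    qed
    show "(\<lambda>(S,Y). Y #> r S) ` ((\<lambda>a. B #> a) ` A \<times> (\<lambda>a. C #> a) ` B) = (\<lambda>a. C #> a) ` A"
    proof (intro Set.set_eqI iffI)
      fix Z assume "Z \<in> (\<lambda>(S,Y). Y #> r S) ` ((\<lambda>a. B #> a) ` A \<times> (\<lambda>a. C #> a) ` B)"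
      then obtain a b where h: "a \<in> A" "b \<in> B" "Z = C #> b #> r (B #> a)" by auto
      then have "r (B #> a) \<in> A" using r by blast
      then have "Z = C #> (b \<otimes> r (B #> a))" "b \<otimes> r (B #> a) \<in> A"
        using h Ac Bc Cc assms by (auto simp: coset_mult_assoc subset_iff subgroup.m_closed)
      then show "Z \<in> (\<lambda>a. C #> a) ` A" by blast
    next
      fix Z assume "Z \<in> (\<lambda>a. C #> a) ` A"
      then obtain a where a: "a \<in> A" "Z = C #> a" by auto
      let ?x = "r (B #> a)"
      have x: "?x \<in> A" "B #> a = B #> ?x" using r a by blast+
      have b: "a \<otimes> inv ?x \<in> B" using x a Ac rcos_eq_iff[OF assms(2)] by blast
      have c: "a \<in> carrier G" "?x \<in> carrier G" using a x Ac by auto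
      then have "Z = C #> (a \<otimes> inv ?x \<otimes> ?x)" using a by (simp add: m_assoc)
      then have "Z = C #> (a \<otimes> inv ?x) #> ?x" using c Cc by (simp add: coset_mult_assoc)
      then show "Z \<in> (\<lambda>(S,Y). Y #> r S) ` ((\<lambda>a. B #> a) ` A \<times> (\<lambda>a. C #> a) ` B)"
        using a b by (auto intro!: image_eqI[of _ _ "(B #> a, C #> (a \<otimes> inv ?x))"])
    qed
  qed
  show ?thesis using bij_betw_same_card[OF key] by (simp add: card_cartesian_product)
qed


lemma rel_index_one_iff:
  assumes "subgroup A G" "subgroup B G"
  shows "rel_index G A B = 1 \<longleftrightarrow> A \<subseteq> B"
proof -
  note A = subgroup.mem_carrier[OF assms(1)] and B = subgroup.mem_carrier[OF assms(2)]
  have one: "\<one> \<in> A" "\<one> \<in> B" using assms by (simp_all add: subgroup.one_closed)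
  show ?thesis
  proof
    assume "rel_index G A B = 1"
    then obtain S where "(\<lambda>a. B #> a) ` A = {S}" using assms by (auto simp: rel_index_eq card_1_singleton_iff)
    then have "B #> a = B #> \<one>" if "a \<in> A" for a using that one by blast
    then have "a \<otimes> inv \<one> \<in> B" if "a \<in> A" for a
      using that rcos_eq_iff[OF assms(2) A[OF that] one_closed] by blast
    then show "A \<subseteq> B" using A by auto
  next
    assume AB: "A \<subseteq> B"
    have "(\<lambda>a. B #> a) ` A = {B #> \<one>}"
    proof -
      have "B #> a = B #> \<one>" if "a \<in> A" for a
        using that AB A[OF that] rcos_eq_iff[OF assms(2) A[OF that] one_closed] by auto
      then show ?thesis using one by blast
    qed
    then show "rel_index G A B = 1" using assms by (simp add: rel_index_eq)
  qed
qed

lemma rel_index_le: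
  assumes "subgroup A G" "subgroup A' G" "subgroup B G" "A' \<subseteq> A" "finite ((\<lambda>a. B #> a) ` A)"
  shows "rel_index G A' B \<le> rel_index G A B"
  using assms by (simp add: rel_index_eq card_mono image_mono)

lemma rel_index_pos: "V \<in> COS G T \<Longrightarrow> W \<in> COS G T \<Longrightarrow> rel_index G V W > 0"
  using finite_rcos_COS[of W V] COS_D(1)[of V] COS_D(1)[of W] subgroup.one_closed[of V G]
  by (auto simp: rel_index_eq card_gt_0_iff)

lemma rel_index_tower:
  assumes "subgroup A G" "subgroup B G" "subgroup C G" "C \<subseteq> B" "B \<subseteq> A"
  shows "rel_index G A C = rel_index G A B * rel_index G B C"
  using card_tower[OF assms] assms by (simp add: rel_index_eq)

lemma rel_index_Int:
  assumes "subgroup A G" "subgroup B G"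
  shows "rel_index G A (A \<inter> B) = rel_index G A B"
  by (simp add: rel_index_def Int_assoc[symmetric])

lemma rel_index_image:
  assumes "\<phi> \<in> Aut G T" "subgroup A G" "subgroup B G"
  shows "rel_index G (\<phi> ` A) (\<phi> ` B) = rel_index G A B"
proof -
  note A = subgroup.mem_carrier[OF assms(2)] and B = subgroup.subset[OF assms(3)]
  have sA: "subgroup (\<phi> ` A) G" and sB: "subgroup (\<phi> ` B) G" using assms by (simp_all add: subgroup_image)
  have eq: "(\<lambda>a. \<phi> ` B #> a) ` \<phi> ` A = (\<lambda>a. \<phi> ` B #> \<phi> a) ` A" by (simp add: image_image)
  have "card ((\<lambda>a. \<phi> ` B #> \<phi> a) ` A) = card ((\<lambda>a. B #> a) ` A)"
  proof (rule card_image_cong_rel)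
    fix a b assume ab: "a \<in> A" "b \<in> A"
    have "\<phi> ` B #> \<phi> a = \<phi> ` B #> \<phi> b \<longleftrightarrow> \<phi> (a \<otimes> inv b) \<in> \<phi> ` B"
      using rcos_eq_iff[OF sB] ab A assms(1) by (simp add: Aut_closed Aut_mult Aut_inv)
    also have "\<dots> \<longleftrightarrow> a \<otimes> inv b \<in> B"
      using inj_on_image_mem_iff[OF Aut_inj[OF assms(1), of "carrier G"]] ab A B by simp
    also have "\<dots> \<longleftrightarrow> B #> a = B #> b" using rcos_eq_iff[OF assms(3)] ab A by simp
    finally show "\<phi> ` B #> \<phi> a = \<phi> ` B #> \<phi> b \<longleftrightarrow> B #> a = B #> b" .
  qed
  then show ?thesis using eq assms sA sB by (simp add: rel_index_eq)
qed

text \<open>The index of \<open>U \<inter> V \<inter> W\<close> in \<open>U\<close> dominates the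
  left side and factors through \<open>U \<inter> V\<close>. This is the triangle inequality of
  \<open>cos_dist\<close>, kept separate for the two directions.\<close>

lemma rel_index_triangle:
  assumes "U \<in> COS G T" "V \<in> COS G T" "W \<in> COS G T"
  shows "rel_index G U W \<le> rel_index G U V * rel_index G V W"
proof -
  note U = COS_D[OF assms(1)] and V = COS_D[OF assms(2)] and W = COS_D[OF assms(3)]
  have UV: "U \<inter> V \<in> COS G T" and UVW: "U \<inter> V \<inter> W \<in> COS G T" using assms by (auto intro: COS_Int)
  note sUV = COS_D(1)[OF UV] and sUVW = COS_D(1)[OF UVW]
  have "rel_index G U W = card ((\<lambda>a. W #> a) ` U)" using U W by (simp add: rel_index_eq)
  also have "\<dots> = rel_index G U (U \<inter> W)" using U W by (simp add: rel_index_Int rel_index_eq)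
  also have "\<dots> \<le> rel_index G U (U \<inter> W) * rel_index G (U \<inter> W) (U \<inter> V \<inter> W)"
    using rel_index_pos[OF COS_Int[OF assms(1,3)] UVW] by simp
  also have "\<dots> = rel_index G U (U \<inter> V \<inter> W)"
    using rel_index_tower[OF U(1) COS_D(1)[OF COS_Int[OF assms(1,3)]] sUVW] by (simp add: le_infI1)
  also have "\<dots> = rel_index G U (U \<inter> V) * rel_index G (U \<inter> V) (U \<inter> V \<inter> W)"
    by (rule rel_index_tower[OF U(1) sUV sUVW]) auto
  also have "\<dots> = rel_index G U V * rel_index G (U \<inter> V) W"
    using rel_index_Int[OF U(1) V(1)] rel_index_Int[OF sUV W(1)] by simp
  also have "\<dots> \<le> rel_index G U V * rel_index G V W"
    using rel_index_le[OF V(1) sUV W(1) _ finite_rcos_COS[OF assms(3,2)]] by simp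
  finally show ?thesis .
qed

text \<open>Left factors from \<open>B\<close> do not change the coset of \<open>B\<close>, so
  \<open>A'\<close> meets all cosets that \<open>A\<close> meets.\<close>

lemma rel_index_cover:
  assumes "subgroup A G" "subgroup A' G" "subgroup B G" "A' \<subseteq> A" "A \<subseteq> B <#> A'"
  shows "rel_index G A B = rel_index G A' B"
proof -
  note A' = subgroup.mem_carrier[OF assms(2)] and B = subgroup.mem_carrier[OF assms(3)]
  have "(\<lambda>a. B #> a) ` A \<subseteq> (\<lambda>a. B #> a) ` A'"
  proof
    fix S assume "S \<in> (\<lambda>a. B #> a) ` A"
    then obtain a where a: "a \<in> A" "S = B #> a" by blast
    then obtain b a' where ba: "b \<in> B" "a' \<in> A'" "a = b \<otimes> a'" using assms(5) by (auto simp: set_mult_def)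
    have "B #> a = B #> a'" using ba A'[OF ba(2)] B[OF ba(1)]
      by (subst rcos_eq_iff[OF assms(3)]) (simp_all add: m_assoc)
    then show "S \<in> (\<lambda>a. B #> a) ` A'" using a ba by blast
  qed
  then have "(\<lambda>a. B #> a) ` A = (\<lambda>a. B #> a) ` A'" using assms(4) by blast
  then show ?thesis using assms by (simp add: rel_index_eq)
qed

text \<open>A converse to \<open>rel_index_cover\<close>: among finitely many cosets, equal counts
  mean equal sets of cosets. In this way equalities of indices become factorizations of
  elements.\<close>

lemma rel_index_eq_cover:
  assumes "subgroup A G" "subgroup A' G" "subgroup B G" "A' \<subseteq> A" "finite ((\<lambda>a. B #> a) ` A)"
    "rel_index G A B \<le> rel_index G A' B"
  shows "A \<subseteq> (B \<inter> A) <#> A'"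
proof
  note A = subgroup.mem_carrier[OF assms(1)] and B = subgroup.mem_carrier[OF assms(3)]
  have e: "(\<lambda>a. B #> a) ` A' = (\<lambda>a. B #> a) ` A"
    using assms by (intro card_seteq) (auto simp: rel_index_eq)
  fix a assume a: "a \<in> A"
  then obtain a' where a': "a' \<in> A'" "B #> a = B #> a'" using e by blast
  have b: "a \<otimes> inv a' \<in> B" using rcos_eq_iff[OF assms(3) A[OF a] A] a' assms(4) by auto
  have a'A: "a' \<in> A" using a' assms(4) by blast
  then have "a \<otimes> inv a' \<in> A" using a assms(1) by (simp add: subgroup.m_closed subgroup.m_inv_closed)
  moreover have "a = (a \<otimes> inv a') \<otimes> a'" using A[OF a] A[OF a'A] by (simp add: m_assoc)
  ultimately show "a \<in> (B \<inter> A) <#> A'" using a' b unfolding set_mult_def by blast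
qed

text \<open>The admissible first factors of \<open>x = a \<otimes> (inv a \<otimes> x)\<close> form
  closed subsets of the compact set \<open>V\<close>, one for each index, and \<open>fin\<close> is
  their finite intersection property. All passages from finitely many to infinitely many conditions
  on a factorization use this form.\<close>

lemma compact_factor:
  assumes V: "V \<in> COS G T" and x: "x \<in> carrier G" and I: "I \<noteq> {}"
    and A: "\<And>i. i \<in> I \<Longrightarrow> closedin T (A i)" and B: "\<And>i. i \<in> I \<Longrightarrow> closedin T (B i)"
    and fin: "\<And>J. finite J \<Longrightarrow> J \<noteq> {} \<Longrightarrow> J \<subseteq> I \<Longrightarrow>
      \<exists>a\<in>V. (\<forall>i\<in>J. a \<in> A i \<and> inv a \<otimes> x \<in> B i)"
  shows "\<exists>a\<in>V. \<forall>i\<in>I. a \<in> A i \<and> inv a \<otimes> x \<in> B i"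
proof -
  have c: "continuous_map T T (\<lambda>a. inv a \<otimes> x)"
    using x by (intro continuous_mult_fun continuous_inv) simp
  define S where "S i = A i \<inter> {a \<in> topspace T. inv a \<otimes> x \<in> B i}" for i
  have S: "closedin T (S i)" if "i \<in> I" for i
    unfolding S_def by (intro closedin_Int A that closedin_continuous_map_preimage[OF c] B)
  have "V \<inter> \<Inter>(S ` I) \<noteq> {}"
  proof (rule compactin_fip[THEN iffD1, THEN conjunct2, rule_format, OF COS_D(3)[OF V]], intro conjI ballI allI impI)
    show "closedin T C" if "C \<in> S ` I" for C using that S by blast
    fix \<F> assume F: "finite \<F> \<and> \<F> \<subseteq> S ` I"
    then obtain J where J: "finite J" "J \<subseteq> I" "\<F> = S ` J" by (meson finite_subset_image)
    show "V \<inter> \<Inter>\<F> \<noteq> {}"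
    proof (cases "J = {}")
      case True
      then show ?thesis using J subgroup.one_closed[OF COS_D(1)[OF V]] by auto
    next
      case False
      then obtain a where "a \<in> V" "\<forall>i\<in>J. a \<in> A i \<and> inv a \<otimes> x \<in> B i" using fin[OF J(1) _ J(2)] by blast
      then have "a \<in> V \<inter> \<Inter>\<F>" using J COS_D(4)[OF V] unfolding S_def by auto
      then show ?thesis by blast
    qed
  qed
  then show ?thesis unfolding S_def by auto
qed

end


section \<open>Multiplicative subgroups and the scale\<close>

lemma nat_power_growth:
  fixes a t c :: nat
  assumes "\<And>n. t ^ n \<le> c * a ^ n" "a > 0"
  shows "t \<le> a"
proof (rule ccontr)
  assume "\<not> t \<le> a"
  then have t: "t \<ge> a + 1" by simp
  \<comment> \<open>Chosen so that Bernoulli's inequality yields \<open>1 + c\<close>, one more than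
    the hypothesis permits.\<close>
  define n where "n = c * a"
  have "1 + real n * (1 / real a) \<le> (1 + 1 / real a) ^ n"
    by (rule Bernoulli_inequality) (use assms(2) in \<open>simp add: field_simps\<close>)
  moreover have "(1 + 1 / real a) ^ n * real a ^ n = real (a + 1) ^ n"
    using assms(2) by (simp add: power_mult_distrib[symmetric] field_simps)
  moreover have "real n * (1 / real a) = real c" using assms(2) by (simp add: n_def)
  ultimately have "(1 + real c) * real a ^ n \<le> real (a + 1) ^ n"
    by (metis mult_right_mono of_nat_0_le_iff zero_le_power)
  also have "\<dots> \<le> real t ^ n" using t by (intro power_mono) auto
  also have "\<dots> = real (t ^ n)" by simp
  also have "\<dots> \<le> real (c * a ^ n)" using assms(1)[of n] by (rule of_nat_mono)
  also have "\<dots> = real c * real a ^ n" by simp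
  finally have "real a ^ n \<le> 0" by (simp add: algebra_simps)
  moreover have "real a ^ n > 0" using assms(2) by simp
  ultimately show False by linarith
qed

context tdlc
begin

section \<open>Positive and negative parts, tidiness above\<close>

lemma solve_right: "a = p \<otimes> q \<Longrightarrow> p \<in> carrier G \<Longrightarrow> q \<in> carrier G \<Longrightarrow> p = a \<otimes> inv q"
  by (simp add: m_assoc)
lemma solve_left: "a = p \<otimes> q \<Longrightarrow> p \<in> carrier G \<Longrightarrow> q \<in> carrier G \<Longrightarrow> q = inv p \<otimes> a"
  by (simp add: m_assoc[symmetric])

text \<open>The intersections of \<phi>^j(S) over j \<ge> 0, over j \<le> 0 and over 0 \<le> j \<le>
  n. Described through orbits of points, membership becomes arithmetic with exponents.\<close>

definition pos where "pos \<phi> S = {x \<in> carrier G. \<forall>j::nat. ev \<phi> (- int j) x \<in> S}"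
definition neg where "neg \<phi> S = {x \<in> carrier G. \<forall>j::nat. ev \<phi> (int j) x \<in> S}"
definition lev where "lev \<phi> S n = {x \<in> carrier G. \<forall>j::nat\<le>n. ev \<phi> (- int j) x \<in> S}"

lemma pos_inv: "\<phi> \<in> Aut G T \<Longrightarrow> pos (ainv \<phi>) S = neg \<phi> S"
  by (simp add: pos_def neg_def ev_inv)
lemma neg_inv: "\<phi> \<in> Aut G T \<Longrightarrow> neg (ainv \<phi>) S = pos \<phi> S"
  by (simp add: pos_def neg_def ev_inv)

lemma pos_subset: "pos \<phi> S \<subseteq> S"
proof
  fix x assume x: "x \<in> pos \<phi> S"
  then have "ev \<phi> (- int 0) x \<in> S" unfolding pos_def by blast
  then show "x \<in> S" using x by (simp add: pos_def)
qed
lemma neg_subset: "neg \<phi> S \<subseteq> S"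
proof
  fix x assume x: "x \<in> neg \<phi> S"
  then have "ev \<phi> (int 0) x \<in> S" unfolding neg_def by blast
  then show "x \<in> S" using x by (simp add: neg_def)
qed
lemma lev_subset: "lev \<phi> S n \<subseteq> S"
proof
  fix x assume x: "x \<in> lev \<phi> S n"
  then have "ev \<phi> (- int 0) x \<in> S" unfolding lev_def by blast
  then show "x \<in> S" using x by (simp add: lev_def)
qed

lemma pos_carrier: "pos \<phi> S \<subseteq> carrier G" by (auto simp: pos_def)
lemma neg_carrier: "neg \<phi> S \<subseteq> carrier G" by (auto simp: neg_def)
lemma lev_carrier: "lev \<phi> S n \<subseteq> carrier G" by (auto simp: lev_def)

lemma subgroup_pos: assumes "\<phi> \<in> Aut G T" "subgroup S G" shows "subgroup (pos \<phi> S) G"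
proof (rule subgroupI)
  show "pos \<phi> S \<noteq> {}" using assms subgroup.one_closed[OF assms(2)] by (auto simp: pos_def intro!: exI[of _ \<one>])
qed (use assms in \<open>auto simp: pos_def subgroup.m_closed subgroup.m_inv_closed\<close>)

lemma subgroup_neg: assumes "\<phi> \<in> Aut G T" "subgroup S G" shows "subgroup (neg \<phi> S) G"
  using subgroup_pos[of "ainv \<phi>" S] assms by (simp add: pos_inv)

lemma posD: "x \<in> pos \<phi> S \<Longrightarrow> j \<le> 0 \<Longrightarrow> ev \<phi> j x \<in> S"
proof -
  assume x: "x \<in> pos \<phi> S" and j: "j \<le> 0"
  have "ev \<phi> (- int (nat (- j))) x \<in> S" using x unfolding pos_def by blast
  then show ?thesis using j by simp
qed
lemma negD: "x \<in> neg \<phi> S \<Longrightarrow> 0 \<le> j \<Longrightarrow> ev \<phi> j x \<in> S"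
proof -
  assume x: "x \<in> neg \<phi> S" and j: "0 \<le> j"
  have "ev \<phi> (int (nat j)) x \<in> S" using x unfolding neg_def by blast
  then show ?thesis using j by simp
qed
lemma posI: "x \<in> carrier G \<Longrightarrow> (\<And>j. j \<le> 0 \<Longrightarrow> ev \<phi> j x \<in> S) \<Longrightarrow> x \<in> pos \<phi> S" by (auto simp: pos_def)
lemma negI: "x \<in> carrier G \<Longrightarrow> (\<And>j. 0 \<le> j \<Longrightarrow> ev \<phi> j x \<in> S) \<Longrightarrow> x \<in> neg \<phi> S" by (auto simp: neg_def)

lemma levD: "x \<in> lev \<phi> S n \<Longrightarrow> - int n \<le> j \<Longrightarrow> j \<le> 0 \<Longrightarrow> ev \<phi> j x \<in> S"
proof -
  assume x: "x \<in> lev \<phi> S n" and j: "- int n \<le> j" "j \<le> 0"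
  have "\<forall>i\<le>n. ev \<phi> (- int i) x \<in> S" using x unfolding lev_def by blast
  moreover have "nat (- j) \<le> n" using j by simp
  ultimately have "ev \<phi> (- int (nat (- j))) x \<in> S" by blast
  then show ?thesis using j by simp
qed
lemma levI: "x \<in> carrier G \<Longrightarrow> (\<And>j. - int n \<le> j \<Longrightarrow> j \<le> 0 \<Longrightarrow> ev \<phi> j x \<in> S) \<Longrightarrow> x \<in> lev \<phi> S n" by (auto simp: lev_def)

lemma ev_pos: "\<phi> \<in> Aut G T \<Longrightarrow> x \<in> pos \<phi> S \<Longrightarrow> j \<le> 0 \<Longrightarrow> ev \<phi> j x \<in> pos \<phi> S"
  using pos_carrier[of \<phi> S] posD[of x \<phi> S] by (intro posI) (auto simp: ev_ev subset_iff)
lemma ev_neg: "\<phi> \<in> Aut G T \<Longrightarrow> x \<in> neg \<phi> S \<Longrightarrow> 0 \<le> j \<Longrightarrow> ev \<phi> j x \<in> neg \<phi> S"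
  using neg_carrier[of \<phi> S] negD[of x \<phi> S] by (intro negI) (auto simp: ev_ev subset_iff)

lemma lev_eq:
  assumes "\<phi> \<in> Aut G T" "S \<subseteq> carrier G" shows "lev \<phi> S n = (\<Inter>j\<in>{..n}. ev \<phi> (int j) ` S)"
proof -
  have "x \<in> carrier G" if "x \<in> (\<Inter>j\<in>{..n}. ev \<phi> (int j) ` S)" for x
  proof -
    have "x \<in> ev \<phi> (int 0) ` S" using that by blast
    then show ?thesis using assms(2) by auto
  qed
  then show ?thesis using assms unfolding lev_def by (auto simp: mem_ev_image[OF assms(1) _ assms(2)])
      (metis atMost_iff mem_ev_image)
qed

lemma COS_lev: "\<phi> \<in> Aut G T \<Longrightarrow> V \<in> COS G T \<Longrightarrow> lev \<phi> V n \<in> COS G T"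
  by (subst lev_eq) (auto intro!: COS_INT COS_image COS_D)

lemma pos_eq_lev: "pos \<phi> S = (\<Inter>n. lev \<phi> S n)"
  by (auto simp: pos_def lev_def)

lemma closedin_pos: assumes "\<phi> \<in> Aut G T" "V \<in> COS G T" shows "closedin T (pos \<phi> V)"
  unfolding pos_eq_lev using COS_closed[OF COS_lev[OF assms]] by (intro closedin_INT) auto
lemma closedin_neg: assumes "\<phi> \<in> Aut G T" "V \<in> COS G T" shows "closedin T (neg \<phi> V)"
  using closedin_pos[of "ainv \<phi>" V] assms by (simp add: pos_inv)

lemma lev_antimono: "m \<le> n \<Longrightarrow> lev \<phi> S n \<subseteq> lev \<phi> S m" by (auto simp: lev_def)

lemma lev_lev: assumes "\<phi> \<in> Aut G T" shows "lev \<phi> (lev \<phi> S m) n = lev \<phi> S (m + n)"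
proof (intro Set.set_eqI iffI)
  fix x assume x: "x \<in> lev \<phi> (lev \<phi> S m) n"
  then have c: "x \<in> carrier G" by (simp add: lev_def)
  show "x \<in> lev \<phi> S (m + n)"
  proof (rule levI[OF c])
    fix j assume j: "- int (m + n) \<le> j" "j \<le> 0"
    have "ev \<phi> (max j (- int n)) x \<in> lev \<phi> S m" using levD[OF x] j by auto
    then have "ev \<phi> (j - max j (- int n)) (ev \<phi> (max j (- int n)) x) \<in> S"
      by (rule levD) (use j in auto)
    then show "ev \<phi> j x \<in> S" using assms c by (simp add: ev_ev)
  qed
next
  fix x assume x: "x \<in> lev \<phi> S (m + n)"
  then have c: "x \<in> carrier G" by (simp add: lev_def)
  show "x \<in> lev \<phi> (lev \<phi> S m) n"
    using assms c levD[OF x] by (intro levI) (auto simp: ev_ev)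
qed

definition tidy_above where
  "tidy_above \<phi> V \<longleftrightarrow> (\<forall>x\<in>V. \<exists>a\<in>neg \<phi> V. \<exists>b\<in>pos \<phi> V. x = a \<otimes> b)"

text \<open>As the index does not drop for \<open>lev \<phi> V n\<close>, the image of
  \<open>lev \<phi> V n\<close> meets every coset of \<open>V\<close> that \<phi>(V) meets.
  Compactness gives one splitting with a factor in \<open>pos\<close>. Iteration keeps the forward
  orbit of the other factor in \<open>V\<close> for longer and longer times, and compactness once
  more produces a factor in \<open>neg\<close>.\<close>

lemma tidy_above_if_index_const:
  assumes \<phi>: "\<phi> \<in> Aut G T" and V: "V \<in> COS G T"
    and const: "\<And>n. rel_index G (\<phi> ` V) V \<le> rel_index G (\<phi> ` lev \<phi> V n) (lev \<phi> V n)"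
  shows "tidy_above \<phi> V"
proof -
  let ?i = "ev \<phi> (-1)"
  note Vc = COS_D(4)[OF V] and sV = COS_D(1)[OF V]
  note mulc = subgroup.m_closed[OF sV] subgroup.m_inv_closed[OF sV]
  have i: "?i = ainv \<phi>" using ev_minus[OF \<phi>, of 1] \<phi> by simp
  have lc: "lev \<phi> V n \<in> COS G T" for n using COS_lev[OF \<phi> V] .
  have mem: "y \<in> \<phi> ` lev \<phi> V n \<longleftrightarrow> ?i y \<in> lev \<phi> V n" if "y \<in> carrier G" for y n
    using image_iff_inv[OF \<phi> that lev_carrier] i by simp
  \<comment> \<open>A point of \<open>V\<close> whose predecessor is in
    \<open>lev \<phi> V n\<close> is itself in \<open>lev \<phi> V n\<close>. So both indices in
    \<open>const\<close> can be counted with cosets of the same group \<open>V\<close>.\<close>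
  have cap: "\<phi> ` lev \<phi> V n \<inter> lev \<phi> V n = \<phi> ` lev \<phi> V n \<inter> V" for n
  proof -
    have "y \<in> lev \<phi> V n" if y: "y \<in> \<phi> ` lev \<phi> V n" "y \<in> V" for y
    proof -
      have c: "y \<in> carrier G" using y Vc by blast
      have l: "?i y \<in> lev \<phi> V n" using mem[OF c] y by simp
      have "ev \<phi> (- int j) y \<in> V" if "j \<le> n" for j
      proof (cases j)
        case 0 then show ?thesis using y c by simp
      next
        case (Suc k)
        then have "ev \<phi> (- int k) (?i y) \<in> V" using l that by (simp add: lev_def)
        moreover have "- int k + - 1 = - int j" using Suc by simp
        ultimately show ?thesis using \<phi> c by (simp add: ev_ev)
      qed
      then show ?thesis using c by (simp add: lev_def)
    qed
    then show ?thesis using lev_subset[of \<phi> V n] by blast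
  qed
  have cover: "\<phi> ` V \<subseteq> (V \<inter> \<phi> ` V) <#> \<phi> ` lev \<phi> V n" for n
  proof (rule rel_index_eq_cover)
    show "rel_index G (\<phi> ` V) V \<le> rel_index G (\<phi> ` lev \<phi> V n) V"
      using const[of n] cap[of n] by (simp add: rel_index_def)
  next
    show "\<phi> ` lev \<phi> V n \<subseteq> \<phi> ` V" using lev_subset by (intro image_mono)
  qed (use \<phi> V lc COS_image finite_rcos_COS COS_D in \<open>auto simp: subgroup_image\<close>)
  have step: "\<exists>a b. b \<in> pos \<phi> V \<and> a \<in> V \<and> \<phi> a \<in> V \<and> x = a \<otimes> b" if x: "x \<in> V" for x
  proof -
    have xc: "x \<in> carrier G" using x Vc by blast
    have yc: "\<phi> x \<in> carrier G" using \<phi> xc by (simp add: Aut_closed)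
    have "\<exists>a\<in>V. \<forall>n\<in>(UNIV::nat set). a \<in> V \<and> inv a \<otimes> \<phi> x \<in> \<phi> ` lev \<phi> V n"
    proof (rule compact_factor[OF V yc])
      fix J :: "nat set" assume J: "finite J" "J \<noteq> {}"
      obtain a z where az: "a \<in> V" "z \<in> \<phi> ` lev \<phi> V (Max J)" "\<phi> x = a \<otimes> z"
        using subsetD[OF cover[of "Max J"] imageI[OF x]] unfolding set_mult_def by blast
      have ac: "a \<in> carrier G" "z \<in> carrier G" using az Vc COS_D(4)[OF COS_image[OF \<phi> lc]] by blast+
      then have "inv a \<otimes> \<phi> x = z" using az by (simp add: m_assoc[symmetric])
      then have "inv a \<otimes> \<phi> x \<in> \<phi> ` lev \<phi> V n" if "n \<in> J" for n
        using az(2) lev_antimono[of n "Max J" \<phi> V] J that by auto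
      then show "\<exists>a\<in>V. \<forall>i\<in>J. a \<in> V \<and> inv a \<otimes> \<phi> x \<in> \<phi> ` lev \<phi> V i" using az by blast
    qed (use V COS_closed COS_image[OF \<phi> lc] in auto)
    then obtain a where a: "a \<in> V" "\<And>n. inv a \<otimes> \<phi> x \<in> \<phi> ` lev \<phi> V n" by blast
    have ac: "a \<in> carrier G" using a Vc by blast
    define b where "b = ?i (inv a \<otimes> \<phi> x)"
    have bp: "b \<in> pos \<phi> V" unfolding pos_eq_lev b_def using a(2) mem ac yc by blast
    have bc: "b \<in> carrier G" "b \<in> V" using bp pos_carrier pos_subset by blast+
    have "?i (\<phi> x) = x" using \<phi> xc i by (simp add: inv_apply)
    then have b: "b = inv (?i a) \<otimes> x" using ac yc \<phi> by (simp add: b_def)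
    have e: "x = ?i a \<otimes> b" using b ac \<phi> xc by (simp add: m_assoc[symmetric])
    have "?i a = x \<otimes> inv b" using e ac \<phi> bc xc by (intro solve_right) auto
    then have "?i a \<in> V" using x bc mulc by simp
    moreover have "\<phi> (?i a) \<in> V" using a ac \<phi> i by (simp add: inv_apply)
    ultimately show ?thesis using e bp by blast
  qed
  \<comment> \<open>In the induction \<phi>^n(a) is split once more by \<open>step\<close>; its
    positive factor is carried back by \<phi>^(-n), under which \<open>pos\<close> is stable, and
    absorbed into \<open>b\<close>.\<close>
  have steps: "\<exists>a b. b \<in> pos \<phi> V \<and> a \<in> carrier G \<and> x = a \<otimes> b \<and> (\<forall>j\<le>n. ev \<phi> (int j) a \<in> V)" if x: "x \<in> V" for x n
  proof (induction n)
    case 0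
    show ?case using x Vc subgroup.one_closed[OF subgroup_pos[OF \<phi> sV]]
      by (intro exI[of _ x] exI[of _ \<one>]) auto
  next
    case (Suc n)
    then obtain a b where ab: "b \<in> pos \<phi> V" "x = a \<otimes> b" "\<forall>j\<le>n. ev \<phi> (int j) a \<in> V" and ac: "a \<in> carrier G" by blast
    have bc: "b \<in> carrier G" using ab pos_carrier by blast
    obtain a' b' where a': "b' \<in> pos \<phi> V" "a' \<in> V" "\<phi> a' \<in> V" "ev \<phi> (int n) a = a' \<otimes> b'"
      using step ab(3) by blast
    have c': "a' \<in> carrier G" "b' \<in> carrier G" using a' Vc pos_carrier by blast+
    let ?a = "ev \<phi> (- int n) a'" and ?b = "ev \<phi> (- int n) b'"
    have "ev \<phi> (- int n) (ev \<phi> (int n) a) = ?a \<otimes> ?b" using a' c' \<phi> by simp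
    then have e: "a = ?a \<otimes> ?b" using \<phi> ac by (simp add: ev_ev)
    have ea: "?a = a \<otimes> inv ?b" using e c' ac \<phi> by (intro solve_right) auto
    have "?b \<in> pos \<phi> V" by (rule ev_pos[OF \<phi> a'(1)]) simp
    then have "?b \<otimes> b \<in> pos \<phi> V" using ab(1) subgroup.m_closed[OF subgroup_pos[OF \<phi> sV]] by simp
    moreover have "x = ?a \<otimes> (?b \<otimes> b)"
    proof -
      have "x = (?a \<otimes> ?b) \<otimes> b" using ab(2) e by simp
      then show ?thesis using c' bc \<phi> by (simp add: m_assoc)
    qed
    moreover have "ev \<phi> (int j) ?a \<in> V" if "j \<le> Suc n" for j
    proof (cases "j = Suc n")
      case True
      have "ev \<phi> (int j) ?a = ev \<phi> 1 a'" using True \<phi> c' by (simp add: ev_ev del: ev_1)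
      then show ?thesis using a' \<phi> by simp
    next
      case False
      then have j: "j \<le> n" using that by simp
      have "ev \<phi> (int j) ?b \<in> V" using posD[OF a'(1), of "int j - int n"] j \<phi> c' by (simp add: ev_ev)
      then show ?thesis using ea ab(3) j \<phi> c' ac mulc by simp
    qed
    ultimately show ?case using c' \<phi> by (intro exI[of _ ?a] exI[of _ "?b \<otimes> b"]) simp
  qed
  show ?thesis unfolding tidy_above_def
  proof
    fix x assume x: "x \<in> V"
    then have xc: "x \<in> carrier G" using Vc by blast
    let ?l = "lev (ainv \<phi>) V"
    have l: "?l n = {a \<in> carrier G. \<forall>j\<le>n. ev \<phi> (int j) a \<in> V}" for n
      using \<phi> by (simp add: lev_def ev_inv)
    have "\<exists>a\<in>V. \<forall>n\<in>(UNIV::nat set). a \<in> ?l n \<and> inv a \<otimes> x \<in> pos \<phi> V"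
    proof (rule compact_factor[OF V xc])
      fix J :: "nat set" assume J: "finite J" "J \<noteq> {}"
      obtain a b where ab: "b \<in> pos \<phi> V" "x = a \<otimes> b" "\<forall>j\<le>Max J. ev \<phi> (int j) a \<in> V" "a \<in> carrier G"
        using steps[OF x, of "Max J"] by blast
      have "inv a \<otimes> x = b" using ab pos_carrier[of \<phi> V] by (auto simp: m_assoc[symmetric])
      moreover have "a \<in> ?l n" if "n \<in> J" for n
        using ab Max_ge[OF J(1) that] unfolding l by (auto dest: le_trans)
      moreover have "a \<in> V" using ab(3)[rule_format, of 0] ab(4) by simp
      ultimately show "\<exists>a\<in>V. \<forall>i\<in>J. a \<in> ?l i \<and> inv a \<otimes> x \<in> pos \<phi> V" using ab by blast
    qed (use \<phi> V COS_closed COS_lev closedin_pos in auto)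
    then obtain a where a: "a \<in> V" "\<And>n. a \<in> ?l n" "inv a \<otimes> x \<in> pos \<phi> V" by blast
    then have "a \<in> neg \<phi> V" unfolding l neg_def by blast
    moreover have "x = a \<otimes> (inv a \<otimes> x)" using a(1) Vc xc by (auto simp: m_assoc[symmetric])
    ultimately show "\<exists>a\<in>neg \<phi> V. \<exists>b\<in>pos \<phi> V. x = a \<otimes> b" using a(3) by blast
  qed
qed


text \<open>Indices are natural numbers, so some \<open>m\<close> minimizes the index of
  \<open>lev \<phi> V m\<close>. As \<open>lev\<close> of a \<open>lev\<close> is again a
  \<open>lev\<close>, minimality is just the hypothesis of
  \<open>tidy_above_if_index_const\<close>.\<close>

lemma ex_tidy_above:
  assumes "\<phi> \<in> Aut G T" "V \<in> COS G T"
  shows "\<exists>m. tidy_above \<phi> (lev \<phi> V m)"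
proof -
  let ?f = "\<lambda>n. rel_index G (\<phi> ` lev \<phi> V n) (lev \<phi> V n)"
  obtain m where m: "\<And>n. ?f m \<le> ?f n" using ex_has_least_nat[of "\<lambda>_. True" 0 ?f] by blast
  have "tidy_above \<phi> (lev \<phi> V m)"
    by (rule tidy_above_if_index_const[OF assms(1) COS_lev[OF assms]]) (simp add: lev_lev[OF assms(1)] m)
  then show ?thesis ..
qed

text \<open>The obstruction to tidiness below: elements that leave \<open>V\<close> and return to it in both time directions.\<close>

definition ell where
  "ell \<phi> V = {x \<in> carrier G. \<exists>n::nat. \<forall>j. int n \<le> j \<longrightarrow> ev \<phi> j x \<in> V \<and> ev \<phi> (- j) x \<in> V}"

lemma subgroup_ell:
  assumes "\<phi> \<in> Aut G T" "subgroup V G" shows "subgroup (ell \<phi> V) G"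
proof (rule subgroupI)
  show "ell \<phi> V \<subseteq> carrier G" by (auto simp: ell_def)
  show "ell \<phi> V \<noteq> {}" using assms subgroup.one_closed[OF assms(2)] by (auto simp: ell_def intro!: exI[of _ \<one>])
  show "inv x \<in> ell \<phi> V" if xl: "x \<in> ell \<phi> V" for x
  proof -
    obtain n :: nat where n: "\<forall>j. int n \<le> j \<longrightarrow> ev \<phi> j x \<in> V \<and> ev \<phi> (- j) x \<in> V" and c: "x \<in> carrier G"
      using xl unfolding ell_def by blast
    then have "\<forall>j. int n \<le> j \<longrightarrow> ev \<phi> j (inv x) \<in> V \<and> ev \<phi> (- j) (inv x) \<in> V"
      using assms by (auto simp: subgroup.m_inv_closed)
    then show ?thesis using c unfolding ell_def by blast
  qed
  show "x \<otimes> y \<in> ell \<phi> V" if xy: "x \<in> ell \<phi> V" "y \<in> ell \<phi> V" for x y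
  proof -
    obtain m n :: nat where m: "\<forall>j. int m \<le> j \<longrightarrow> ev \<phi> j x \<in> V \<and> ev \<phi> (- j) x \<in> V"
      and n: "\<forall>j. int n \<le> j \<longrightarrow> ev \<phi> j y \<in> V \<and> ev \<phi> (- j) y \<in> V" using xy by (auto simp: ell_def)
    then have "\<forall>j. int (max m n) \<le> j \<longrightarrow> ev \<phi> j (x \<otimes> y) \<in> V \<and> ev \<phi> (- j) (x \<otimes> y) \<in> V"
      using xy assms by (auto simp: ell_def subgroup.m_closed)
    then show ?thesis using xy unfolding ell_def by blast
  qed
qed

lemma ev_ell: assumes "\<phi> \<in> Aut G T" "x \<in> ell \<phi> V" shows "ev \<phi> i x \<in> ell \<phi> V"
proof -
  obtain m :: nat where m: "\<forall>j. int m \<le> j \<longrightarrow> ev \<phi> j x \<in> V \<and> ev \<phi> (- j) x \<in> V" and c: "x \<in> carrier G"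
    using assms by (auto simp: ell_def)
  have "ev \<phi> j (ev \<phi> i x) \<in> V \<and> ev \<phi> (- j) (ev \<phi> i x) \<in> V" if j: "int (m + nat \<bar>i\<bar>) \<le> j" for j
  proof -
    have "int m \<le> j + i" "int m \<le> j - i" using j by auto
    then show ?thesis using m[rule_format, of "j + i"] m[rule_format, of "j - i"] assms(1) c by (simp add: ev_ev)
  qed
  then have "\<forall>j. int (m + nat \<bar>i\<bar>) \<le> j \<longrightarrow> ev \<phi> j (ev \<phi> i x) \<in> V \<and> ev \<phi> (- j) (ev \<phi> i x) \<in> V" by blast
  then show ?thesis using ev_closed[OF assms(1) c, of i] unfolding ell_def by blast
qed

text \<open>Backward iteration brings every element of \<open>ell\<close> into \<open>pos\<close>.
  The elements of \<open>ell\<close> that are one step away from \<open>pos\<close> lie in finitely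
  many left cosets of \<open>V\<close>, and finitely many representatives share a time
  \<open>N\<close> after which their forward orbits stay in \<open>V\<close>. Dividing by
  representatives lowers the number of steps down to \<open>N\<close>, at the cost of factors in
  \<open>V\<close>.\<close>

lemma ell_bounded:
  assumes \<phi>: "\<phi> \<in> Aut G T" and V: "V \<in> COS G T"
  shows "\<exists>N. ell \<phi> V \<subseteq> V <#> ev \<phi> N ` V"
proof -
  note Vc = COS_D(4)[OF V] and sV = COS_D(1)[OF V]
  let ?L = "ell \<phi> V" and ?P = "pos \<phi> V"
  note sL = subgroup_ell[OF \<phi> sV] and sP = subgroup_pos[OF \<phi> sV]
  define E where "E = {z \<in> ?L. ev \<phi> (-1) z \<in> ?P}"
  \<comment> \<open>The right coset of the inverse encodes the left coset of \<open>z\<close>: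
    equality of \<open>f x\<close> and \<open>f z\<close> means that
    \<open>inv x \<otimes> z\<close> is in \<open>V\<close>.\<close>
  define f where "f z = V #> inv z" for z
  have Ec: "z \<in> carrier G" if "z \<in> E" for z using that by (auto simp: E_def ell_def)
  have EV: "inv z \<in> \<phi> ` V" if z: "z \<in> E" for z
  proof -
    have "ev \<phi> (-1) (inv z) \<in> V" using z Ec[OF z] \<phi> pos_subset[of \<phi> V] sV
      by (auto simp: E_def subgroup.m_inv_closed)
    then show ?thesis using mem_ev_image[OF \<phi> inv_closed[OF Ec[OF z]] Vc, of 1] \<phi> by simp
  qed
  have "finite (f ` E)"
    using EV by (intro finite_subset[OF _ finite_rcos_COS[OF V COS_image[OF \<phi> V]]]) (auto simp: f_def)
  moreover have "\<forall>y\<in>f ` E. \<exists>n::nat. \<exists>x\<in>E. f x = y \<and> (\<forall>j. int n \<le> j \<longrightarrow> ev \<phi> j x \<in> V)"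
    by (fastforce simp: E_def ell_def)
  ultimately obtain h where h: "finite (f ` E)"
    "\<forall>y\<in>f ` E. \<exists>x\<in>E. f x = y \<and> (\<forall>j. int (h y :: nat) \<le> j \<longrightarrow> ev \<phi> j x \<in> V)"
    using bchoice[of "f ` E" "\<lambda>y n. \<exists>x\<in>E. f x = y \<and> (\<forall>j. int n \<le> j \<longrightarrow> ev \<phi> j x \<in> V)"] by auto
  define N where "N = Max (h ` f ` E)"
  have rep: "\<exists>x\<in>E. f x = f z \<and> (\<forall>j. int N \<le> j \<longrightarrow> ev \<phi> j x \<in> V)" if z: "z \<in> E" for z
  proof -
    have "h (f z) \<le> N" unfolding N_def using h(1) z by (intro Max_ge) auto
    moreover obtain x where "x \<in> E" "f x = f z" "\<forall>j. int (h (f z)) \<le> j \<longrightarrow> ev \<phi> j x \<in> V"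
      using h(2) z by blast
    ultimately show ?thesis by (meson of_nat_mono order_trans)
  qed
  have main: "y \<in> ?L \<Longrightarrow> ev \<phi> (- int n) y \<in> ?P \<Longrightarrow> y \<in> V <#> ev \<phi> (int N) ` ?P" if "N \<le> n" for n y
    using that
  proof (induction n arbitrary: y rule: dec_induct)
    case base
    have c: "y \<in> carrier G" using base by (simp add: ell_def)
    then have "y \<in> ev \<phi> (int N) ` ?P" using mem_ev_image[OF \<phi> c pos_carrier] base by simp
    then have "\<one> \<otimes> y \<in> V <#> ev \<phi> (int N) ` ?P" using subgroup.one_closed[OF sV] unfolding set_mult_def by blast
    then show ?case using c by simp
  next
    case (step n)
    have c: "y \<in> carrier G" using step by (simp add: ell_def)
    define z where "z = ev \<phi> (- int n) y"
    have "ev \<phi> (-1) z = ev \<phi> (- int (Suc n)) y" using \<phi> c by (simp add: z_def ev_ev algebra_simps)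
    then have z: "z \<in> E" using step ev_ell[OF \<phi>] by (simp add: E_def z_def)
    then obtain x where x: "x \<in> E" "f x = f z" "\<forall>j. int N \<le> j \<longrightarrow> ev \<phi> j x \<in> V" using rep by blast
    have xc: "x \<in> carrier G" "z \<in> carrier G" using x z Ec by auto
    \<comment> \<open>Here y = \<phi>^n(z) = \<phi>^n(x) \<phi>^n(v). The first factor is in
      \<open>V\<close> because n \<ge> N. Since \<open>v\<close> is in \<open>pos\<close>, while
      \<open>z\<close> is only one step away from it, the induction hypothesis applies to
      \<phi>^n(v).\<close>
    define v where "v = inv x \<otimes> z"
    have vV: "v \<in> V" using x(2) rcos_eq_iff[OF sV, of "inv x" "inv z"] xc by (simp add: f_def v_def)
    have vL: "v \<in> ?L" using x z sL by (simp add: v_def E_def subgroup.m_closed subgroup.m_inv_closed)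
    have vc: "v \<in> carrier G" using vV Vc by blast
    have "ev \<phi> (-1) v \<in> ?P" using x z sP xc \<phi> by (simp add: v_def E_def subgroup.m_closed subgroup.m_inv_closed)
    then have vP: "v \<in> ?P"
    proof (intro posI[OF vc])
      fix j :: int assume j: "ev \<phi> (-1) v \<in> ?P" "j \<le> 0"
      show "ev \<phi> j v \<in> V"
      proof (cases "j = 0")
        case True then show ?thesis using vV vc by simp
      next
        case False
        then have "ev \<phi> (j + 1) (ev \<phi> (-1) v) \<in> V" using j by (intro posD[OF j(1)]) auto
        then show ?thesis using \<phi> vc by (simp add: ev_ev)
      qed
    qed
    define y' where "y' = ev \<phi> (int n) v"
    have y'L: "y' \<in> ?L" using vL ev_ell[OF \<phi>] by (simp add: y'_def)
    have "ev \<phi> (- int n) y' = v" using \<phi> vc by (simp add: y'_def ev_ev)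
    then have "y' \<in> V <#> ev \<phi> (int N) ` ?P" using step.IH y'L vP by simp
    then obtain a b where ab: "a \<in> V" "b \<in> ev \<phi> (int N) ` ?P" "y' = a \<otimes> b" unfolding set_mult_def by blast
    have bc: "b \<in> carrier G" using ab(2) Aut_image_subset[of "ev \<phi> (int N)" ?P] \<phi> pos_carrier by auto
    have ac: "a \<in> carrier G" using ab Vc by blast
    have xV: "ev \<phi> (int n) x \<in> V" using x(3) step by simp
    have "z = x \<otimes> v" using xc by (simp add: v_def m_assoc[symmetric])
    then have "ev \<phi> (int n) z = ev \<phi> (int n) x \<otimes> y'" using \<phi> xc vc by (simp add: y'_def)
    moreover have "ev \<phi> (int n) z = y" using \<phi> c by (simp add: z_def ev_ev)
    ultimately have "y = (ev \<phi> (int n) x \<otimes> a) \<otimes> b" using ab ac bc xc \<phi> by (simp add: m_assoc)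
    moreover have "ev \<phi> (int n) x \<otimes> a \<in> V" using xV ab sV by (simp add: subgroup.m_closed)
    ultimately show ?case using ab(2) unfolding set_mult_def by blast
  qed
  have "y \<in> V <#> ev \<phi> (int N) ` V" if y: "y \<in> ?L" for y
  proof -
    obtain m :: nat where m: "\<forall>j. int m \<le> j \<longrightarrow> ev \<phi> j y \<in> V \<and> ev \<phi> (- j) y \<in> V" and c: "y \<in> carrier G"
      using y by (auto simp: ell_def)
    have "ev \<phi> (- int (max N m)) y \<in> ?P"
    proof (rule posI)
      fix j :: int assume "j \<le> 0"
      then have "int m \<le> int (max N m) - j" by simp
      then have "ev \<phi> (- (int (max N m) - j)) y \<in> V" using m by blast
      then show "ev \<phi> j (ev \<phi> (- int (max N m)) y) \<in> V" using \<phi> c by (simp add: ev_ev algebra_simps)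
    qed (use \<phi> c in simp)
    then have "y \<in> V <#> ev \<phi> (int N) ` ?P" using main[of "max N m" y] y by simp
    then show ?thesis using pos_subset[of \<phi> V] unfolding set_mult_def by blast
  qed
  then show ?thesis by blast
qed


section \<open>Multiplicative subgroups exist and compute the scale\<close>

lemma subgroup_set_mult:
  assumes "subgroup W G" "subgroup L G" and n: "\<And>l w. l \<in> L \<Longrightarrow> w \<in> W \<Longrightarrow> l \<otimes> w \<otimes> inv l \<in> W"
  shows "subgroup (W <#> L) G"
proof (rule subgroupI)
  note Wc = subgroup.mem_carrier[OF assms(1)] and Lc = subgroup.mem_carrier[OF assms(2)]
  note W = subgroup.m_closed[OF assms(1)] subgroup.m_inv_closed[OF assms(1)]
  note L = subgroup.m_closed[OF assms(2)] subgroup.m_inv_closed[OF assms(2)]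
  show "W <#> L \<subseteq> carrier G" using Wc Lc by (auto simp: set_mult_def)
  show "W <#> L \<noteq> {}" using subgroup.one_closed[OF assms(1)] subgroup.one_closed[OF assms(2)] by (auto simp: set_mult_def)
  fix x assume "x \<in> W <#> L"
  then obtain w l where x: "w \<in> W" "l \<in> L" "x = w \<otimes> l" by (auto simp: set_mult_def)
  have "inv x = (inv l \<otimes> inv w \<otimes> inv (inv l)) \<otimes> inv l" using x Wc[OF x(1)] Lc[OF x(2)]
    by (simp add: inv_mult_group m_assoc)
  moreover have "inv l \<otimes> inv w \<otimes> inv (inv l) \<in> W" using n x W L by blast
  ultimately show "inv x \<in> W <#> L" using L x unfolding set_mult_def by blast
  fix y assume "y \<in> W <#> L"
  then obtain v k where y: "v \<in> W" "k \<in> L" "y = v \<otimes> k" by (auto simp: set_mult_def)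
  note c = Wc[OF x(1)] Lc[OF x(2)] Wc[OF y(1)] Lc[OF y(2)]
  have "(w \<otimes> (l \<otimes> v \<otimes> inv l)) \<otimes> (l \<otimes> k) = w \<otimes> l \<otimes> v \<otimes> (inv l \<otimes> l) \<otimes> k"
    using c by (simp only: m_assoc inv_closed m_closed)
  then have "x \<otimes> y = (w \<otimes> (l \<otimes> v \<otimes> inv l)) \<otimes> (l \<otimes> k)" using c x y by (simp add: m_assoc)
  moreover have "w \<otimes> (l \<otimes> v \<otimes> inv l) \<in> W" using n x y W by blast
  ultimately show "x \<otimes> y \<in> W <#> L" using L x y unfolding set_mult_def by blast
qed

text \<open>The intersection of the conjugates of \<open>V\<close> by elements of \<open>L\<close>
  is normalized by \<open>L\<close>. The conjugate by \<open>l\<close> depends only on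
  \<open>V #> inv l\<close>, and a bounded group meets finitely many cosets, so the intersection is
  open.\<close>

lemma ex_COS_normalized:
  assumes V: "V \<in> COS G T" and L: "subgroup L G" and bdd: "bdd L"
  shows "\<exists>W\<in>COS G T. W \<subseteq> V \<and> (\<forall>l\<in>L. \<forall>w\<in>W. inv l \<otimes> w \<otimes> l \<in> W)"
proof -
  note Vc = COS_D(4)[OF V] and sV = COS_D(1)[OF V] and Lc = subgroup.subset[OF L]
  note mV = subgroup.m_closed[OF sV] subgroup.m_inv_closed[OF sV]
  note mL = subgroup.m_closed[OF L] subgroup.m_inv_closed[OF L]
  define C where "C l = {x \<in> topspace T. inv l \<otimes> x \<otimes> l \<in> V}" for l
  define W where "W = (\<Inter>l\<in>L. C l)"
  define f where "f l = V #> inv l" for l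
  have one: "\<one> \<in> L" using subgroup.one_closed[OF L] .
  have "finite ((\<lambda>a. V #> a) ` L)" using finite_rcos_image[OF V bdd Lc] .
  moreover have "f ` L \<subseteq> (\<lambda>a. V #> a) ` L" using mL(2) unfolding f_def by blast
  ultimately have fin: "finite (f ` L)" by (rule rev_finite_subset)
  have Ceq: "C l = C d" if e: "f l = f d" "l \<in> L" "d \<in> L" for l d
  proof -
    have "C d \<subseteq> C l" if e: "f l = f d" "l \<in> L" "d \<in> L" for l d
    proof
      fix x assume x: "x \<in> C d"
      have c: "l \<in> carrier G" "d \<in> carrier G" "x \<in> carrier G" using e Lc x by (auto simp: C_def)
      have m: "inv l \<otimes> d \<in> V" using e(1) rcos_eq_iff[OF sV, of "inv l" "inv d"] c by (simp add: f_def)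
      then have "inv l \<otimes> d \<otimes> (inv d \<otimes> x \<otimes> d) \<otimes> inv (inv l \<otimes> d) \<in> V" using x mV unfolding C_def by blast
      also have "inv l \<otimes> d \<otimes> (inv d \<otimes> x \<otimes> d) \<otimes> inv (inv l \<otimes> d)
         = inv l \<otimes> (d \<otimes> inv d) \<otimes> x \<otimes> (d \<otimes> inv d) \<otimes> l"
        using c by (simp only: m_assoc inv_closed m_closed inv_mult_group inv_inv)
      also have "\<dots> = inv l \<otimes> x \<otimes> l" using c by simp
      finally show "x \<in> C l" using c by (simp add: C_def)
    qed
    from this[OF e] this[OF e(1)[symmetric] e(3,2)] show ?thesis by blast
  qed
  have "W = (\<Inter>y\<in>f ` L. C (inv_into L f y))"
  proof -
    have "C (inv_into L f (f l)) = C l" if "l \<in> L" for l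
      using that f_inv_into_f[of "f l" f L] inv_into_into[of "f l" f L] by (intro Ceq) auto
    then show ?thesis unfolding W_def by auto
  qed
  moreover have "openin T (C l)" if "l \<in> L" for l
  proof -
    have "continuous_map T T (\<lambda>x. inv l \<otimes> x \<otimes> l)" using that Lc by (intro continuous_mult_fun) auto
    then show ?thesis unfolding C_def using COS_D(2)[OF V] by (rule openin_continuous_map_preimage)
  qed
  ultimately have "openin T W"
    using fin one inv_into_into[of _ f L] by (simp only:) (rule openin_INT2, auto)
  moreover have sub: "W \<subseteq> V"
  proof
    fix x assume "x \<in> W"
    then have "x \<in> C \<one>" using one unfolding W_def by blast
    then have "x \<in> carrier G \<and> inv \<one> \<otimes> x \<otimes> \<one> \<in> V" unfolding C_def topspace_eq by blast
    then show "x \<in> V" by (metis inv_one l_one r_one)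
  qed
  moreover have "subgroup W G"
  proof (rule subgroupI)
    show "W \<subseteq> carrier G" using sub Vc by blast
    have "\<one> \<in> W" using Lc subgroup.one_closed[OF sV] by (auto simp: W_def C_def subset_iff)
    then show "W \<noteq> {}" by blast
    fix x assume x: "x \<in> W"
    have xc: "x \<in> carrier G" using x sub Vc by blast
    have xl: "inv l \<otimes> x \<otimes> l \<in> V" if "l \<in> L" for l using x that by (auto simp: W_def C_def)
    have "inv l \<otimes> inv x \<otimes> l \<in> V" if l: "l \<in> L" for l
    proof -
      have "inv l \<otimes> inv x \<otimes> l = inv (inv l \<otimes> x \<otimes> l)" using xc l Lc by (auto simp: inv_mult_group m_assoc)
      then show ?thesis using xl[OF l] mV by simp
    qed
    then show "inv x \<in> W" using xc by (simp add: W_def C_def)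
    fix y assume y: "y \<in> W"
    have yc: "y \<in> carrier G" using y sub Vc by blast
    have yl: "inv l \<otimes> y \<otimes> l \<in> V" if "l \<in> L" for l using y that by (auto simp: W_def C_def)
    have "inv l \<otimes> (x \<otimes> y) \<otimes> l \<in> V" if l: "l \<in> L" for l
    proof -
      have lc: "l \<in> carrier G" using l Lc by blast
      have "(inv l \<otimes> x \<otimes> l) \<otimes> (inv l \<otimes> y \<otimes> l) = inv l \<otimes> x \<otimes> (l \<otimes> inv l) \<otimes> y \<otimes> l"
        using xc yc lc by (simp only: m_assoc inv_closed m_closed)
      also have "\<dots> = inv l \<otimes> (x \<otimes> y) \<otimes> l" using xc yc lc by (simp add: m_assoc)
      finally show ?thesis using xl[OF l] yl[OF l] mV by metis
    qed
    then show "x \<otimes> y \<in> W" using xc yc by (simp add: W_def C_def)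
  qed
  ultimately have "W \<in> COS G T" using COS_I COS_D(3)[OF V] by blast
  moreover have "inv l \<otimes> w \<otimes> l \<in> W" if l: "l \<in> L" and w: "w \<in> W" for l w
  proof -
    have c: "l \<in> carrier G" "w \<in> carrier G" using l w Lc sub Vc by blast+
    have "inv k \<otimes> (inv l \<otimes> w \<otimes> l) \<otimes> k \<in> V" if k: "k \<in> L" for k
    proof -
      have kc: "k \<in> carrier G" using k Lc by blast
      have "inv (l \<otimes> k) \<otimes> w \<otimes> (l \<otimes> k) \<in> V" using w mL(1)[OF l k] by (auto simp: W_def C_def)
      then show ?thesis using c kc by (simp add: inv_mult_group m_assoc)
    qed
    then show ?thesis using c by (simp add: W_def C_def)
  qed
  ultimately show ?thesis using sub by blast
qed

text \<open>Exact growth of the indices of all forward powers. Unlike minimality this concerns one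
  subgroup only, and comparison of growth rates shows that such a subgroup is minimizing.\<close>

definition multv where
  "multv \<phi> U \<longleftrightarrow> U \<in> COS G T \<and> (\<forall>n. rel_index G (ev \<phi> (int n) ` U) U = rel_index G (\<phi> ` U) U ^ n)"

text \<open>Once \<open>R \<subseteq> \<phi>(R)\<close> and \<open>\<phi>\<^sup>n(U)\<close> is covered by \<open>U \<phi>\<^sup>n(R)\<close> with \<open>\<phi>\<^sup>n(R) \<inter> U = R\<close>, all indices are those of the
  chain \<open>R \<subseteq> \<phi>(R) \<subseteq> \<phi>\<^sup>2(R) \<subseteq> \<dots>\<close>.\<close>

lemma multv_if_expanding:
  assumes \<phi>: "\<phi> \<in> Aut G T" and U: "U \<in> COS G T" and R: "subgroup R G" "R \<subseteq> U"
    and inc: "\<And>x. x \<in> R \<Longrightarrow> ev \<phi> (-1) x \<in> R"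
    and cov: "\<And>n. ev \<phi> (int n) ` U \<subseteq> U <#> ev \<phi> (int n) ` R"
    and cap: "\<And>n x. x \<in> R \<Longrightarrow> ev \<phi> (int n) x \<in> U \<Longrightarrow> ev \<phi> (int n) x \<in> R"
  shows "multv \<phi> U"
proof -
  note Rc = subgroup.subset[OF R(1)] and sU = COS_D(1)[OF U]
  let ?t = "rel_index G (\<phi> ` R) R"
  have sE: "subgroup (ev \<phi> j ` R) G" for j using \<phi> R subgroup_image by simp
  have incn: "R \<subseteq> ev \<phi> (int n) ` R" for n
  proof -
    have "ev \<phi> (- int n) x \<in> R" if "x \<in> R" for x
    proof (induction n)
      case 0 then show ?case using that Rc by auto
    next
      case (Suc n)
      have "ev \<phi> (-1) (ev \<phi> (- int n) x) \<in> R" using inc Suc by simp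
      moreover have "ev \<phi> (-1) (ev \<phi> (- int n) x) = ev \<phi> (- int (Suc n)) x"
        using \<phi> that Rc by (auto simp: ev_ev)
      ultimately show ?case by simp
    qed
    then show ?thesis using mem_ev_image[OF \<phi> _ Rc] Rc by blast
  qed
  have pw: "rel_index G (ev \<phi> (int n) ` R) R = ?t ^ n" for n
  proof (induction n)
    case 0
    then show ?case using rel_index_one_iff[OF R(1) R(1)] Rc by simp
  next
    case (Suc n)
    have im: "ev \<phi> (int (Suc n)) ` R = ev \<phi> (int n) ` \<phi> ` R"
      using ev_image[OF \<phi> Rc, of "int n" 1] \<phi> by (simp add: add.commute)
    have R1: "R \<subseteq> \<phi> ` R" using incn[of 1] \<phi> by simp
    then have sub: "ev \<phi> (int n) ` R \<subseteq> ev \<phi> (int (Suc n)) ` R" unfolding im by (rule image_mono)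
    have "rel_index G (ev \<phi> (int (Suc n)) ` R) R
      = rel_index G (ev \<phi> (int (Suc n)) ` R) (ev \<phi> (int n) ` R) * rel_index G (ev \<phi> (int n) ` R) R"
      by (rule rel_index_tower[OF sE sE R(1) incn sub])
    also have "rel_index G (ev \<phi> (int (Suc n)) ` R) (ev \<phi> (int n) ` R) = ?t"
      unfolding im using \<phi> R by (intro rel_index_image) (auto simp: subgroup_image)
    finally show ?case using Suc by simp
  qed
  have idx: "rel_index G (ev \<phi> (int n) ` U) U = ?t ^ n" for n
  proof -
    have "rel_index G (ev \<phi> (int n) ` U) U = rel_index G (ev \<phi> (int n) ` R) U"
      using \<phi> sU R cov by (intro rel_index_cover sE) (auto simp: subgroup_image)
    also have "ev \<phi> (int n) ` R \<inter> U = ev \<phi> (int n) ` R \<inter> R"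
      using cap R(2) by blast
    then have "rel_index G (ev \<phi> (int n) ` R) U = rel_index G (ev \<phi> (int n) ` R) R"
      by (simp add: rel_index_def)
    finally show ?thesis using pw by simp
  qed
  have "rel_index G (\<phi> ` U) U = ?t" using idx[of 1] \<phi> by simp
  then show ?thesis using idx U by (simp add: multv_def)
qed

text \<open>Willis's tidying procedure. The bounded group \<open>ell\<close> is absorbed into a
  subgroup \<open>W\<close> that is tidy above and normalized by \<open>ell\<close>:
  \<open>U\<close> is the product of \<open>W\<close> with \<open>ell\<close>, and its expanding
  part \<open>R\<close> that of \<open>pos \<phi> W\<close> with \<open>ell\<close>. Points of
  \<open>R\<close> that leave \<open>U\<close> and return to it are then back in
  \<open>R\<close>.\<close>

lemma ex_multv:
  assumes \<phi>: "\<phi> \<in> Aut G T" and V: "V \<in> COS G T"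
  shows "\<exists>U. multv \<phi> U"
proof -
  let ?L = "ell \<phi> V"
  note Vc = COS_D(4)[OF V] and sV = COS_D(1)[OF V]
  note sL = subgroup_ell[OF \<phi> sV]
  note mL = subgroup.m_closed[OF sL] subgroup.m_inv_closed[OF sL]
  obtain N where N: "?L \<subseteq> V <#> ev \<phi> N ` V" using ell_bounded[OF \<phi> V] by blast
  have bdd: "bdd ?L" using \<phi> V by (intro bdd_subset[OF bdd_mult N] bdd_image bdd_COS) auto
  obtain V' where V': "V' \<in> COS G T" "V' \<subseteq> V" "\<And>l w. l \<in> ?L \<Longrightarrow> w \<in> V' \<Longrightarrow> inv l \<otimes> w \<otimes> l \<in> V'"
    using ex_COS_normalized[OF V sL bdd] by blast
  obtain m where m: "tidy_above \<phi> (lev \<phi> V' m)" using ex_tidy_above[OF \<phi> V'(1)] by blast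
  define W where "W = lev \<phi> V' m"
  have W: "W \<in> COS G T" unfolding W_def using COS_lev[OF \<phi> V'(1)] .
  have WV: "W \<subseteq> V" unfolding W_def using lev_subset V'(2) by blast
  note Wc = COS_D(4)[OF W] and sW = COS_D(1)[OF W]
  have Lc: "?L \<subseteq> carrier G" using subgroup.subset[OF sL] .
  \<comment> \<open>Under \<phi>^j conjugation by \<open>l\<close> becomes conjugation by
    \<phi>^j(l), again an element of \<open>ell\<close>. So normalization passes from
    \<open>V'\<close> to \<open>lev \<phi> V' m\<close>.\<close>
  have nW: "l \<otimes> w \<otimes> inv l \<in> W" if l: "l \<in> ?L" and w: "w \<in> W" for l w
  proof -
    have c: "l \<in> carrier G" "w \<in> carrier G" using l w Lc Wc by blast+
    show ?thesis unfolding W_def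
    proof (rule levI)
      fix j assume j: "- int m \<le> j" "j \<le> 0"
      have "ev \<phi> j w \<in> V'" using levD[of w \<phi> V' m] w j unfolding W_def by blast
      moreover have "inv (ev \<phi> j l) \<in> ?L" using ev_ell[OF \<phi> l] mL by blast
      ultimately have "inv (inv (ev \<phi> j l)) \<otimes> ev \<phi> j w \<otimes> inv (ev \<phi> j l) \<in> V'" using V'(3) by blast
      then show "ev \<phi> j (l \<otimes> w \<otimes> inv l) \<in> V'" using \<phi> c by simp
    qed (use c in simp)
  qed
  let ?P = "pos \<phi> W"
  note sP = subgroup_pos[OF \<phi> sW]
  have nP: "l \<otimes> w \<otimes> inv l \<in> ?P" if l: "l \<in> ?L" and w: "w \<in> ?P" for l w
  proof -
    have c: "l \<in> carrier G" "w \<in> carrier G" using l w Lc pos_carrier by blast+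
    show ?thesis
    proof (rule posI)
      fix j :: int assume j: "j \<le> 0"
      have "ev \<phi> j l \<otimes> ev \<phi> j w \<otimes> inv (ev \<phi> j l) \<in> W" using nW ev_ell[OF \<phi> l] posD[OF w j] by blast
      then show "ev \<phi> j (l \<otimes> w \<otimes> inv l) \<in> W" using \<phi> c by simp
    qed (use c in simp)
  qed
  define U where "U = W <#> ?L"
  define R where "R = ?P <#> ?L"
  have sU: "subgroup U G" unfolding U_def by (rule subgroup_set_mult[OF sW sL nW])
  have sR: "subgroup R G" unfolding R_def by (rule subgroup_set_mult[OF sP sL nP])
  have one: "\<one> \<in> W" "\<one> \<in> ?L" "\<one> \<in> ?P" using subgroup.one_closed sW sL sP by blast+
  have U: "U \<in> COS G T"
  proof -
    have "U = (\<Union>l\<in>?L. W #> l)" unfolding U_def set_mult_def r_coset_def by blast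
    moreover have "openin T (\<Union>l\<in>?L. W #> l)"
      using openin_rcos[OF COS_D(2)[OF W]] Lc by (intro openin_Union) auto
    ultimately have "openin T U" by simp
    moreover have "bdd U" unfolding U_def by (intro bdd_mult bdd bdd_COS W)
    then obtain C where "compactin T C" "U \<subseteq> C" unfolding bdd_def by blast
    ultimately show ?thesis using COS_I[OF sU] by blast
  qed
  have RU: "R \<subseteq> U" unfolding R_def U_def using pos_subset[of \<phi> W] by (intro mono_set_mult) auto
  have "multv \<phi> U"
  proof (rule multv_if_expanding[OF \<phi> U sR RU])
    fix x assume "x \<in> R"
    then obtain p l where x: "p \<in> ?P" "l \<in> ?L" "x = p \<otimes> l" unfolding R_def set_mult_def by blast
    have c: "p \<in> carrier G" "l \<in> carrier G" using x Lc pos_carrier by blast+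
    have "ev \<phi> (-1) x = ev \<phi> (-1) p \<otimes> ev \<phi> (-1) l" using x c \<phi> by simp
    then show "ev \<phi> (-1) x \<in> R" using ev_pos[OF \<phi> x(1), of "-1"] ev_ell[OF \<phi> x(2)] unfolding R_def set_mult_def by auto
  next
    fix n
    show "ev \<phi> (int n) ` U \<subseteq> U <#> ev \<phi> (int n) ` R"
    proof
      fix y assume "y \<in> ev \<phi> (int n) ` U"
      then obtain w l where y: "w \<in> W" "l \<in> ?L" "y = ev \<phi> (int n) (w \<otimes> l)" unfolding U_def set_mult_def by blast
      obtain a b where ab: "a \<in> neg \<phi> W" "b \<in> ?P" "w = a \<otimes> b"
        using m y(1) unfolding tidy_above_def W_def by blast
      have c: "a \<in> carrier G" "b \<in> carrier G" "l \<in> carrier G" using ab y Lc pos_carrier neg_carrier by blast+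
      have ye: "y = ev \<phi> (int n) a \<otimes> ev \<phi> (int n) (b \<otimes> l)" using y ab c \<phi> by (simp add: m_assoc)
      have "ev \<phi> (int n) a \<in> W" using negD[OF ab(1)] by simp
      then have "ev \<phi> (int n) a \<otimes> \<one> \<in> U" using one unfolding U_def set_mult_def by blast
      moreover have "b \<otimes> l \<in> R" using ab y unfolding R_def set_mult_def by blast
      ultimately have "ev \<phi> (int n) a \<otimes> \<one> \<otimes> ev \<phi> (int n) (b \<otimes> l) \<in> U <#> ev \<phi> (int n) ` R"
        unfolding set_mult_def by blast
      then show "y \<in> U <#> ev \<phi> (int n) ` R" using ye c \<phi> by (simp del: ev_hom)
    qed
  next
    fix n x assume "x \<in> R" and xU: "ev \<phi> (int n) x \<in> U"
    then obtain p l where x: "p \<in> ?P" "l \<in> ?L" "x = p \<otimes> l" unfolding R_def set_mult_def by blast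
    have c: "p \<in> carrier G" "l \<in> carrier G" using x Lc pos_carrier by blast+
    let ?a = "ev \<phi> (int n) p" and ?l = "ev \<phi> (int n) l"
    have lL: "?l \<in> ?L" using ev_ell[OF \<phi> x(2)] .
    obtain w k where wk: "w \<in> W" "k \<in> ?L" "ev \<phi> (int n) x = w \<otimes> k" using xU unfolding U_def set_mult_def by blast
    obtain b d where bd: "b \<in> neg \<phi> W" "d \<in> ?P" "w = b \<otimes> d" using m wk(1) unfolding tidy_above_def W_def by blast
    have c2: "b \<in> carrier G" "d \<in> carrier G" "k \<in> carrier G" "w \<in> carrier G" using bd wk Lc Wc pos_carrier neg_carrier by blast+
    define q where "q = k \<otimes> inv ?l"
    have q: "q \<in> ?L" "q \<in> carrier G" using wk lL mL Lc unfolding q_def by blast+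
    have "?a \<otimes> ?l = w \<otimes> k" using wk x c \<phi> by simp
    then have "?a = w \<otimes> k \<otimes> inv ?l" using c c2 \<phi> by (intro solve_right) auto
    then have a: "?a = b \<otimes> (d \<otimes> q)" using bd c c2 \<phi> by (simp add: q_def m_assoc)
    then have b: "b = ?a \<otimes> inv (d \<otimes> q)" using c c2 q \<phi> by (intro solve_right) auto
    obtain m' :: nat where m': "\<forall>j. int m' \<le> j \<longrightarrow> ev \<phi> j q \<in> V \<and> ev \<phi> (- j) q \<in> V"
      using q by (auto simp: ell_def)
    \<comment> \<open>The forward orbit of \<open>b\<close> stays in \<open>W\<close> since
      \<open>b\<close> is in \<open>neg\<close>. Backwards, \<open>b\<close> is \<phi>^n(p) times
      the inverse of \<open>d \<otimes> q\<close>, with \<open>p\<close> and \<open>d\<close> in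
      \<open>pos\<close> and \<open>q\<close> in \<open>ell\<close>, so its orbit ends up in
      \<open>V\<close>.\<close>
    have "b \<in> ?L"
    proof -
      have "ev \<phi> j b \<in> V \<and> ev \<phi> (- j) b \<in> V" if j: "int (max m' n) \<le> j" for j
      proof
        show "ev \<phi> j b \<in> V" using negD[OF bd(1), of j] j WV by auto
        have "ev \<phi> (- j) ?a \<in> V" using posD[OF x(1), of "- j + int n"] j WV \<phi> c by (auto simp: ev_ev)
        moreover have "ev \<phi> (- j) d \<in> V" using posD[OF bd(2), of "- j"] j WV by auto
        moreover have "ev \<phi> (- j) q \<in> V" using m' j by auto
        ultimately have "ev \<phi> (- j) ?a \<otimes> inv (ev \<phi> (- j) d \<otimes> ev \<phi> (- j) q) \<in> V"
          using sV by (simp add: subgroup.m_closed subgroup.m_inv_closed)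
        then show "ev \<phi> (- j) b \<in> V" unfolding b using \<phi> c c2 q by simp
      qed
      then show ?thesis using c2 unfolding ell_def by blast
    qed
    then have "\<one> \<otimes> b \<in> R" using one unfolding R_def set_mult_def by blast
    moreover have "d \<otimes> q \<in> R" using bd q unfolding R_def set_mult_def by blast
    moreover have "\<one> \<otimes> ?l \<in> R" using one lL unfolding R_def set_mult_def by blast
    ultimately have "b \<otimes> (d \<otimes> q) \<otimes> ?l \<in> R" using sR c2 c \<phi> by (simp add: subgroup.m_closed)
    then show "ev \<phi> (int n) x \<in> R" using a x c \<phi> by simp
  qed
  then show ?thesis by blast
qed


text \<open>By the triangle inequality the index of \<phi>^n(U) in \<open>U\<close> exceeds that of
  \<phi>^n(V) in \<open>V\<close> at most by a factor independent of n, and the latter is at most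
  the n-th power of the index of \<phi>(V). Growth rates then compare the bases.\<close>

lemma multv_scale:
  assumes \<phi>: "\<phi> \<in> Aut G T" and U: "multv \<phi> U" and V: "V \<in> COS G T"
  shows "rel_index G (\<phi> ` U) U \<le> rel_index G (\<phi> ` V) V"
proof (rule nat_power_growth)
  have Uc: "U \<in> COS G T" using U by (simp add: multv_def)
  note Vs = COS_D(4)[OF V] COS_D(4)[OF Uc] COS_D(1)[OF V] COS_D(1)[OF Uc]
  have sub: "rel_index G (ev \<phi> (int n) ` V) V \<le> rel_index G (\<phi> ` V) V ^ n" for n
  proof (induction n)
    case 0
    then show ?case using rel_index_one_iff[OF Vs(3,3)] Vs by simp
  next
    case (Suc n)
    have im: "ev \<phi> (int (Suc n)) ` V = ev \<phi> (int n) ` \<phi> ` V"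
      using ev_image[OF \<phi> Vs(1), of "int n" 1] \<phi> by (simp add: add.commute)
    have "rel_index G (ev \<phi> (int (Suc n)) ` V) V
      \<le> rel_index G (ev \<phi> (int (Suc n)) ` V) (ev \<phi> (int n) ` V) * rel_index G (ev \<phi> (int n) ` V) V"
      using \<phi> V by (intro rel_index_triangle COS_image) auto
    also have "rel_index G (ev \<phi> (int (Suc n)) ` V) (ev \<phi> (int n) ` V) = rel_index G (\<phi> ` V) V"
      unfolding im using \<phi> Vs by (intro rel_index_image) (auto simp: subgroup_image)
    also have "rel_index G (\<phi> ` V) V * rel_index G (ev \<phi> (int n) ` V) V \<le> rel_index G (\<phi> ` V) V * rel_index G (\<phi> ` V) V ^ n"
      using Suc by (rule mult_le_mono2)
    finally show ?case by simp
  qed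
  show "rel_index G (\<phi> ` U) U ^ n \<le> (rel_index G U V * rel_index G V U) * rel_index G (\<phi> ` V) V ^ n" for n
  proof -
    let ?n = "ev \<phi> (int n)"
    have n: "?n ` U \<in> COS G T" "?n ` V \<in> COS G T" using \<phi> Uc V COS_image by auto
    have "rel_index G (\<phi> ` U) U ^ n = rel_index G (?n ` U) U" using U by (simp add: multv_def)
    also have "\<dots> \<le> rel_index G (?n ` U) (?n ` V) * rel_index G (?n ` V) U"
      using rel_index_triangle[OF n Uc] .
    also have "\<dots> \<le> rel_index G (?n ` U) (?n ` V) * (rel_index G (?n ` V) V * rel_index G V U)"
      using rel_index_triangle[OF n(2) V Uc] by (rule mult_le_mono2)
    also have "rel_index G (?n ` U) (?n ` V) = rel_index G U V" using \<phi> Vs by (intro rel_index_image) auto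
    also have "rel_index G U V * (rel_index G (?n ` V) V * rel_index G V U)
       \<le> rel_index G U V * (rel_index G (\<phi> ` V) V ^ n * rel_index G V U)"
      using sub[of n] by (intro mult_le_mono) auto
    finally show ?thesis by (simp add: mult_ac)
  qed
  show "rel_index G (\<phi> ` V) V > 0" using \<phi> V by (intro rel_index_pos COS_image)
qed

lemma aut_scale_multv:
  assumes "\<phi> \<in> Aut G T" "multv \<phi> U"
  shows "aut_scale G T \<phi> = rel_index G (\<phi> ` U) U"
  unfolding aut_scale_def
proof (rule Least_equality)
  show "\<exists>V\<in>COS G T. rel_index G (\<phi> ` U) U = rel_index G (\<phi> ` V) V" using assms by (auto simp: multv_def)
qed (use multv_scale[OF assms] in auto)

lemma aut_scale_le:
  assumes "V \<in> COS G T"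
  shows "aut_scale G T \<phi> \<le> rel_index G (\<phi> ` V) V"
  unfolding aut_scale_def using assms by (intro Least_le) auto

lemma multv_ev:
  assumes "\<phi> \<in> Aut G T" "multv \<phi> U" shows "multv (ev \<phi> (int m)) U"
  using assms by (simp add: multv_def ev_mult power_mult flip: of_nat_mult)

lemma aut_scale_pow:
  assumes \<phi>: "\<phi> \<in> Aut G T" and V: "V \<in> COS G T"
  shows "aut_scale G T (ev \<phi> (int n)) = aut_scale G T \<phi> ^ n"
proof -
  obtain U where U: "multv \<phi> U" using ex_multv[OF \<phi> V] by blast
  have "aut_scale G T (ev \<phi> (int n)) = rel_index G (ev \<phi> (int n) ` U) U"
    using aut_scale_multv[OF _ multv_ev[OF \<phi> U]] \<phi> by simp
  then show ?thesis using U aut_scale_multv[OF \<phi> U] by (simp add: multv_def)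
qed

text \<open>Willis's tidiness: with \<open>V\<^sub>+\<close> and \<open>V\<^sub>-\<close> for \<open>pos\<close> and \<open>neg\<close>, this says \<open>V = V\<^sub>- V\<^sub>+\<close> and \<open>V\<^sub>+\<^sub>+ \<inter> V = V\<^sub>+\<close>.\<close>

definition tidy where
  "tidy \<phi> V \<longleftrightarrow> V \<in> COS G T \<and> tidy_above \<phi> V \<and>
     (\<forall>x\<in>V. (\<exists>n. \<forall>j\<le>n. ev \<phi> j x \<in> V) \<longrightarrow> x \<in> pos \<phi> V)"

section \<open>Tidy, multiplicative and minimizing subgroups coincide\<close>

lemma tidy_above_cover:
  assumes "\<phi> \<in> Aut G T" "tidy_above \<phi> V"
  shows "ev \<phi> (int n) ` V \<subseteq> V <#> ev \<phi> (int n) ` pos \<phi> V"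
proof
  fix y assume "y \<in> ev \<phi> (int n) ` V"
  then obtain x where x: "x \<in> V" "y = ev \<phi> (int n) x" by blast
  obtain a b where ab: "a \<in> neg \<phi> V" "b \<in> pos \<phi> V" "x = a \<otimes> b" using assms(2) x unfolding tidy_above_def by blast
  have "a \<in> carrier G" "b \<in> carrier G" using ab pos_carrier neg_carrier by blast+
  then have "y = ev \<phi> (int n) a \<otimes> ev \<phi> (int n) b" using ab x assms(1) by simp
  moreover have "ev \<phi> (int n) a \<in> V" using negD[OF ab(1)] by simp
  ultimately show "y \<in> V <#> ev \<phi> (int n) ` pos \<phi> V" using ab unfolding set_mult_def by blast
qed

lemma tidy_multv:
  assumes \<phi>: "\<phi> \<in> Aut G T" and V: "tidy \<phi> V"
  shows "multv \<phi> V"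
proof -
  have Vc: "V \<in> COS G T" and ta: "tidy_above \<phi> V"
    and tb: "\<And>x n. x \<in> V \<Longrightarrow> \<forall>j\<le>n. ev \<phi> j x \<in> V \<Longrightarrow> x \<in> pos \<phi> V" using V unfolding tidy_def by blast+
  note sP = subgroup_pos[OF \<phi> COS_D(1)[OF Vc]]
  show ?thesis
  proof (rule multv_if_expanding[OF \<phi> Vc sP pos_subset])
    show "ev \<phi> (-1) x \<in> pos \<phi> V" if "x \<in> pos \<phi> V" for x using ev_pos[OF \<phi> that] by simp
    show "ev \<phi> (int n) ` V \<subseteq> V <#> ev \<phi> (int n) ` pos \<phi> V" for n
      by (rule tidy_above_cover[OF \<phi> ta])
    fix n x assume x: "x \<in> pos \<phi> V" "ev \<phi> (int n) x \<in> V"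
    have "x \<in> carrier G" using x pos_carrier by blast
    then have "\<forall>j\<le>- int n. ev \<phi> j (ev \<phi> (int n) x) \<in> V" using posD[OF x(1)] \<phi> by (simp add: ev_ev)
    then show "ev \<phi> (int n) x \<in> pos \<phi> V" using tb x by blast
  qed
qed

lemma rel_index_expand_pos:
  assumes \<phi>: "\<phi> \<in> Aut G T" and V: "V \<in> COS G T"
  shows "rel_index G (\<phi> ` pos \<phi> V) (pos \<phi> V) = rel_index G (\<phi> ` pos \<phi> V) V"
proof -
  have "\<phi> ` pos \<phi> V \<inter> V \<subseteq> pos \<phi> V"
  proof
    fix y assume "y \<in> \<phi> ` pos \<phi> V \<inter> V"
    then obtain x where x: "x \<in> pos \<phi> V" "y = ev \<phi> 1 x" "y \<in> V" using \<phi> by auto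
    have c: "x \<in> carrier G" using x pos_carrier by blast
    show "y \<in> pos \<phi> V"
    proof (rule posI)
      fix j :: int assume "j \<le> 0"
      then show "ev \<phi> j y \<in> V" using posD[OF x(1), of "j + 1"] x \<phi> c
        by (cases "j = 0") (auto simp: ev_ev simp del: ev_1)
    qed (use x c \<phi> in \<open>simp del: ev_1\<close>)
  qed
  then have "\<phi> ` pos \<phi> V \<inter> V = \<phi> ` pos \<phi> V \<inter> pos \<phi> V" using pos_subset[of \<phi> V] by blast
  then show ?thesis by (simp add: rel_index_def)
qed

text \<open>The index of \<open>lev \<phi> V n\<close> cannot fall below the scale, which gives
  tidiness above. For the second condition let E be the image of \<open>pos \<phi> V\<close> under
  \<phi>^m. Its index over \<open>pos \<phi> V\<close> is s^m, while its index over the intersection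
  of E and \<open>V\<close> is at least the scale of \<phi>^m, which is s^m too. So nothing fits
  between that intersection and \<open>pos \<phi> V\<close>.\<close>

lemma tidy_if_min:
  assumes \<phi>: "\<phi> \<in> Aut G T" and V: "V \<in> COS G T" and min: "rel_index G (\<phi> ` V) V = aut_scale G T \<phi>"
  shows "tidy \<phi> V"
proof -
  note Vc = COS_D(4)[OF V] and sV = COS_D(1)[OF V]
  have ta: "tidy_above \<phi> V"
    using min aut_scale_le[OF COS_lev[OF \<phi> V]] by (intro tidy_above_if_index_const[OF \<phi> V]) simp
  let ?P = "pos \<phi> V" and ?s = "aut_scale G T \<phi>"
  note sP = subgroup_pos[OF \<phi> sV]
  note cov = tidy_above_cover[OF \<phi> ta]
  have sE: "subgroup (ev \<phi> j ` ?P) G" for j using \<phi> sP subgroup_image by simp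
  have idx: "rel_index G (ev \<phi> (int n) ` V) V = rel_index G (ev \<phi> (int n) ` ?P) V" for n
    using \<phi> sV cov pos_subset[of \<phi> V] by (intro rel_index_cover sE) (auto simp: subgroup_image)
  have one: "rel_index G (\<phi> ` ?P) ?P = ?s" using idx[of 1] \<phi> min rel_index_expand_pos[OF \<phi> V] by simp
  have inc: "?P \<subseteq> ev \<phi> (int n) ` ?P" for n
  proof
    fix x assume x: "x \<in> ?P"
    then have "ev \<phi> (- int n) x \<in> ?P" by (intro ev_pos[OF \<phi>]) auto
    then show "x \<in> ev \<phi> (int n) ` ?P" using mem_ev_image[OF \<phi> _ pos_carrier, of x] x pos_carrier by blast
  qed
  have pw: "rel_index G (ev \<phi> (int n) ` ?P) ?P = ?s ^ n" for n
  proof (induction n)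
    case 0
    then show ?case using rel_index_one_iff[OF sP sP] pos_carrier by simp
  next
    case (Suc n)
    have im: "ev \<phi> (int (Suc n)) ` ?P = ev \<phi> (int n) ` \<phi> ` ?P"
      using ev_image[OF \<phi> pos_carrier, of "int n" 1] \<phi> by (simp add: add.commute)
    have "?P \<subseteq> \<phi> ` ?P" using inc[of 1] \<phi> by simp
    then have sub: "ev \<phi> (int n) ` ?P \<subseteq> ev \<phi> (int (Suc n)) ` ?P" unfolding im by (rule image_mono)
    have "rel_index G (ev \<phi> (int (Suc n)) ` ?P) ?P
      = rel_index G (ev \<phi> (int (Suc n)) ` ?P) (ev \<phi> (int n) ` ?P) * rel_index G (ev \<phi> (int n) ` ?P) ?P"
      by (rule rel_index_tower[OF sE sE sP inc sub])
    also have "rel_index G (ev \<phi> (int (Suc n)) ` ?P) (ev \<phi> (int n) ` ?P) = ?s"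
      unfolding im one[symmetric] using \<phi> sP by (intro rel_index_image) (auto simp: subgroup_image)
    finally show ?case using Suc by simp
  qed
  have "x \<in> ?P" if x: "x \<in> V" and n: "\<forall>j\<le>n. ev \<phi> j x \<in> V" for x n
  proof -
    have xc: "x \<in> carrier G" using x Vc by blast
    define m where "m = nat \<bar>n\<bar>"
    have m: "- int m \<le> n" by (simp add: m_def)
    let ?E = "ev \<phi> (int m) ` ?P"
    have sEV: "subgroup (?E \<inter> V) G" using sE sV subgroups_Inter_pair by blast
    have "ev \<phi> (- int m) x \<in> ?P" using n m \<phi> xc by (intro posI) (auto simp: ev_ev)
    then have xE: "x \<in> ?E \<inter> V" using mem_ev_image[OF \<phi> xc pos_carrier] x by simp
    have spos: "?s > 0" using rel_index_pos[OF COS_image[OF \<phi> V] V] min by simp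
    have "?s ^ m = aut_scale G T (ev \<phi> (int m))" using aut_scale_pow[OF \<phi> V] by simp
    also have "\<dots> \<le> rel_index G (ev \<phi> (int m) ` V) V" by (rule aut_scale_le[OF V])
    also have "\<dots> = rel_index G ?E (?E \<inter> V)" using idx rel_index_Int[OF sE sV] by simp
    finally have le: "?s ^ m \<le> rel_index G ?E (?E \<inter> V)" .
    have "?s ^ m = rel_index G ?E (?E \<inter> V) * rel_index G (?E \<inter> V) ?P"
      unfolding pw[symmetric] using inc pos_subset[of \<phi> V] by (intro rel_index_tower[OF sE sEV sP]) auto
    then have "rel_index G (?E \<inter> V) ?P = 1"
    proof -
      assume e: "?s ^ m = rel_index G ?E (?E \<inter> V) * rel_index G (?E \<inter> V) ?P"
      let ?u = "rel_index G ?E (?E \<inter> V)" and ?v = "rel_index G (?E \<inter> V) ?P"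
      have "?u * ?v > 0" using e spos by (metis zero_less_power)
      then have "?u > 0" "?v > 0" by auto
      moreover have "?u * ?v \<le> ?u * 1" using e le by simp
      ultimately have "?v \<le> 1" by (simp only: mult_le_cancel1)
      then show "?v = 1" using \<open>?v > 0\<close> by simp
    qed
    then show ?thesis using rel_index_one_iff[OF sEV sP] xE by blast
  qed
  then show ?thesis using V ta unfolding tidy_def by blast
qed

lemma tidy_iff_multv:
  assumes "\<phi> \<in> Aut G T" shows "tidy \<phi> V \<longleftrightarrow> multv \<phi> V"
  using tidy_multv[OF assms] tidy_if_min[OF assms] aut_scale_multv[OF assms, of V] by (auto simp: multv_def)

lemma tidy_iff_min:
  assumes "\<phi> \<in> Aut G T" "V \<in> COS G T"
  shows "tidy \<phi> V \<longleftrightarrow> rel_index G (\<phi> ` V) V = aut_scale G T \<phi>"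
  using tidy_if_min[OF assms] aut_scale_multv[OF assms(1) tidy_multv[OF assms(1)]] by auto

end

section \<open>Tidy subgroups\<close>

context tdlc
begin

lemma bdd_finite: "finite S \<Longrightarrow> S \<subseteq> carrier G \<Longrightarrow> bdd S"
  unfolding bdd_def using finite_imp_compactin[of S T] by auto

lemma tidyD:
  assumes "tidy \<phi> V"
  shows "V \<in> COS G T" "\<And>x. x \<in> V \<Longrightarrow> \<exists>a\<in>neg \<phi> V. \<exists>b\<in>pos \<phi> V. x = a \<otimes> b"
    "\<And>x n. x \<in> V \<Longrightarrow> \<forall>j\<le>n. ev \<phi> j x \<in> V \<Longrightarrow> x \<in> pos \<phi> V"
  using assms unfolding tidy_def tidy_above_def by blast+

text \<open>In x = a b with \<open>a\<close> in \<open>neg\<close> and \<open>b\<close> in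
  \<open>pos\<close>, the forward orbit of \<open>b\<close> is bounded and meets finitely many
  cosets of \<open>V\<close>. So each \<phi>^j(b) equals some \<phi>^i(b) with i \<le> N up to a
  factor in \<open>V\<close>, and tidiness puts this factor in \<open>pos\<close>. Hence
  \<phi>^(j-N)(b) is in \<open>pos\<close> for all j \<ge> 0, and the forward orbit of
  \<open>b\<close> stays in \<open>V\<close>.\<close>

lemma tidy_bdd_neg:
  assumes \<phi>: "\<phi> \<in> Aut G T" and t: "tidy \<phi> V" and x: "x \<in> V" and C: "bdd C" "\<And>j. 0 \<le> j \<Longrightarrow> ev \<phi> j x \<in> C"
  shows "x \<in> neg \<phi> V"
proof -
  note V = tidyD(1)[OF t]
  note Vc = COS_D(4)[OF V] and sV = COS_D(1)[OF V]
  note sP = subgroup_pos[OF \<phi> sV] and sN = subgroup_neg[OF \<phi> sV]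
  note mV = subgroup.m_closed[OF sV] subgroup.m_inv_closed[OF sV]
  obtain a b where ab: "a \<in> neg \<phi> V" "b \<in> pos \<phi> V" "x = a \<otimes> b" using tidyD(2)[OF t x] by blast
  have c: "a \<in> carrier G" "b \<in> carrier G" using ab pos_carrier neg_carrier by blast+
  define f where "f j = V #> ev \<phi> (int j) b" for j :: nat
  have "ev \<phi> (int j) b \<in> V <#> C" for j
  proof -
    have "ev \<phi> (int j) x = ev \<phi> (int j) a \<otimes> ev \<phi> (int j) b" using ab c \<phi> by simp
    then have "ev \<phi> (int j) b = inv (ev \<phi> (int j) a) \<otimes> ev \<phi> (int j) x" using c \<phi> by (intro solve_left) auto
    moreover have "inv (ev \<phi> (int j) a) \<in> V" using negD[OF ab(1)] mV by simp
    moreover have "ev \<phi> (int j) x \<in> C" using C(2) by simp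
    ultimately show ?thesis unfolding set_mult_def by blast
  qed
  then have "bdd (range (\<lambda>j. ev \<phi> (int j) b))" by (intro bdd_subset[OF bdd_mult[OF bdd_COS[OF V] C(1)]]) blast
  then have "finite ((\<lambda>a. V #> a) ` range (\<lambda>j. ev \<phi> (int j) b))" using \<phi> c by (intro finite_rcos_image[OF V]) auto
  then have "finite (range f)" unfolding f_def by (simp add: image_image)
  then obtain I where I: "finite I" "range f = f ` I" by (metis finite_subset_image subset_refl subset_UNIV)
  define N where "N = Max I"
  have rep: "\<exists>i\<le>N. f j = f i" for j
  proof -
    have "f j \<in> f ` I" using I(2) by blast
    then obtain i where "i \<in> I" "f j = f i" by blast
    then show ?thesis using Max_ge[OF I(1)] unfolding N_def by blast
  qed
  have key: "ev \<phi> (int j - int N) b \<in> pos \<phi> V" for j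
  proof -
    obtain i where i: "i \<le> N" "f j = f i" using rep by blast
    define r where "r = ev \<phi> (int j) b \<otimes> inv (ev \<phi> (int i) b)"
    have rc: "r \<in> carrier G" using \<phi> c by (simp add: r_def)
    have rV: "r \<in> V" using i(2) rcos_eq_iff[OF sV] \<phi> c by (simp add: f_def r_def)
    have "ev \<phi> k r \<in> V" if k: "k \<le> - int (max i j)" for k
    proof -
      have "ev \<phi> k (ev \<phi> (int j) b) \<in> V" "ev \<phi> k (ev \<phi> (int i) b) \<in> V"
        using posD[OF ab(2)] k \<phi> c by (auto simp: ev_ev)
      then show ?thesis using \<phi> c mV by (simp add: r_def)
    qed
    then have rP: "r \<in> pos \<phi> V" using tidyD(3)[OF t rV] by blast
    have "ev \<phi> (int j) b = r \<otimes> ev \<phi> (int i) b" using \<phi> c by (simp add: r_def m_assoc)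
    then have "ev \<phi> (- int N) (ev \<phi> (int j) b) = ev \<phi> (- int N) r \<otimes> ev \<phi> (- int N) (ev \<phi> (int i) b)"
      using \<phi> c rc by simp
    moreover have "ev \<phi> (- int N) r \<in> pos \<phi> V" using ev_pos[OF \<phi> rP] by simp
    moreover have "ev \<phi> (- int N) (ev \<phi> (int i) b) \<in> pos \<phi> V" using ev_pos[OF \<phi> ab(2), of "int i - int N"] i \<phi> c by (simp add: ev_ev)
    ultimately have "ev \<phi> (- int N) (ev \<phi> (int j) b) \<in> pos \<phi> V" using subgroup.m_closed[OF sP] by simp
    then show ?thesis using \<phi> c by (simp add: ev_ev)
  qed
  have "b \<in> neg \<phi> V"
  proof (rule negI[OF c(2)])
    fix j :: int assume "0 \<le> j"
    then show "ev \<phi> j b \<in> V" using key[of "nat j + N"] pos_subset by auto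
  qed
  then show ?thesis using ab subgroup.m_closed[OF sN] by simp
qed

text \<open>Inverting elements exchanges the order of the two factors. The second condition for the
  inverse concerns forward orbits that end up in \<open>V\<close>; these are bounded, so
  \<open>tidy_bdd_neg\<close> applies.\<close>

lemma tidy_inv:
  assumes \<phi>: "\<phi> \<in> Aut G T" and t: "tidy \<phi> V"
  shows "tidy (ainv \<phi>) V"
proof -
  note V = tidyD(1)[OF t]
  note Vc = COS_D(4)[OF V] and sV = COS_D(1)[OF V]
  note sP = subgroup_pos[OF \<phi> sV] and sN = subgroup_neg[OF \<phi> sV]
  have "\<exists>a\<in>pos \<phi> V. \<exists>b\<in>neg \<phi> V. x = a \<otimes> b" if x: "x \<in> V" for x
  proof -
    obtain a b where ab: "a \<in> neg \<phi> V" "b \<in> pos \<phi> V" "inv x = a \<otimes> b"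
      using tidyD(2)[OF t subgroup.m_inv_closed[OF sV x]] by blast
    have c: "a \<in> carrier G" "b \<in> carrier G" "x \<in> carrier G" using ab x Vc pos_carrier neg_carrier by blast+
    have "x = inv b \<otimes> inv a" using ab(3) c by (metis inv_inv inv_mult_group)
    then show ?thesis using ab subgroup.m_inv_closed[OF sP] subgroup.m_inv_closed[OF sN] by blast
  qed
  moreover have "x \<in> neg \<phi> V" if x: "x \<in> V" and n: "\<forall>j\<le>n. ev \<phi> (- j) x \<in> V" for x n
  proof (rule tidy_bdd_neg[OF \<phi> t x])
    let ?F = "(\<lambda>j. ev \<phi> j x) ` {0..-n}"
    have "bdd ?F" using \<phi> x Vc by (intro bdd_finite) auto
    then show "bdd (V \<union> ?F)" using bdd_Un bdd_COS[OF V] by blast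
    fix j :: int assume "0 \<le> j"
    then show "ev \<phi> j x \<in> V \<union> ?F" using n[rule_format, of "-j"] by (cases "j \<le> -n") auto
  qed
  ultimately show ?thesis using V \<phi> unfolding tidy_def tidy_above_def
    by (auto simp: pos_inv neg_inv ev_inv)
qed

lemma tidy_bdd_pos:
  assumes \<phi>: "\<phi> \<in> Aut G T" and t: "tidy \<phi> V" and x: "x \<in> V" and C: "bdd C" "\<And>j. j \<le> 0 \<Longrightarrow> ev \<phi> j x \<in> C"
  shows "x \<in> pos \<phi> V"
  using tidy_bdd_neg[of "ainv \<phi>" V x C] tidy_inv[OF \<phi> t] assms by (simp add: neg_inv ev_inv)

text \<open>The closed sets \<phi>^(-n)(pos) decrease to
  \<open>pos \<phi> U \<inter> neg \<phi> U\<close> inside the compact group \<open>U\<close>, so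
  they finally enter the open set of products of this intersection with \<open>Q\<close>.\<close>

lemma pos_contracts:
  assumes \<phi>: "\<phi> \<in> Aut G T" and U: "U \<in> COS G T" and Q: "Q \<in> COS G T"
  shows "\<exists>m. \<forall>n\<ge>m. \<forall>x\<in>pos \<phi> U. \<exists>c\<in>pos \<phi> U \<inter> neg \<phi> U. \<exists>d\<in>Q. ev \<phi> (- int n) x = c \<otimes> d"
proof -
  let ?P = "pos \<phi> U" and ?Z = "pos \<phi> U \<inter> neg \<phi> U"
  define D where "D = (\<Union>c\<in>?Z. {x \<in> topspace T. inv c \<otimes> x \<in> Q})"
  have Dop: "openin T D" unfolding D_def
  proof (intro openin_Union, clarify)
    fix c assume "c \<in> ?P" "c \<in> neg \<phi> U"
    then have "c \<in> carrier G" using pos_carrier by blast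
    then have "continuous_map T T (\<lambda>x. inv c \<otimes> x)" by (intro continuous_mult_fun) auto
    then show "openin T {x \<in> topspace T. inv c \<otimes> x \<in> Q}" using COS_D(2)[OF Q] by (rule openin_continuous_map_preimage)
  qed
  define S where "S n = ev \<phi> (- int n) ` ?P - D" for n
  have mem: "x \<in> ev \<phi> (- int n) ` ?P \<longleftrightarrow> ev \<phi> (int n) x \<in> ?P" if "x \<in> carrier G" for x n
    using mem_ev_image[OF \<phi> that pos_carrier, of "- int n"] by simp
  have cl: "closedin T (S n)" for n unfolding S_def
    using \<phi> by (intro closedin_diff Dop Aut_closedin_image closedin_pos U) auto
  have PU: "ev \<phi> (- int n) ` ?P \<subseteq> U" for n using posD[of _ \<phi> U "- int n"] by auto
  have anti: "S n \<subseteq> S m" if "m \<le> n" for m n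
  proof
    fix x assume x: "x \<in> S n"
    then have c: "x \<in> carrier G" using PU COS_D(4)[OF U] unfolding S_def by blast
    have "ev \<phi> (int n) x \<in> ?P" using x mem[OF c] unfolding S_def by simp
    from ev_pos[OF \<phi> this, of "int m - int n"] have "ev \<phi> (int m - int n) (ev \<phi> (int n) x) \<in> ?P"
      using that by simp
    then have "ev \<phi> (int m) x \<in> ?P" using \<phi> c by (simp add: ev_ev)
    then show "x \<in> S m" using mem[OF c] x unfolding S_def by simp
  qed
  have "\<exists>m. S m = {}"
  proof (rule ccontr)
    assume ne: "\<not> (\<exists>m. S m = {})"
    have "U \<inter> \<Inter>(range S) \<noteq> {}"
    proof (rule compactin_fip[THEN iffD1, THEN conjunct2, rule_format, OF COS_D(3)[OF U]], intro conjI ballI allI impI)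
      show "closedin T C" if "C \<in> range S" for C using that cl by blast
      fix \<F> assume F: "finite \<F> \<and> \<F> \<subseteq> range S"
      then obtain J where J: "finite J" "\<F> = S ` J" by (metis finite_subset_image)
      define m where "m = Max (insert 0 J)"
      obtain x where x: "x \<in> S m" using ne by blast
      have "x \<in> S j" if "j \<in> J" for j using anti[of j m] x Max_ge[of "insert 0 J" j] J that unfolding m_def by auto
      moreover have "x \<in> U" using x PU unfolding S_def by blast
      ultimately show "U \<inter> \<Inter>\<F> \<noteq> {}" using J by blast
    qed
    then obtain x where x: "x \<in> U" "\<And>n. x \<in> S n" by blast
    have c: "x \<in> carrier G" using x COS_D(4)[OF U] by blast
    have p: "ev \<phi> (int n) x \<in> ?P" for n using x(2)[of n] mem[OF c] unfolding S_def by simp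
    have "x \<in> ?P" using p[of 0] c by simp
    moreover have "x \<in> neg \<phi> U" unfolding neg_def using p pos_subset[of \<phi> U] c by blast
    moreover have "inv x \<otimes> x \<in> Q" using subgroup.one_closed[OF COS_D(1)[OF Q]] c by simp
    ultimately have "x \<in> D" using c unfolding D_def topspace_eq by blast
    then show False using x(2)[of 0] unfolding S_def by blast
  qed
  then obtain m where m: "S m = {}" by blast
  have "\<exists>c\<in>?Z. \<exists>d\<in>Q. ev \<phi> (- int n) x = c \<otimes> d" if n: "n \<ge> m" and x: "x \<in> ?P" for n x
  proof -
    have "S n = {}" using anti[OF n] m by blast
    then have "ev \<phi> (- int n) x \<in> D" using x unfolding S_def by blast
    then obtain c where c: "c \<in> ?Z" "inv c \<otimes> ev \<phi> (- int n) x \<in> Q" unfolding D_def by blast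
    have cc: "c \<in> carrier G" "x \<in> carrier G" using c x pos_carrier by blast+
    then have "ev \<phi> (- int n) x = c \<otimes> (inv c \<otimes> ev \<phi> (- int n) x)" using \<phi> by (simp add: m_assoc[symmetric])
    then show ?thesis using c by blast
  qed
  then show ?thesis by blast
qed

section \<open>Intersections and roots\<close>

lemma ev_pos_neg:
  assumes "\<phi> \<in> Aut G T" "x \<in> pos \<phi> V" "x \<in> neg \<phi> V"
  shows "ev \<phi> j x \<in> V" "ev \<phi> j x \<in> pos \<phi> V" "ev \<phi> j x \<in> neg \<phi> V"
proof -
  have c: "x \<in> carrier G" using assms pos_carrier by blast
  show *: "ev \<phi> j x \<in> V" for j using posD[OF assms(2), of j] negD[OF assms(3), of j] by (cases "j \<le> 0") auto
  show "ev \<phi> j x \<in> pos \<phi> V" "ev \<phi> j x \<in> neg \<phi> V"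
    using * assms(1) c by (auto intro!: posI negI simp: ev_ev)
qed

text \<open>Let w = a b in \<open>U\<close> and w = c d in \<open>V\<close>. The element z = b
  d^(-1) = a^(-1) c has a bounded two-sided orbit, as \<open>b\<close> and \<open>d\<close> control
  the past and \<open>a\<close> and \<open>c\<close> the future. It is shown to lie in both parts of
  \<open>V\<close>, and moving it across turns the factorization in \<open>U\<close> into one that
  is valid in \<open>V\<close> too.\<close>

lemma tidy_Int:
  assumes \<phi>: "\<phi> \<in> Aut G T" and tU: "tidy \<phi> U" and tV: "tidy \<phi> V"
  shows "tidy \<phi> (U \<inter> V)"
proof -
  note U = tidyD(1)[OF tU] and V = tidyD(1)[OF tV]
  note Uc = COS_D(4)[OF U] and sU = COS_D(1)[OF U] and Vc = COS_D(4)[OF V] and sV = COS_D(1)[OF V]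
  have Q: "U \<inter> V \<in> COS G T" using COS_Int[OF U V] .
  note sO = COS_D(1)[OF Q]
  have pI: "pos \<phi> (U \<inter> V) = pos \<phi> U \<inter> pos \<phi> V" by (auto simp: pos_def)
  have nI: "neg \<phi> (U \<inter> V) = neg \<phi> U \<inter> neg \<phi> V" by (auto simp: neg_def)
  obtain m1 where m1: "\<forall>n\<ge>m1. \<forall>x\<in>pos \<phi> U. \<exists>c\<in>pos \<phi> U \<inter> neg \<phi> U. \<exists>d\<in>U \<inter> V. ev \<phi> (- int n) x = c \<otimes> d"
    using pos_contracts[OF \<phi> U Q] by blast
  obtain m2 where m2: "\<forall>n\<ge>m2. \<forall>x\<in>pos \<phi> V. \<exists>c\<in>pos \<phi> V \<inter> neg \<phi> V. \<exists>d\<in>U \<inter> V. ev \<phi> (- int n) x = c \<otimes> d"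
    using pos_contracts[OF \<phi> V Q] by blast
  define n where "n = max m1 m2"
  \<comment> \<open>Up to a factor in the \<phi>-invariant group
    \<open>pos \<phi> W \<inter> neg \<phi> W\<close>, which can be moved to \<open>a\<close>, the
    point \<phi>^(-n)(b) lies in \<open>U \<inter> V\<close>.\<close>
  have adj: "\<exists>a\<in>neg \<phi> W. \<exists>b\<in>pos \<phi> W. w = a \<otimes> b \<and> ev \<phi> (- int n) b \<in> U \<inter> V"
    if tW: "tidy \<phi> W" and w: "w \<in> W"
      and ctr: "\<forall>x\<in>pos \<phi> W. \<exists>c\<in>pos \<phi> W \<inter> neg \<phi> W. \<exists>d\<in>U \<inter> V. ev \<phi> (- int n) x = c \<otimes> d" for W w
  proof -
    note sW = COS_D(1)[OF tidyD(1)[OF tW]]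
    obtain a b where ab: "a \<in> neg \<phi> W" "b \<in> pos \<phi> W" "w = a \<otimes> b" using tidyD(2)[OF tW w] by blast
    obtain c d where cd: "c \<in> pos \<phi> W" "c \<in> neg \<phi> W" "d \<in> U \<inter> V" "ev \<phi> (- int n) b = c \<otimes> d" using ctr ab(2) by blast
    have cc: "a \<in> carrier G" "b \<in> carrier G" "c \<in> carrier G" "d \<in> carrier G"
      using ab cd pos_carrier neg_carrier Uc by blast+
    let ?c = "ev \<phi> (int n) c" and ?d = "ev \<phi> (int n) d"
    note C = ev_pos_neg[OF \<phi> cd(1,2), of "int n"]
    have "ev \<phi> (int n) (ev \<phi> (- int n) b) = ?c \<otimes> ?d" using cd(4) cc \<phi> by simp
    then have b: "b = ?c \<otimes> ?d" using \<phi> cc by (simp add: ev_ev)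
    then have "?d = inv ?c \<otimes> b" using \<phi> cc by (intro solve_left) auto
    then have "?d \<in> pos \<phi> W" using C ab subgroup_pos[OF \<phi> sW]
      by (simp add: subgroup.m_closed subgroup.m_inv_closed)
    moreover have "a \<otimes> ?c \<in> neg \<phi> W" using C ab subgroup.m_closed[OF subgroup_neg[OF \<phi> sW]] by blast
    moreover have "w = (a \<otimes> ?c) \<otimes> ?d"
    proof -
      have "w = a \<otimes> (?c \<otimes> ?d)" using ab b by simp
      then show ?thesis using cc \<phi> by (simp add: m_assoc)
    qed
    moreover have "ev \<phi> (- int n) ?d \<in> U \<inter> V" using cd(3) cc \<phi> by (simp add: ev_ev)
    ultimately show ?thesis by blast
  qed
  have ta: "\<exists>a\<in>neg \<phi> (U \<inter> V). \<exists>b\<in>pos \<phi> (U \<inter> V). w = a \<otimes> b" if w: "w \<in> U \<inter> V" for w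
  proof -
    obtain a b where ab: "a \<in> neg \<phi> U" "b \<in> pos \<phi> U" "w = a \<otimes> b" "ev \<phi> (- int n) b \<in> U \<inter> V"
      using adj[OF tU, of w] w m1 unfolding n_def by auto
    obtain c d where cd: "c \<in> neg \<phi> V" "d \<in> pos \<phi> V" "w = c \<otimes> d" "ev \<phi> (- int n) d \<in> U \<inter> V"
      using adj[OF tV, of w] w m2 unfolding n_def by auto
    have cc: "a \<in> carrier G" "b \<in> carrier G" "c \<in> carrier G" "d \<in> carrier G"
      using ab cd pos_carrier neg_carrier by blast+
    define z where "z = b \<otimes> inv d"
    have "a \<otimes> b = c \<otimes> d" using ab cd by simp
    then have "b = inv a \<otimes> (c \<otimes> d)" using cc by (metis solve_left)
    then have z: "z = inv a \<otimes> c" using cc by (simp add: z_def m_assoc)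
    have zc: "z \<in> carrier G" using cc by (simp add: z_def)
    let ?C = "U <#> V"
    have orb: "ev \<phi> j z \<in> ?C" for j
    proof (cases "j \<le> 0")
      case True
      have "ev \<phi> j z = ev \<phi> j b \<otimes> inv (ev \<phi> j d)" using \<phi> cc by (simp add: z_def)
      then show ?thesis using posD[OF ab(2) True] posD[OF cd(2) True] subgroup.m_inv_closed[OF sV]
        unfolding set_mult_def by blast
    next
      case False
      then have j: "0 \<le> j" by simp
      have "ev \<phi> j z = inv (ev \<phi> j a) \<otimes> ev \<phi> j c" using \<phi> cc by (simp add: z)
      then show ?thesis using negD[OF ab(1) j] negD[OF cd(1) j] subgroup.m_inv_closed[OF sU]
        unfolding set_mult_def by blast
    qed
    have bC: "bdd ?C" by (intro bdd_mult bdd_COS U V)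
    \<comment> \<open>The criterion for bounded orbits needs a point of \<open>V\<close>, but
      \<open>z\<close> is only known to lie in the product of \<open>U\<close> and \<open>V\<close>.
      Its translate \<open>y\<close> is in \<open>V\<close> by the adjustment made in
      \<open>adj\<close>.\<close>
    define y where "y = ev \<phi> (- int n) z"
    have yc: "y \<in> carrier G" using \<phi> zc by (simp add: y_def)
    have "y = ev \<phi> (- int n) b \<otimes> inv (ev \<phi> (- int n) d)" using \<phi> cc by (simp add: y_def z_def)
    then have yO: "y \<in> U \<inter> V" using ab(4) cd(4) sO by (simp add: subgroup.m_closed[OF sO] subgroup.m_inv_closed[OF sO] del: Int_iff)
    have orby: "ev \<phi> j y \<in> ?C" for j using orb[of "j - int n"] \<phi> zc by (simp add: y_def ev_ev)
    have "y \<in> pos \<phi> V" "y \<in> neg \<phi> V"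
      using tidy_bdd_pos[OF \<phi> tV _ bC orby] tidy_bdd_neg[OF \<phi> tV _ bC orby] yO by blast+
    note Y = ev_pos_neg[OF \<phi> this, of "int n"]
    have "ev \<phi> (int n) y = z" using \<phi> zc by (simp add: y_def ev_ev)
    then have Z: "z \<in> pos \<phi> V" "z \<in> neg \<phi> V" using Y by simp_all
    have "b = z \<otimes> d" using cc by (simp add: z_def m_assoc)
    then have "b \<in> pos \<phi> V" using Z cd subgroup.m_closed[OF subgroup_pos[OF \<phi> sV]] by simp
    moreover have "a = c \<otimes> inv z" using cc by (simp add: z inv_mult_group m_assoc[symmetric])
    then have "a \<in> neg \<phi> V" using Z cd subgroup_neg[OF \<phi> sV] by (simp add: subgroup.m_closed subgroup.m_inv_closed)
    ultimately show ?thesis using ab unfolding pI nI by blast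
  qed
  have "x \<in> pos \<phi> (U \<inter> V)" if "x \<in> U \<inter> V" "\<forall>j\<le>n. ev \<phi> j x \<in> U \<inter> V" for x n
    using that tidyD(3)[OF tU, of x n] tidyD(3)[OF tV, of x n] unfolding pI by blast
  then show ?thesis using Q ta unfolding tidy_def tidy_above_def by blast
qed

lemma tidy_INT:
  assumes "\<phi> \<in> Aut G T" "finite I" "I \<noteq> {}" "\<And>i. i \<in> I \<Longrightarrow> tidy \<phi> (V i)"
  shows "tidy \<phi> (\<Inter>i\<in>I. V i)"
  using assms(2-) by (induction I rule: finite_ne_induct) (auto intro: tidy_Int[OF assms(1)])

text \<open>Multiplicativity is transported by \<psi>. As \<open>comm\<close> speaks of images of
  \<open>V\<close> only, it covers conjugates, maps that commute on \<open>V\<close>, and for \<psi>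
  = 1 two automorphisms whose powers move \<open>V\<close> alike.\<close>

lemma tidy_image:
  assumes \<phi>: "\<phi> \<in> Aut G T" and \<psi>: "\<psi> \<in> Aut G T" and \<theta>: "\<theta> \<in> Aut G T" and t: "tidy \<theta> V"
    and comm: "\<And>n. ev \<phi> (int n) ` \<psi> ` V = \<psi> ` ev \<theta> (int n) ` V"
  shows "tidy \<phi> (\<psi> ` V)"
proof -
  have m: "multv \<theta> V" using t tidy_iff_multv[OF \<theta>] by simp
  then have V: "V \<in> COS G T" by (simp add: multv_def)
  note sV = COS_D(1)[OF V]
  have i: "rel_index G (ev \<phi> (int n) ` \<psi> ` V) (\<psi> ` V) = rel_index G (ev \<theta> (int n) ` V) V" for n
    unfolding comm using \<psi> \<theta> sV by (intro rel_index_image) (auto simp: subgroup_image)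
  have "rel_index G (\<phi> ` \<psi> ` V) (\<psi> ` V) = rel_index G (\<theta> ` V) V" using i[of 1] \<phi> \<theta> by simp
  then have "multv \<phi> (\<psi> ` V)" using m i COS_image[OF \<psi> V] by (simp add: multv_def)
  then show ?thesis using tidy_iff_multv[OF \<phi>] by simp
qed

text \<open>The images \<phi>^i(V) are tidy for \<phi>^n since \<phi>^i commutes with it, and so is
  their intersection \<open>W\<close>. Membership in \<open>W\<close> records \<open>n\<close>
  consecutive positions of an orbit, so by division with remainder the positive and negative parts
  of \<open>W\<close> for \<phi>^n are contained in those for \<phi>.\<close>

lemma tidy_root:
  assumes \<phi>: "\<phi> \<in> Aut G T" and n: "n > 0" and t: "tidy (ev \<phi> (int n)) V"
  shows "tidy \<phi> (\<Inter>i\<in>{..<n}. ev \<phi> (int i) ` V)"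
proof -
  let ?\<alpha> = "ev \<phi> (int n)"
  note V = tidyD(1)[OF t]
  note Vc = COS_D(4)[OF V]
  define W where "W = (\<Inter>i\<in>{..<n}. ev \<phi> (int i) ` V)"
  have \<alpha>: "?\<alpha> \<in> Aut G T" using \<phi> by simp
  have tW: "tidy ?\<alpha> W" unfolding W_def
  proof (rule tidy_INT[OF \<alpha>])
    show "tidy ?\<alpha> (ev \<phi> (int i) ` V)" for i
      using \<phi> Vc by (intro tidy_image[OF \<alpha> _ \<alpha> t]) (auto simp: ev_mult ev_image add.commute)
  qed (use n in auto)
  note W = tidyD(1)[OF tW]
  have Wc: "W \<subseteq> carrier G" using COS_D(4)[OF W] .
  have memW: "x \<in> W \<longleftrightarrow> (\<forall>i\<in>{..<n}. ev \<phi> (- int i) x \<in> V)" if "x \<in> carrier G" for x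
    unfolding W_def using mem_ev_image[OF \<phi> that Vc] by simp
  have p: "pos ?\<alpha> W \<subseteq> pos \<phi> W"
  proof
    fix x assume x: "x \<in> pos ?\<alpha> W"
    then have c: "x \<in> carrier G" using pos_carrier by blast
    have all: "ev \<phi> (- int k) x \<in> V" for k
    proof -
      have "ev ?\<alpha> (- int (k div n)) x \<in> W" using x unfolding pos_def by blast
      then have "ev \<phi> (- int (k mod n)) (ev ?\<alpha> (- int (k div n)) x) \<in> V" using memW n c \<alpha> by simp
      then have "ev \<phi> (- int (k mod n) + int n * (- int (k div n))) x \<in> V" using \<phi> c by (simp add: ev_ev ev_mult)
      moreover have "- int (k mod n) + int n * (- int (k div n)) = - int k"
        by (metis minus_add_distrib mod_mult_div_eq mult_minus_right of_nat_add of_nat_mult add.inverse_inverse)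
      ultimately show ?thesis by simp
    qed
    have "ev \<phi> (- int j) x \<in> W" for j
    proof -
      have "ev \<phi> (- int i) (ev \<phi> (- int j) x) \<in> V" for i
        using all[of "i + j"] \<phi> c by (simp add: ev_ev)
      then show ?thesis using memW \<phi> c by simp
    qed
    then show "x \<in> pos \<phi> W" using c by (simp add: pos_def)
  qed
  have q: "neg ?\<alpha> W \<subseteq> neg \<phi> W"
  proof
    fix x assume x: "x \<in> neg ?\<alpha> W"
    then have c: "x \<in> carrier G" using neg_carrier by blast
    \<comment> \<open>Membership of \<phi>^j(x) in \<open>W\<close> involves exponents down to j -
      (n - 1), hence the range of \<open>k\<close>. Here \<open>d\<close> is k / n rounded up, and
      \<open>r\<close> is the distance from k to n d.\<close>
    have all: "ev \<phi> k x \<in> V" if k: "k > - int n" for k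
    proof -
      define d where "d = (k + int n - 1) div int n"
      define r where "r = int n * d - k"
      have dm: "int n * d + (k + int n - 1) mod int n = k + int n - 1" unfolding d_def by simp
      have m0: "0 \<le> (k + int n - 1) mod int n" "(k + int n - 1) mod int n < int n" using n by simp_all
      have r: "0 \<le> r" "r < int n" using dm m0 by (auto simp: r_def)
      have "d \<ge> 0" unfolding d_def using k n by (intro pos_imp_zdiv_nonneg_iff[THEN iffD2]) auto
      then have "ev ?\<alpha> d x \<in> W" using negD[OF x] by simp
      moreover have "nat r < n" using r by auto
      ultimately have "ev \<phi> (- int (nat r)) (ev ?\<alpha> d x) \<in> V" using memW[OF ev_closed[OF \<alpha> c]] by blast
      then show ?thesis using \<phi> c r by (simp add: ev_ev ev_mult r_def)
    qed
    have "ev \<phi> (int j) x \<in> W" for j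
    proof -
      have "ev \<phi> (- int i) (ev \<phi> (int j) x) \<in> V" if "i < n" for i
        using all[of "int j - int i"] that \<phi> c by (simp add: ev_ev)
      then show ?thesis using memW \<phi> c by simp
    qed
    then show "x \<in> neg \<phi> W" using c by (simp add: neg_def)
  qed
  have "\<exists>a\<in>neg \<phi> W. \<exists>b\<in>pos \<phi> W. x = a \<otimes> b" if "x \<in> W" for x using tidyD(2)[OF tW that] p q by blast
  moreover have "x \<in> pos \<phi> W" if x: "x \<in> W" and m: "\<forall>j\<le>m. ev \<phi> j x \<in> W" for x m
  proof -
    have "ev ?\<alpha> j x \<in> W" if j: "j \<le> - \<bar>m\<bar>" for j
    proof -
      have "int n * j \<le> 1 * j" using n j by (intro mult_right_mono_neg) auto
      then have "int n * j \<le> m" using j by simp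
      then show ?thesis using m \<phi> by (simp add: ev_mult)
    qed
    then show ?thesis using tidyD(3)[OF tW x] p by blast
  qed
  ultimately show ?thesis using W unfolding tidy_def tidy_above_def W_def[symmetric] by blast
qed

end


section \<open>Tidiness for a finite extension\<close>

text \<open>An ordered product of subsets, in general no subgroup. It is only used that a subgroup
  containing all factors contains the product.\<close>

fun plist :: "('a,'b) monoid_scheme \<Rightarrow> 'a set list \<Rightarrow> 'a set" where
  "plist G [] = {\<one>\<^bsub>G\<^esub>}"
| "plist G (S # Ss) = S <#>\<^bsub>G\<^esub> plist G Ss"

context tdlc
begin

lemma plist_subset:
  assumes "subgroup H G" "\<And>S. S \<in> set Ss \<Longrightarrow> S \<subseteq> H" shows "plist G Ss \<subseteq> H"
  using assms(2)
proof (induction Ss)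
  case Nil then show ?case using subgroup.one_closed[OF assms(1)] by simp
next
  case (Cons S Ss)
  then have "S \<subseteq> H" "plist G Ss \<subseteq> H" by auto
  then show ?case using subgroup.m_closed[OF assms(1)] by (auto simp: set_mult_def)
qed

lemma plist_append:
  assumes "\<And>S. S \<in> set (Ss @ Rs) \<Longrightarrow> S \<subseteq> carrier G"
  shows "plist G (Ss @ Rs) = plist G Ss <#> plist G Rs"
proof -
  have c: "plist G Rs \<subseteq> carrier G" using assms by (intro plist_subset subgroup_self) auto
  show ?thesis using assms
  proof (induction Ss)
    case Nil
    then show ?case using c by (force simp: set_mult_def)
  next
    case (Cons S Ss)
    have "plist G Ss \<subseteq> carrier G" using Cons.prems by (intro plist_subset subgroup_self) auto
    then show ?case using Cons c by (simp add: set_mult_assoc)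
  qed
qed

end

text \<open>The situation after the transfer, with \<open>P\<close> in the role of its kernel and
  \<open>K\<close> the group whose tidiness is provided through \<open>ok\<close>. Commutativity of
  F/P is stated with elements, so that it can be applied to subsets of the group fixed by
  \<open>P\<close>.\<close>

locale flat_extension = tdlc +
  fixes F P K
  assumes F: "subgroup F AG" and P: "subgroup P AG" and K: "subgroup K AG"
    and PK: "P \<subseteq> K" and KF: "K \<subseteq> F"
    and comm: "\<And>\<phi> \<psi>. \<phi> \<in> F \<Longrightarrow> \<psi> \<in> F \<Longrightarrow> \<exists>p\<in>P. \<phi> \<cdot> \<psi> = \<psi> \<cdot> \<phi> \<cdot> p"
begin

lemma FA: "\<phi> \<in> F \<Longrightarrow> \<phi> \<in> Aut G T" using subgroup.mem_carrier[OF F] by (simp add: carrier_Aut)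
lemma KF': "k \<in> K \<Longrightarrow> k \<in> F" using KF by blast
lemma KA: "k \<in> K \<Longrightarrow> k \<in> Aut G T" using FA KF' by blast
lemma PK': "p \<in> P \<Longrightarrow> p \<in> K" using PK by blast
lemma PF: "p \<in> P \<Longrightarrow> p \<in> F" using PK' KF' by blast
lemma F_closed [simp]: "\<phi> \<in> F \<Longrightarrow> \<psi> \<in> F \<Longrightarrow> \<phi> \<cdot> \<psi> \<in> F" "\<phi> \<in> F \<Longrightarrow> ainv \<phi> \<in> F" "\<one>\<^bsub>AG\<^esub> \<in> F"
  using F by (auto simp: subgroup.m_closed subgroup.m_inv_closed subgroup.one_closed)
lemma K_closed [simp]: "\<phi> \<in> K \<Longrightarrow> \<psi> \<in> K \<Longrightarrow> \<phi> \<cdot> \<psi> \<in> K" "\<phi> \<in> K \<Longrightarrow> ainv \<phi> \<in> K" "\<one>\<^bsub>AG\<^esub> \<in> K"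
  using K by (auto simp: subgroup.m_closed subgroup.m_inv_closed subgroup.one_closed)
lemma P_one [simp]: "\<one>\<^bsub>AG\<^esub> \<in> P" using P by (simp add: subgroup.one_closed)
lemma F_ev [simp]: "\<phi> \<in> F \<Longrightarrow> ev \<phi> j \<in> F" using AG.subgroup_int_pow_closed[OF F] .
lemma K_ev [simp]: "\<phi> \<in> K \<Longrightarrow> ev \<phi> j \<in> K" using AG.subgroup_int_pow_closed[OF K] .

definition Pset where "Pset S \<longleftrightarrow> S \<subseteq> carrier G \<and> (\<forall>p\<in>P. p ` S = S)"

lemma PsetD: "Pset S \<Longrightarrow> S \<subseteq> carrier G" "Pset S \<Longrightarrow> p \<in> P \<Longrightarrow> p ` S = S" by (auto simp: Pset_def)

lemma comm_image:
  assumes "\<phi> \<in> F" "\<psi> \<in> F" "Pset S" shows "\<phi> ` \<psi> ` S = \<psi> ` \<phi> ` S"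
proof -
  obtain p where p: "p \<in> P" "\<phi> \<cdot> \<psi> = \<psi> \<cdot> \<phi> \<cdot> p" using comm[OF assms(1,2)] by blast
  note S = PsetD[OF assms(3)]
  have "\<phi> ` \<psi> ` S = (\<phi> \<cdot> \<psi>) ` S" using mult_image[OF S(1)] by simp
  also have "\<dots> = (\<psi> \<cdot> \<phi>) ` p ` S" unfolding p(2) using mult_image[OF S(1)] by simp
  also have "\<dots> = \<psi> ` \<phi> ` S" using mult_image[OF S(1)] S(2)[OF p(1)] by simp
  finally show ?thesis .
qed

lemma Pset_image: assumes "\<phi> \<in> F" "Pset S" shows "Pset (\<phi> ` S)"
  unfolding Pset_def
  using Aut_image_subset[OF FA[OF assms(1)] PsetD(1)[OF assms(2)]] comm_image[OF PF assms(1,2)] PsetD(2)[OF assms(2)]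
  by simp

text \<open>The two composites need not agree at \<open>x\<close>. Both memberships place
  \<open>x\<close> in the image of \<open>S\<close> under the two inverses, and for a
  \<open>P\<close>-invariant set their order is irrelevant.\<close>

lemma comm_mem:
  assumes "\<phi> \<in> F" "\<psi> \<in> F" "Pset S" "x \<in> carrier G" shows "\<phi> (\<psi> x) \<in> S \<longleftrightarrow> \<psi> (\<phi> x) \<in> S"
proof -
  have *: "\<phi> (\<psi> x) \<in> S \<longleftrightarrow> x \<in> (ainv \<psi>) ` (ainv \<phi>) ` S" if "\<phi> \<in> F" "\<psi> \<in> F" for \<phi> \<psi>
  proof -
    note A = FA[OF that(1)] FA[OF that(2)]
    have i: "ainv (ainv \<phi>) = \<phi>" "ainv (ainv \<psi>) = \<psi>" using A by (simp_all add: carrier_Aut)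
    show ?thesis
      using image_iff_inv[of "ainv \<psi>" x "(ainv \<phi>) ` S"] image_iff_inv[of "ainv \<phi>" "\<psi> x" S]
        Aut_image_subset[of "ainv \<phi>" S] assms(4) PsetD(1)[OF assms(3)] A i
      by (simp add: Aut_closed)
  qed
  have "(ainv \<psi>) ` (ainv \<phi>) ` S = (ainv \<phi>) ` (ainv \<psi>) ` S"
    using assms by (intro comm_image) auto
  then show ?thesis using *[OF assms(1,2)] *[OF assms(2,1)] by simp
qed

lemma ev_mult_image:
  assumes "\<phi> \<in> F" "\<psi> \<in> F" "Pset S"
  shows "ev (\<phi> \<cdot> \<psi>) (int n) ` S = ev \<phi> (int n) ` ev \<psi> (int n) ` S"
proof (induction n)
  case 0 then show ?case using PsetD(1)[OF assms(3)] by simp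
next
  case (Suc n)
  note S = PsetD(1)[OF assms(3)] and A = FA[OF assms(1)] FA[OF assms(2)]
  have suc: "ev \<theta> (int (Suc n)) ` R = \<theta> ` ev \<theta> (int n) ` R" if "\<theta> \<in> Aut G T" "R \<subseteq> carrier G" for \<theta> R
    using ev_image[OF that, of 1 "int n"] that by simp
  have c: "ev \<psi> (int n) ` S \<subseteq> carrier G" "ev \<psi> (int (Suc n)) ` S \<subseteq> carrier G" "ev \<phi> (int n) ` ev \<psi> (int n) ` S \<subseteq> carrier G"
    using A S by (auto intro!: Aut_image_subset)
  have "ev (\<phi> \<cdot> \<psi>) (int (Suc n)) ` S = (\<phi> \<cdot> \<psi>) ` ev \<phi> (int n) ` ev \<psi> (int n) ` S"
    using suc[of "\<phi> \<cdot> \<psi>" S] A S Suc by simp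
  also have "\<dots> = \<phi> ` \<psi> ` ev \<phi> (int n) ` ev \<psi> (int n) ` S" by (rule mult_image[OF c(3)])
  also have "\<psi> ` ev \<phi> (int n) ` ev \<psi> (int n) ` S = ev \<phi> (int n) ` \<psi> ` ev \<psi> (int n) ` S"
    using assms by (intro comm_image Pset_image) auto
  also have "\<phi> ` ev \<phi> (int n) ` \<psi> ` ev \<psi> (int n) ` S = ev \<phi> (int (Suc n)) ` ev \<psi> (int (Suc n)) ` S"
    using suc[OF A(1) c(2)] suc[OF A(2) S] by simp
  finally show ?case .
qed

section \<open>The groups \<open>V\<^sub>C\<close>\<close>

definition ok where "ok W \<longleftrightarrow> W \<in> COS G T \<and> Pset W \<and> (\<forall>k\<in>K. tidy k W)"

lemma okD: assumes "ok W" shows "W \<in> COS G T" "Pset W" "k \<in> K \<Longrightarrow> tidy k W" "W \<subseteq> carrier G" "subgroup W G"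
  using assms COS_D[of W] by (auto simp: ok_def)

lemma tidy_Pset_image:
  assumes "\<phi> \<in> F" "\<psi> \<in> F" "Pset V" "tidy \<phi> V" shows "tidy \<phi> (\<psi> ` V)"
  using assms comm_image[of _ \<psi> V] by (intro tidy_image[OF FA FA FA]) auto

text \<open>For empty \<open>C\<close> this is the whole carrier. The families that occur are
  usually infinite, so these groups are closed but need not be open.\<close>

definition Vc where "Vc W C = {x \<in> carrier G. \<forall>c\<in>C. x \<in> c ` W}"

lemma Vc_carrier: "Vc W C \<subseteq> carrier G" by (auto simp: Vc_def)
lemma Vc_anti: "C \<subseteq> C' \<Longrightarrow> Vc W C' \<subseteq> Vc W C" by (auto simp: Vc_def)
lemma Vc_mono: "W \<subseteq> W' \<Longrightarrow> Vc W C \<subseteq> Vc W' C" unfolding Vc_def by blast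
lemma VcD: assumes "x \<in> Vc W C" "c \<in> C" "C \<subseteq> F" "W \<subseteq> carrier G" shows "(ainv c) x \<in> W"
  using assms image_iff_inv[of c x W] FA[of c] by (auto simp: Vc_def)
lemma VcI: assumes "x \<in> carrier G" "C \<subseteq> F" "W \<subseteq> carrier G" "\<And>c. c \<in> C \<Longrightarrow> (ainv c) x \<in> W" shows "x \<in> Vc W C"
  using assms image_iff_inv[OF FA] by (auto simp: Vc_def)

lemma subgroup_Vc: assumes "subgroup W G" "C \<subseteq> F" shows "subgroup (Vc W C) G"
proof -
  have s: "subgroup (c ` W) G" if "c \<in> C" for c using that assms FA subgroup_image by blast
  show ?thesis
    by (rule subgroupI) (use subgroup.one_closed[OF s] subgroup.m_closed[OF s] subgroup.m_inv_closed[OF s] in \<open>auto simp: Vc_def\<close>)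
qed

lemma closedin_Vc: assumes "W \<in> COS G T" "C \<subseteq> F" shows "closedin T (Vc W C)"
proof -
  have "Vc W C = topspace T \<inter> (\<Inter>c\<in>C. c ` W)" by (auto simp: Vc_def)
  moreover have "closedin T (c ` W)" if "c \<in> C" for c using that assms FA COS_image COS_closed by blast
  moreover have "closedin T (topspace T)" by (rule closedin_topspace)
  ultimately show ?thesis by (cases "C = {}") (auto intro!: closedin_Int closedin_INT simp del: topspace_eq)
qed

lemma Pset_Vc: assumes "Pset W" "C \<subseteq> F" shows "Pset (Vc W C)"
proof -
  have sub: "p ` Vc W C \<subseteq> Vc W C" if "p \<in> P" for p
  proof
    fix y assume "y \<in> p ` Vc W C"
    then obtain x where x: "x \<in> Vc W C" "y = p x" by blast
    have "y \<in> c ` W" if "c \<in> C" for c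
    proof -
      have "y \<in> p ` c ` W" using x that by (auto simp: Vc_def)
      then show ?thesis using PsetD(2)[OF Pset_image[of c W] \<open>p \<in> P\<close>] assms that by blast
    qed
    moreover have "y \<in> carrier G" using x Aut_closed[OF FA[OF PF[OF that]]] by (auto simp: Vc_def)
    ultimately show "y \<in> Vc W C" by (simp add: Vc_def)
  qed
  have "p ` Vc W C = Vc W C" if p: "p \<in> P" for p
  proof
    have ip: "ainv p \<in> P" using subgroup.m_inv_closed[OF P p] .
    show "Vc W C \<subseteq> p ` Vc W C"
      using image_mono[OF sub[OF ip], of p] inv_image(2)[OF FA[OF PF[OF p]] Vc_carrier, of W C] by simp
  qed (rule sub[OF p])
  then show ?thesis by (simp add: Pset_def Vc_carrier)
qed

text \<open>Submonoids between \<open>P\<close> and \<open>K\<close>; closure under products makes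
  each element of \<open>C\<close> expand \<open>Vc W C\<close>. As \<open>F\<close> is abelian
  modulo \<open>P\<close>, powers of \<open>y\<close> on the left suffice for \<open>adj y C\<close>
  to be the submonoid generated by \<open>y\<close> and \<open>C\<close>.\<close>

definition smon where "smon C \<longleftrightarrow> P \<subseteq> C \<and> C \<subseteq> K \<and> (\<forall>c\<in>C. \<forall>d\<in>C. c \<cdot> d \<in> C)"
definition adj where "adj y C = {ev y (int j) \<cdot> c | j c. c \<in> C}"

lemma smonD: assumes "smon C" shows "P \<subseteq> C" "C \<subseteq> K" "c \<in> C \<Longrightarrow> d \<in> C \<Longrightarrow> c \<cdot> d \<in> C" "\<one>\<^bsub>AG\<^esub> \<in> C" "C \<subseteq> F"
  using assms KF P_one by (auto simp: smon_def)

lemma smon_P: "smon P" using subgroup.m_closed[OF P] PK by (auto simp: smon_def)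

lemma smon_ev: assumes "smon C" "c \<in> C" shows "ev c (int j) \<in> C"
proof (induction j)
  case 0 then show ?case using smonD(4)[OF assms(1)] by simp
next
  case (Suc j)
  have "c \<in> Aut G T" using assms smonD(2) KA by blast
  then have "ev c (int (Suc j)) = c \<cdot> ev c (int j)" using ev_add[of c 1 "int j"] by simp
  then show ?case using smonD(3)[OF assms(1) assms(2) Suc] by simp
qed

lemma adj_supset: assumes "C \<subseteq> F" "y \<in> F" shows "C \<subseteq> adj y C"
proof
  fix c assume c: "c \<in> C"
  then have "c = ev y (int 0) \<cdot> c" using assms FA[of c] by (auto simp: carrier_Aut)
  then show "c \<in> adj y C" using c unfolding adj_def by blast
qed

lemma smon_adj: assumes C: "smon C" and y: "y \<in> K" shows "smon (adj y C)" "y \<in> adj y C"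
proof -
  note CD = smonD[OF C]
  have yA: "y \<in> Aut G T" using y KA by blast
  have "y = ev y (int 1) \<cdot> \<one>\<^bsub>AG\<^esub>" using yA by (simp add: carrier_Aut)
  then show "y \<in> adj y C" using CD(4) unfolding adj_def by blast
  have "a \<cdot> b \<in> adj y C" if ab': "a \<in> adj y C" "b \<in> adj y C" for a b
  proof -
    obtain i c j d where ab: "a = ev y (int i) \<cdot> c" "c \<in> C" "b = ev y (int j) \<cdot> d" "d \<in> C"
      using ab' unfolding adj_def by blast
    obtain p where p: "p \<in> P" "c \<cdot> ev y (int j) = ev y (int j) \<cdot> c \<cdot> p"
      using comm[of c "ev y (int j)"] ab CD(5) KF'[OF y] by auto
    have cc: "c \<in> carrier AG" "d \<in> carrier AG" "p \<in> carrier AG" "ev y (int i) \<in> carrier AG" "ev y (int j) \<in> carrier AG"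
      using ab CD(5) FA PF[OF p(1)] yA by (auto simp: carrier_Aut)
    have "a \<cdot> b = ev y (int i) \<cdot> (c \<cdot> ev y (int j)) \<cdot> d"
      using ab cc by (simp add: AG.m_assoc)
    also have "\<dots> = (ev y (int i) \<cdot> ev y (int j)) \<cdot> (c \<cdot> p \<cdot> d)"
      unfolding p(2) using cc by (simp add: AG.m_assoc)
    also have "\<dots> = ev y (int (i + j)) \<cdot> (c \<cdot> p \<cdot> d)" using yA by (simp add: ev_add)
    finally show ?thesis using CD(1,3) ab p(1) unfolding adj_def by blast
  qed
  moreover have "adj y C \<subseteq> K" using CD(2) y by (auto simp: adj_def)
  ultimately show "smon (adj y C)" using adj_supset[OF CD(5) KF'[OF y]] CD(1) unfolding smon_def by blast
qed

lemma Vc_subset: assumes "ok W" "smon C" shows "Vc W C \<subseteq> W"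
proof
  fix x assume x: "x \<in> Vc W C"
  have "x \<in> \<one>\<^bsub>AG\<^esub> ` W" using x smonD(4)[OF assms(2)] by (auto simp: Vc_def)
  then show "x \<in> W" using okD(4)[OF assms(1)] by simp
qed

lemma Vc_expand:
  assumes W: "ok W" and C: "smon C" and c: "c \<in> C" and x: "x \<in> Vc W C"
  shows "(ainv c) x \<in> Vc W C"
proof -
  note Wc = okD(4)[OF W] and CF = smonD(5)[OF C]
  have cA: "c \<in> Aut G T" using c CF FA by blast
  have xc: "x \<in> carrier G" using x Vc_carrier by blast
  have "(ainv d) ((ainv c) x) \<in> W" if d: "d \<in> C" for d
  proof -
    have dA: "d \<in> Aut G T" using d CF FA by blast
    have "(ainv (c \<cdot> d)) x \<in> W" using VcD[OF x smonD(3)[OF C c d] CF Wc] .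
    then show ?thesis using cA dA xc by (simp add: AG.inv_mult_group carrier_Aut)
  qed
  then show ?thesis using CF Wc cA xc by (intro VcI) (auto simp: Aut_closed)
qed

text \<open>Each c(W) is tidy for \<open>y\<close>, because \<open>c\<close> and \<open>y\<close>
  commute on \<open>W\<close>, and so is the intersection of finitely many of them. Compactness
  extends the factorization into negative and positive part to all of \<open>C\<close>, and the two
  parts lie in the groups of the enlarged families.\<close>

lemma Vc_decomp:
  assumes W: "W \<in> COS G T" "Pset W" and y: "y \<in> F" "tidy y W" and C: "C \<subseteq> F" "C \<noteq> {}"
  shows "Vc W C \<subseteq> Vc W (adj (ainv y) C) <#> Vc W (adj y C)"
proof
  fix x assume x: "x \<in> Vc W C"
  note Wc = COS_D(4)[OF W(1)] and yA = FA[OF y(1)]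
  have xc: "x \<in> carrier G" using x Vc_carrier by blast
  obtain c0 where c0: "c0 \<in> C" using C by blast
  have cW: "c ` W \<in> COS G T" if "c \<in> C" for c using that C FA COS_image W by blast
  have "\<exists>a\<in>c0 ` W. \<forall>c\<in>C. a \<in> neg y (c ` W) \<and> inv a \<otimes> x \<in> pos y (c ` W)"
  proof (rule compact_factor[OF cW[OF c0] xc C(2)])
    fix J assume J: "finite J" "J \<subseteq> C"
    \<comment> \<open>The extra index keeps the first factor in the fixed compact group
      c0(W).\<close>
    let ?J = "insert c0 J"
    define Y where "Y = (\<Inter>c\<in>?J. c ` W)"
    have t: "tidy y Y" unfolding Y_def
      using J c0 C W y by (intro tidy_INT[OF yA] tidy_Pset_image) auto
    have "x \<in> Y" using x J c0 unfolding Y_def Vc_def by blast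
    then obtain a b where ab: "a \<in> neg y Y" "b \<in> pos y Y" "x = a \<otimes> b" using tidyD(2)[OF t] by blast
    have cc: "a \<in> carrier G" "b \<in> carrier G" using ab pos_carrier neg_carrier by blast+
    have "inv a \<otimes> x = b" using ab cc by (simp add: m_assoc[symmetric])
    moreover have "neg y Y \<subseteq> neg y (c ` W)" "pos y Y \<subseteq> pos y (c ` W)" if "c \<in> ?J" for c
      using that unfolding neg_def pos_def Y_def by blast+
    moreover have "a \<in> c0 ` W" using ab neg_subset[of y Y] unfolding Y_def by blast
    ultimately show "\<exists>a\<in>c0 ` W. \<forall>i\<in>J. a \<in> neg y (i ` W) \<and> inv a \<otimes> x \<in> pos y (i ` W)" using ab by blast
  qed (use closedin_neg closedin_pos cW yA in auto)
  then obtain a where a: "a \<in> c0 ` W" "\<And>c. c \<in> C \<Longrightarrow> a \<in> neg y (c ` W)" "\<And>c. c \<in> C \<Longrightarrow> inv a \<otimes> x \<in> pos y (c ` W)"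
    by blast
  have ac: "a \<in> carrier G" using a(2)[OF c0] neg_carrier by blast
  define b where "b = inv a \<otimes> x"
  have bc: "b \<in> carrier G" using ac xc by (simp add: b_def)
  have b: "b \<in> Vc W (adj y C)" if yC: "y \<in> F" "\<And>c. c \<in> C \<Longrightarrow> b \<in> pos y (c ` W)" "b \<in> carrier G" for b y
  proof -
    have yA: "y \<in> Aut G T" using FA yC by blast
    have "b \<in> (ev y (int j) \<cdot> c) ` W" if c: "c \<in> C" for j c
    proof -
      have cc: "c ` W \<subseteq> carrier G" using COS_D(4)[OF cW[OF c]] .
      have "ev y (- int j) b \<in> c ` W" using posD[OF yC(2)[OF c]] by simp
      then have "b \<in> ev y (int j) ` c ` W" using mem_ev_image[OF yA yC(3) cc] by simp
      then show ?thesis using mult_image[OF Wc] by simp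
    qed
    then show ?thesis using yC(3) unfolding Vc_def adj_def by blast
  qed
  have "b \<in> Vc W (adj y C)" using b[OF y(1)] a(3) bc by (simp add: b_def)
  moreover have "a \<in> Vc W (adj (ainv y) C)" using b[of "ainv y" a] y a(2) ac yA by (simp add: pos_inv)
  moreover have "x = a \<otimes> b" using ac xc by (simp add: b_def m_assoc[symmetric])
  ultimately show "x \<in> Vc W (adj (ainv y) C) <#> Vc W (adj y C)" unfolding set_mult_def by blast
qed


text \<open>By tidiness, an element of \<open>V\<close> whose backward orbits under \<open>C\<close> stay in a compact set already lies in \<open>V\<^sub>C\<close>.\<close>

lemma Vc_cap:
  assumes V: "ok V" and C: "smon C" and a: "a \<in> F" and x: "x \<in> a ` Vc V C" "x \<in> V"
  shows "x \<in> Vc V C"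
proof -
  note Vc' = okD(4)[OF V] and CF = smonD(5)[OF C] and aA = FA[OF a]
  obtain u where u: "u \<in> Vc V C" "x = a u" using x by blast
  have xc: "x \<in> carrier G" using x Vc' by blast
  have "(ainv c) x \<in> V" if c: "c \<in> C" for c
  proof -
    have cK: "c \<in> K" and cF: "c \<in> F" and cA: "c \<in> Aut G T" using c smonD(2)[OF C] KF' KA by blast+
    have "x \<in> pos c V"
    proof (rule tidy_bdd_pos[OF cA okD(3)[OF V cK] x(2)])
      show "bdd (a ` V)" by (rule bdd_COS[OF COS_image[OF aA okD(1)[OF V]]])
      fix j :: int assume "j \<le> 0"
      then obtain i where i: "j = - int i" by (metis nonpos_int_cases)
      have "u \<in> ev c (int i) ` V" using u smon_ev[OF C c] by (auto simp: Vc_def)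
      then have "x \<in> a ` ev c (int i) ` V" using u by blast
      also have "a ` ev c (int i) ` V = ev c (int i) ` a ` V" using a cF okD(2)[OF V] by (intro comm_image) auto
      finally show "ev c j x \<in> a ` V" using mem_ev_image[OF cA xc Aut_image_subset[OF aA Vc'], of "int i"] i by simp
    qed
    then have "ev c (-1) x \<in> V" by (rule posD) simp
    then show ?thesis using ev_minus[OF cA, of 1] cA by simp
  qed
  then show ?thesis using xc CF Vc' by (intro VcI) auto
qed

text \<open>By \<open>Vc_cap\<close> the image of \<open>Vc V C\<close> under \<open>a\<close> meets
  \<open>V\<close> only inside \<open>Vc V C\<close>. So the index can be counted with cosets of the
  open group \<open>V\<close>, which makes it finite although \<open>Vc V C\<close> need not be
  open.\<close>

lemma Vc_index:
  assumes V: "ok V" and C: "smon C" and a: "a \<in> F"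
  shows "rel_index G (a ` Vc V C) (Vc V C) = rel_index G (a ` Vc V C) V"
    "finite ((\<lambda>z. V #> z) ` a ` Vc V C)"
proof -
  have "a ` Vc V C \<inter> V = a ` Vc V C \<inter> Vc V C" using Vc_cap[OF V C a] Vc_subset[OF V C] by blast
  then show "rel_index G (a ` Vc V C) (Vc V C) = rel_index G (a ` Vc V C) V" by (simp add: rel_index_def)
  have aV: "a ` V \<in> COS G T" using COS_image[OF FA[OF a] okD(1)[OF V]] .
  show "finite ((\<lambda>z. V #> z) ` a ` Vc V C)"
    by (rule finite_subset[OF _ finite_rcos_COS[OF okD(1)[OF V] aV]]) (use Vc_subset[OF V C] in blast)
qed

lemma Vc_index_pos:
  assumes V: "ok V" and C: "smon C" and a: "a \<in> F"
  shows "rel_index G (a ` Vc V C) (Vc V C) > 0"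
proof -
  have s: "subgroup (a ` Vc V C) G" using subgroup_image[OF FA[OF a] subgroup_Vc[OF okD(5)[OF V] smonD(5)[OF C]]] .
  then have "rel_index G (a ` Vc V C) V = card ((\<lambda>z. V #> z) ` a ` Vc V C)" using rel_index_eq okD(5)[OF V] by blast
  moreover have "a ` Vc V C \<noteq> {}" using subgroup.one_closed[OF s] by blast
  ultimately show ?thesis using Vc_index[OF assms] by (simp add: card_gt_0_iff)
qed

text \<open>Generation of \<open>K\<close> modulo \<open>P\<close> up to powers. The exponent leaves
  room for generators that had to be replaced by powers in order to lie in a subgroup of finite
  index.\<close>

definition full where "full E \<longleftrightarrow> (\<forall>y\<in>K. \<exists>m>0. ev y (int m) \<in> generate AG (E \<union> P))"

definition lprod where "lprod gs = foldr (\<lambda>g h. g \<cdot> h) gs \<one>\<^bsub>AG\<^esub>"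

lemma lprod_in: "smon C \<Longrightarrow> set gs \<subseteq> C \<Longrightarrow> lprod gs \<in> C"
  by (induction gs) (auto simp: lprod_def smonD)

text \<open>It exhibits \<open>g\<close> as u^(-1) times the whole product times v^(-1). Hence a set
  that is stable under the product and under inverses of elements of \<open>C\<close> is stable
  under each generator.\<close>

lemma lprod_split:
  assumes C: "smon C" and "set gs \<subseteq> C" "g \<in> set gs"
  shows "\<exists>u\<in>C. \<exists>v\<in>C. lprod gs = u \<cdot> (g \<cdot> v)"
  using assms(2,3)
proof (induction gs)
  case (Cons h gs)
  have CA: "c \<in> carrier AG" if "c \<in> C" for c using that smonD(5)[OF C] FA by (auto simp: carrier_Aut)
  have l: "lprod (h # gs) = h \<cdot> lprod gs" by (simp add: lprod_def)
  have gC: "g \<in> C" "h \<in> C" "lprod gs \<in> C" using Cons.prems lprod_in[OF C, of gs] by auto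
  show ?case
  proof (cases "g = h")
    case True
    then show ?thesis using l gC smonD(4)[OF C] CA
      by (intro bexI[of _ "\<one>\<^bsub>AG\<^esub>"] bexI[of _ "lprod gs"]) auto
  next
    case False
    then obtain u v where uv: "u \<in> C" "v \<in> C" "lprod gs = u \<cdot> (g \<cdot> v)" using Cons by auto
    then show ?thesis using l gC CA smonD(3)[OF C]
      by (intro bexI[of _ "h \<cdot> u"] bexI[of _ v]) (auto simp: AG.m_assoc)
  qed
qed simp

text \<open>The intersection of the contracted groups is invariant under all generators, so the orbits of its elements
  under every element of \<open>K\<close> are bounded.\<close>

lemma Vc_core:
  assumes V: "ok V" and C: "smon C" and gs: "set gs \<subseteq> C" "full (set gs)" and C': "smon C'"
  shows "neg (lprod gs) (Vc V C) \<subseteq> Vc V C'"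
proof
  note VC = okD(4)[OF V] and CF = smonD(5)[OF C]
  define c0 where "c0 = lprod gs"
  have c0: "c0 \<in> C" "c0 \<in> F" "c0 \<in> Aut G T" using lprod_in[OF C gs(1)] CF FA unfolding c0_def by blast+
  let ?I = "neg c0 (Vc V C)"
  have PX: "Pset (Vc V C)" using Pset_Vc[OF okD(2)[OF V] CF] .
  have Ic: "?I \<subseteq> carrier G" by (rule neg_carrier)
  have i: "(ainv c) b \<in> ?I" if c: "c \<in> C" and b: "b \<in> ?I" for c b
  proof -
    have cF: "c \<in> F" and cA: "ainv c \<in> Aut G T" and bc: "b \<in> carrier G" using c b CF FA Ic by auto
    show ?thesis
    proof (rule negI)
      fix j :: int assume j: "0 \<le> j"
      have "(ainv c) (ev c0 j b) \<in> Vc V C" using Vc_expand[OF V C c negD[OF b j]] .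
      then show "ev c0 j ((ainv c) b) \<in> Vc V C" using comm_mem[of "ainv c" "ev c0 j" _ b] cF c0 PX bc by simp
    qed (use cA bc in \<open>simp add: Aut_closed\<close>)
  qed
  have ii: "c0 b \<in> ?I" if "b \<in> ?I" for b using ev_neg[OF c0(3) that, of 1] c0 by simp
  define St where "St = {\<phi> \<in> F. (\<forall>b\<in>?I. \<phi> b \<in> ?I) \<and> (\<forall>b\<in>?I. (ainv \<phi>) b \<in> ?I)}"
  have St: "subgroup St AG"
  proof (rule AG.subgroupI)
    show "St \<subseteq> carrier AG" using FA by (auto simp: St_def carrier_Aut)
    have "\<one>\<^bsub>AG\<^esub> \<in> St" using Ic by (auto simp: St_def subset_iff)
    then show "St \<noteq> {}" by blast
    show "ainv \<phi> \<in> St" if "\<phi> \<in> St" for \<phi> using that FA by (auto simp: St_def carrier_Aut)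
    show "\<phi> \<cdot> \<psi> \<in> St" if "\<phi> \<in> St" "\<psi> \<in> St" for \<phi> \<psi>
      using that FA Ic by (auto simp: St_def carrier_Aut AG.inv_mult_group subset_iff)
  qed
  have gSt: "g \<in> St" if g: "g \<in> set gs" for g
  proof -
    have gC: "g \<in> C" using g gs by blast
    obtain u v where uv: "u \<in> C" "v \<in> C" "c0 = u \<cdot> (g \<cdot> v)" using lprod_split[OF C gs(1) g] unfolding c0_def by blast
    have A: "u \<in> Aut G T" "v \<in> Aut G T" "g \<in> Aut G T" using uv gC CF FA by blast+
    have "g b \<in> ?I" if b: "b \<in> ?I" for b
    proof -
      have bc: "b \<in> carrier G" using b Ic by blast
      have "(ainv u) (c0 ((ainv v) b)) \<in> ?I" using i[OF uv(1) ii[OF i[OF uv(2) b]]] .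
      moreover have "c0 ((ainv v) b) = u (g b)" using uv(3) A bc by (simp add: Aut_closed inv_apply)
      ultimately show ?thesis using A bc by (simp add: inv_apply Aut_closed)
    qed
    then show ?thesis using i[OF gC] gC CF unfolding St_def by blast
  qed
  have pSt: "p \<in> St" if p: "p \<in> P" for p
  proof -
    have ip: "ainv p \<in> P" using subgroup.m_inv_closed[OF P p] .
    have pp: "ainv (ainv p) = p" using FA[OF PF[OF p]] by (simp add: carrier_Aut)
    have "p \<in> C" "ainv p \<in> C" using smonD(1)[OF C] p ip by blast+
    then show ?thesis using i[of p] i[of "ainv p"] pp PF[OF p] unfolding St_def by simp
  qed
  have gen: "generate AG (set gs \<union> P) \<subseteq> St" using AG.generate_subgroup_incl[OF _ St] gSt pSt by blast
  fix b assume "b \<in> neg (lprod gs) (Vc V C)"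
  then have b: "b \<in> ?I" by (simp add: c0_def)
  have bc: "b \<in> carrier G" using b Ic by blast
  have IV: "?I \<subseteq> V" using neg_subset Vc_subset[OF V C] by blast
  have "(ainv c) b \<in> V" if c: "c \<in> C'" for c
  proof -
    have cK: "c \<in> K" and cA: "c \<in> Aut G T" using c smonD(2)[OF C'] KA by blast+
    obtain m where m: "m > 0" "ev c (int m) \<in> St" using gs(2) cK gen unfolding full_def by blast
    have inv: "ev c (int m * i) b \<in> V" for i
    proof -
      have "ev (ev c (int m)) i \<in> St" using AG.subgroup_int_pow_closed[OF St m(2)] .
      then have "ev (ev c (int m)) i b \<in> ?I" using b unfolding St_def by blast
      then show ?thesis using cA IV by (auto simp: ev_mult)
    qed
    have "b \<in> pos c V"
    proof (rule tidy_bdd_pos[OF cA okD(3)[OF V cK]])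
      show "b \<in> V" using b IV by blast
      \<comment> \<open>The points of the orbit at multiples of \<open>m\<close> lie in the group
        \<open>?I\<close>, which is stable under \<open>ev c (int m)\<close>. The remaining points
        are their translates by the finitely many residues modulo \<open>m\<close>.\<close>
      show "bdd (\<Union>r\<in>{0..<int m}. ev c r ` V)"
        using cA okD(1)[OF V] by (intro bdd_finite_UN bdd_COS COS_image) auto
      fix j :: int
      have "ev c (j mod int m) (ev c (int m * (j div int m)) b) = ev c j b" using cA bc by (simp add: ev_ev)
      moreover have "j mod int m \<in> {0..<int m}" using m by simp
      moreover have "ev c (j mod int m) (ev c (int m * (j div int m)) b) \<in> ev c (j mod int m) ` V"
        using inv by (rule imageI)
      ultimately show "ev c j b \<in> (\<Union>r\<in>{0..<int m}. ev c r ` V)" by (simp only:) blast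
    qed
    then have "ev c (-1) b \<in> V" by (rule posD) simp
    then show ?thesis using ev_minus[OF cA, of 1] cA by simp
  qed
  then show "b \<in> Vc V C'" using bc smonD(5)[OF C'] VC by (intro VcI) auto
qed

text \<open>Let c0 be the product of the generators, X = \<open>Vc V C\<close> and Y =
  \<open>Vc V C'\<close>. Without a drop, coset counting gives c0(X) inside X c0(Y), hence X inside
  c0^(-j)(X) Y for all j. In the limit X lies in \<open>neg c0 X\<close> times Y, and
  \<open>Vc_core\<close> puts the first factor in Y.\<close>

lemma Vc_index_drop:
  assumes V: "ok V" and C: "smon C" and C': "smon C'" and CC: "C \<subseteq> C'" and gs: "set gs \<subseteq> C" "full (set gs)"
    and ne: "\<not> Vc V C \<subseteq> Vc V C'"
  shows "rel_index G (lprod gs ` Vc V C') (Vc V C') < rel_index G (lprod gs ` Vc V C) (Vc V C)"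
proof (rule ccontr)
  let ?X = "Vc V C" and ?Y = "Vc V C'"
  define c0 where "c0 = lprod gs"
  have c0: "c0 \<in> C" "c0 \<in> C'" "c0 \<in> F" "c0 \<in> Aut G T"
    using lprod_in[OF C gs(1)] CC smonD(5)[OF C] FA unfolding c0_def by blast+
  note sX = subgroup_Vc[OF okD(5)[OF V] smonD(5)[OF C]] and sY = subgroup_Vc[OF okD(5)[OF V] smonD(5)[OF C']]
  have YX: "?Y \<subseteq> ?X" using Vc_anti[OF CC] .
  have cX: "c0 ` ?X \<subseteq> carrier G" using Aut_image_subset[OF c0(4) Vc_carrier] .
  have i1: "ev c0 (-1) = ainv c0" using ev_minus[OF c0(4), of 1] c0 by simp
  assume "\<not> ?thesis"
  then have le: "rel_index G (c0 ` ?X) ?X \<le> rel_index G (c0 ` ?Y) ?Y" unfolding c0_def by simp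
  have "c0 ` ?X \<subseteq> (V \<inter> c0 ` ?X) <#> c0 ` ?Y"
  proof (rule rel_index_eq_cover)
    show "rel_index G (c0 ` ?X) V \<le> rel_index G (c0 ` ?Y) V"
      using le Vc_index(1)[OF V C c0(3)] Vc_index(1)[OF V C' c0(3)] by simp
  qed (use c0 sX sY subgroup_image okD(5)[OF V] YX Vc_index(2)[OF V C c0(3)] in auto)
  moreover have "V \<inter> c0 ` ?X \<subseteq> ?X" using Vc_cap[OF V C c0(3)] by blast
  ultimately have cov: "c0 ` ?X \<subseteq> ?X <#> c0 ` ?Y" using mono_set_mult[of "V \<inter> c0 ` ?X" ?X "c0 ` ?Y" "c0 ` ?Y" G] by blast
  have Xc: "?X \<subseteq> carrier G" by (rule Vc_carrier)
  have one: "\<exists>b\<in>?X. \<exists>a\<in>?Y. x = ev c0 (-1) b \<otimes> a" if x: "x \<in> ?X" for x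
  proof -
    obtain b a where ab: "b \<in> ?X" "a \<in> ?Y" "c0 x = b \<otimes> c0 a"
      using subsetD[OF cov imageI[OF x]] unfolding set_mult_def by blast
    have cc: "x \<in> carrier G" "b \<in> carrier G" "a \<in> carrier G" using x ab Vc_carrier by blast+
    have "ev c0 (-1) (c0 x) = ev c0 (-1) b \<otimes> ev c0 (-1) (c0 a)" using ab cc c0 by (simp add: Aut_closed)
    then have "x = ev c0 (-1) b \<otimes> a" using cc c0 i1 by (simp add: inv_apply)
    then show ?thesis using ab by blast
  qed
  have many: "\<exists>b\<in>?X. \<exists>a\<in>?Y. x = ev c0 (- int j) b \<otimes> a" if x: "x \<in> ?X" for x j
    using x
  proof (induction j arbitrary: x)
    case 0
    have "x \<in> carrier G" using 0 Vc_carrier by blast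
    then show ?case using 0 subgroup.one_closed[OF sY] by (intro bexI[of _ x] bexI[of _ \<one>]) auto
  next
    case (Suc j)
    obtain b a where ab: "b \<in> ?X" "a \<in> ?Y" "x = ev c0 (-1) b \<otimes> a" using one Suc.prems by blast
    obtain b' a' where ab': "b' \<in> ?X" "a' \<in> ?Y" "b = ev c0 (- int j) b' \<otimes> a'" using Suc.IH ab(1) by blast
    have cc: "b \<in> carrier G" "a \<in> carrier G" "b' \<in> carrier G" "a' \<in> carrier G" using ab ab' Vc_carrier by blast+
    have "ev c0 (-1) b = ev c0 (- int (Suc j)) b' \<otimes> ev c0 (-1) a'" unfolding ab'(3) using cc c0 by (simp add: ev_ev)
    then have "x = ev c0 (- int (Suc j)) b' \<otimes> (ev c0 (-1) a' \<otimes> a)" using ab(3) cc c0 by (simp add: m_assoc)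
    moreover have "ev c0 (-1) a' \<otimes> a \<in> ?Y"
      using Vc_expand[OF V C' c0(2) ab'(2)] ab(2) subgroup.m_closed[OF sY] by (simp add: i1)
    ultimately show ?case using ab' by blast
  qed
  have dec: "ev c0 (- int j) ` ?X \<subseteq> ev c0 (- int i) ` ?X" if "i \<le> j" for i j
  proof -
    have st: "ev c0 (- int k) ` ?X \<subseteq> ?X" for k
    proof (induction k)
      case 0 then show ?case using Xc by simp
    next
      case (Suc k)
      have "ev c0 (- int (Suc k)) ` ?X = ev c0 (-1) ` ev c0 (- int k) ` ?X"
        using ev_image[OF c0(4) Xc, of "-1" "- int k"] by simp
      also have "\<dots> \<subseteq> ev c0 (-1) ` ?X" using Suc by (rule image_mono)
      also have "\<dots> \<subseteq> ?X" using Vc_expand[OF V C c0(1)] by (auto simp: i1)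
      finally show ?case .
    qed
    have "ev c0 (- int j) ` ?X = ev c0 (- int i) ` ev c0 (- int (j - i)) ` ?X"
      using ev_image[OF c0(4) Xc, of "- int i" "- int (j - i)"] that by simp
    then show ?thesis using image_mono[OF st] by simp
  qed
  have "?X \<subseteq> ?Y"
  proof
    fix x assume x: "x \<in> ?X"
    have xc: "x \<in> carrier G" using x Vc_carrier by blast
    have "\<exists>b\<in>V. \<forall>j\<in>(UNIV::nat set). b \<in> ev c0 (- int j) ` ?X \<and> inv b \<otimes> x \<in> ?Y"
    proof (rule compact_factor[OF okD(1)[OF V] xc])
      fix J :: "nat set" assume J: "finite J" "J \<noteq> {}"
      obtain b a where ab: "b \<in> ?X" "a \<in> ?Y" "x = ev c0 (- int (Max J)) b \<otimes> a" using many[OF x] by blast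
      let ?b = "ev c0 (- int (Max J)) b"
      have cc: "b \<in> carrier G" "a \<in> carrier G" using ab Vc_carrier by blast+
      have "inv ?b \<otimes> x = a" using ab cc c0 by (simp add: m_assoc[symmetric])
      moreover have "?b \<in> ev c0 (- int j) ` ?X" if "j \<in> J" for j
        using dec[OF Max_ge[OF J(1) that]] ab(1) by blast
      moreover have "?b \<in> V" using dec[of 0 "Max J"] ab(1) Vc_carrier[of V C] Vc_subset[OF V C] by auto
      ultimately show "\<exists>b\<in>V. \<forall>j\<in>J. b \<in> ev c0 (- int j) ` ?X \<and> inv b \<otimes> x \<in> ?Y"
        using ab(2) by (intro bexI[of _ ?b]) simp_all
    qed (use c0 V smonD(5) C C' okD in \<open>auto intro!: Aut_closedin_image closedin_Vc\<close>)
    then obtain b where b: "b \<in> V" "\<And>j::nat. b \<in> ev c0 (- int j) ` ?X" "inv b \<otimes> x \<in> ?Y" by blast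
    have bc: "b \<in> carrier G" using b okD(4)[OF V] by blast
    have "ev c0 (int j) b \<in> ?X" for j using b(2)[of j] mem_ev_image[OF c0(4) bc Xc, of "- int j"] by simp
    then have "b \<in> neg c0 ?X" using bc by (simp add: neg_def)
    then have "b \<in> ?Y" using Vc_core[OF V C gs C'] unfolding c0_def by blast
    then have "b \<otimes> (inv b \<otimes> x) \<in> ?Y" using b(3) subgroup.m_closed[OF sY] by blast
    then show "x \<in> ?Y" using bc xc by (simp add: m_assoc[symmetric])
  qed
  then show False using ne by simp
qed


section \<open>Splitting into irreducible factors\<close>

definition dm where "dm D C = {d \<cdot> c | d c. d \<in> D \<and> c \<in> C}"

text \<open>The condition is imposed on orbits in \<open>V\<close>, because its failure for
  \<open>y\<close> is what makes the index drop for the monoids enlarged by \<open>y\<close> and by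
  its inverse. \<open>irr_Kp\<close> converts it into a statement on \<open>Vc V C\<close>
  alone.\<close>

definition irr where
  "irr V C \<longleftrightarrow> smon C \<and> (\<forall>y\<in>K. Vc V C \<subseteq> pos y V \<or> Vc V C \<subseteq> neg y V)"

text \<open>The same list of irreducible monoids has to serve every smaller tidy \<open>W\<close>, and every \<open>D\<close> so that it can be
  applied to the groups \<open>W\<^sub>k\<^sub>+\<close>.\<close>

definition splits where
  "splits V C \<longleftrightarrow> (\<exists>Cs. (\<forall>C'\<in>set Cs. irr V C') \<and>
     (\<forall>W D. ok W \<longrightarrow> D \<subseteq> F \<longrightarrow> D \<noteq> {} \<longrightarrow> Vc W (dm D C) \<subseteq> plist G (map (\<lambda>C'. Vc W (dm D C')) Cs)))"

lemma dm_F: "D \<subseteq> F \<Longrightarrow> C \<subseteq> F \<Longrightarrow> dm D C \<subseteq> F" unfolding dm_def using F_closed(1) by blast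

lemma Vc_adj_dm:
  assumes W: "Pset W" and "D \<subseteq> F" "C \<subseteq> F" "y \<in> F"
  shows "Vc W (adj y (dm D C)) \<subseteq> Vc W (dm D (adj y C))"
proof -
  note Wc = PsetD(1)[OF W]
  have "x \<in> (d \<cdot> (ev y (int j) \<cdot> c)) ` W" if x: "x \<in> Vc W (adj y (dm D C))" and d: "d \<in> D" and c: "c \<in> C" for x d c j
  proof -
    have dF: "d \<in> F" and cF: "c \<in> F" and yF: "ev y (int j) \<in> F" using d c assms by auto
    have cW: "c ` W \<subseteq> carrier G" "d ` c ` W \<subseteq> carrier G" 
      using Aut_image_subset[OF FA[OF cF] Wc] Aut_image_subset[OF FA[OF dF]] by simp_all
    have "x \<in> (ev y (int j) \<cdot> (d \<cdot> c)) ` W" using x d c unfolding Vc_def adj_def dm_def by blast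
    also have "\<dots> = ev y (int j) ` d ` c ` W" using mult_image[OF Wc] by simp
    also have "\<dots> = d ` ev y (int j) ` c ` W" using comm_image[OF yF dF Pset_image[OF cF W]] .
    also have "\<dots> = (d \<cdot> (ev y (int j) \<cdot> c)) ` W" using mult_image[OF Wc] by simp
    finally show ?thesis .
  qed
  moreover have "\<exists>d\<in>D. \<exists>j. \<exists>c\<in>C. e = d \<cdot> (ev y (int j) \<cdot> c)" if "e \<in> dm D (adj y C)" for e
    using that by (auto simp: dm_def adj_def)
  ultimately have "x \<in> e ` W" if "x \<in> Vc W (adj y (dm D C))" "e \<in> dm D (adj y C)" for x e
    using that by metis
  then show ?thesis using Vc_carrier[of W "adj y (dm D C)"] unfolding Vc_def[of W "dm D (adj y C)"] by blast
qed

text \<open>\<open>Vc_decomp\<close> is applied to the group \<open>W\<close> and the family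
  \<open>dm D C\<close>, and powers of \<open>y\<close> are moved past \<open>D\<close>. Thus one
  concatenated list of monoids works for all \<open>W\<close> and \<open>D\<close>.\<close>

lemma splits_step:
  assumes C: "C \<subseteq> F" "C \<noteq> {}" and y: "y \<in> K" and s: "splits V (adj (ainv y) C)" "splits V (adj y C)"
  shows "splits V C"
proof -
  have yF: "y \<in> F" "ainv y \<in> F" using KF'[OF y] by simp_all
  obtain Cs where Cs: "\<forall>C'\<in>set Cs. irr V C'"
     "\<And>W D. ok W \<Longrightarrow> D \<subseteq> F \<Longrightarrow> D \<noteq> {} \<Longrightarrow> Vc W (dm D (adj (ainv y) C)) \<subseteq> plist G (map (\<lambda>C'. Vc W (dm D C')) Cs)"
    using s(1) unfolding splits_def by blast
  obtain Ds where Ds: "\<forall>C'\<in>set Ds. irr V C'"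
     "\<And>W D. ok W \<Longrightarrow> D \<subseteq> F \<Longrightarrow> D \<noteq> {} \<Longrightarrow> Vc W (dm D (adj y C)) \<subseteq> plist G (map (\<lambda>C'. Vc W (dm D C')) Ds)"
    using s(2) unfolding splits_def by blast
  have "Vc W (dm D C) \<subseteq> plist G (map (\<lambda>C'. Vc W (dm D C')) (Cs @ Ds))" if W: "ok W" and D: "D \<subseteq> F" "D \<noteq> {}" for W D
  proof -
    have ne: "dm D C \<noteq> {}" using C D unfolding dm_def by blast
    have "Vc W (dm D C) \<subseteq> Vc W (adj (ainv y) (dm D C)) <#> Vc W (adj y (dm D C))"
      by (rule Vc_decomp[OF okD(1,2)[OF W] yF(1) okD(3)[OF W y] dm_F[OF D(1) C(1)] ne])
    also have "\<dots> \<subseteq> plist G (map (\<lambda>C'. Vc W (dm D C')) Cs) <#> plist G (map (\<lambda>C'. Vc W (dm D C')) Ds)"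
      by (intro mono_set_mult order_trans[OF Vc_adj_dm[OF okD(2)[OF W] D(1) C(1)]] Cs(2) Ds(2) W D yF)
    also have "\<dots> = plist G (map (\<lambda>C'. Vc W (dm D C')) (Cs @ Ds))"
      unfolding map_append by (rule plist_append[symmetric]) (auto simp: Vc_def)
    finally show ?thesis .
  qed
  then show ?thesis using Cs(1) Ds(1) unfolding splits_def by (intro exI[of _ "Cs @ Ds"]) auto
qed

lemma splits_irr: assumes "irr V C" shows "splits V C"
  unfolding splits_def
proof (intro exI[of _ "[C]"] conjI allI impI)
  fix W D
  show "Vc W (dm D C) \<subseteq> plist G (map (\<lambda>C'. Vc W (dm D C')) [C])"
    using Vc_carrier[of W "dm D C"] by (force simp: set_mult_def)
qed (use assms in simp)

lemma Vc_adj_pos: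
  assumes V: "ok V" and C: "smon C" and y: "y \<in> K" shows "Vc V (adj y C) \<subseteq> pos y V"
proof
  fix x assume x: "x \<in> Vc V (adj y C)"
  have xc: "x \<in> carrier G" using x Vc_carrier by blast
  have "ev y (- int j) x \<in> V" for j
  proof -
    have "ev y (int j) \<cdot> \<one>\<^bsub>AG\<^esub> \<in> adj y C" using smonD(4)[OF C] unfolding adj_def by blast
    then have "x \<in> ev y (int j) ` V" using x KA[OF y] unfolding Vc_def by (simp add: carrier_Aut)
    then show ?thesis using mem_ev_image[OF KA[OF y] xc okD(4)[OF V]] by simp
  qed
  then show "x \<in> pos y V" using xc by (simp add: pos_def)
qed

text \<open>Induction on the index by which the product of the generators expands
  \<open>Vc V C\<close>. If some \<open>y\<close> in \<open>K\<close> neither expands nor contracts,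
  neither enlarged monoid has a group containing \<open>Vc V C\<close>, so both indices are
  smaller.\<close>

lemma splits_full:
  assumes V: "ok V" and C: "smon C" and gs: "set gs \<subseteq> C" "full (set gs)"
  shows "splits V C"
  using C gs(1)
proof (induction "rel_index G (lprod gs ` Vc V C) (Vc V C)" arbitrary: C rule: less_induct)
  case less
  note C = less.prems(1)
  show ?case
  proof (cases "irr V C")
    case True then show ?thesis by (rule splits_irr)
  next
    case False
    then obtain y where y: "y \<in> K" "\<not> Vc V C \<subseteq> pos y V" "\<not> Vc V C \<subseteq> neg y V" using C unfolding irr_def by blast
    have rec: "splits V (adj z C)" if z: "z \<in> K" "\<not> Vc V C \<subseteq> pos z V" for z
    proof -
      note a = smon_adj[OF C z(1)] adj_supset[OF smonD(5)[OF C] KF'[OF z(1)]]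
      have "\<not> Vc V C \<subseteq> Vc V (adj z C)" using z(2) Vc_adj_pos[OF V C z(1)] by blast
      then have "rel_index G (lprod gs ` Vc V (adj z C)) (Vc V (adj z C)) < rel_index G (lprod gs ` Vc V C) (Vc V C)"
        using Vc_index_drop[OF V C a(1,3) less.prems(2) gs(2)] by blast
      then show ?thesis using less.hyps a less.prems(2) by blast
    qed
    have "splits V (adj (ainv y) C)" using rec[of "ainv y"] y pos_inv[OF KA[OF y(1)]] by simp
    moreover have "splits V (adj y C)" using rec y by blast
    ultimately show ?thesis using splits_step[OF smonD(5)[OF C] _ y(1)] smonD(4)[OF C] by blast
  qed
qed

lemma full_mono:
  assumes "full E" "E \<subseteq> generate AG (E' \<union> P)" "E' \<subseteq> K" shows "full E'"
proof -
  have "E' \<union> P \<subseteq> carrier AG" using assms(3) KA PK by (auto simp: carrier_Aut)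
  then have sg: "subgroup (generate AG (E' \<union> P)) AG" by (rule AG.generate_is_subgroup)
  have "P \<subseteq> generate AG (E' \<union> P)" by (auto intro: generate.incl)
  then have "generate AG (E \<union> P) \<subseteq> generate AG (E' \<union> P)" using assms(2) by (intro AG.generate_subgroup_incl[OF _ sg]) blast
  then show ?thesis using assms(1) unfolding full_def by blast
qed

text \<open>The index argument needs a monoid that contains full generators, which the initial
  monoid \<open>P\<close> may lack. Each missing generator is added with both signs, as a vector
  space is divided into orthants; fullness does not depend on the signs.\<close>

lemma splits_partial:
  assumes V: "ok V"
  shows "smon C \<Longrightarrow> set gs \<subseteq> C \<Longrightarrow> set es \<subseteq> K \<Longrightarrow> full (set gs \<union> set es) \<Longrightarrow> splits V C"
proof (induction es arbitrary: C gs)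
  case Nil then show ?case using splits_full[OF V] by simp
next
  case (Cons e es)
  note C = Cons.prems(1)
  have e: "e \<in> K" "set es \<subseteq> K" using Cons.prems by auto
  have gK: "set gs \<subseteq> K" using Cons.prems smonD(2)[OF C] by blast
  have rec: "splits V (adj z C)" if z: "z \<in> K" "e \<in> generate AG (set (z # gs) \<union> set es \<union> P)" for z
  proof (rule Cons.IH[of _ "z # gs"])
    note a = smon_adj[OF C z(1)] adj_supset[OF smonD(5)[OF C] KF'[OF z(1)]]
    show "smon (adj z C)" "set (z # gs) \<subseteq> adj z C" using a Cons.prems by auto
    show "full (set (z # gs) \<union> set es)"
    proof (rule full_mono[OF Cons.prems(4)])
      show "set gs \<union> set (e # es) \<subseteq> generate AG (set (z # gs) \<union> set es \<union> P)"
        using z(2) by (auto intro: generate.incl)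
    qed (use gK e z in auto)
  qed (rule e(2))
  have eA: "ainv (ainv e) = e" using KA[OF e(1)] by (simp add: carrier_Aut)
  have "e \<in> generate AG (set (ainv e # gs) \<union> set es \<union> P)"
    using generate.inv[of "ainv e" "set (ainv e # gs) \<union> set es \<union> P" AG] eA by simp
  then have "splits V (adj (ainv e) C)" using rec e by simp
  moreover have "splits V (adj e C)" using rec e by (simp add: generate.incl)
  ultimately show ?case using splits_step[OF smonD(5)[OF C] _ e(1)] smonD(4)[OF C] by blast
qed

text \<open>For irreducible \<open>C\<close> this is the positive cone of a total preorder on \<open>K\<close>, the analogue of a root.\<close>

definition Kp where "Kp V C = {k \<in> K. Vc V C \<subseteq> k ` Vc V C}"

section \<open>Positive cones and tidiness for the whole extension\<close>

lemma KpD: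
  assumes "k \<in> Kp V C" "C \<subseteq> F"
  shows "k \<in> K" "\<And>x. x \<in> Vc V C \<Longrightarrow> ev k (- int j) x \<in> Vc V C" "Vc V C \<subseteq> ev k (int j) ` Vc V C"
proof -
  show k: "k \<in> K" using assms by (simp add: Kp_def)
  note kA = KA[OF k]
  have i1: "ev k (-1) = ainv k" using ev_minus[OF kA, of 1] kA by simp
  have one: "ev k (-1) x \<in> Vc V C" if "x \<in> Vc V C" for x
    using assms(1) that image_iff_inv[OF kA _ Vc_carrier, of x V C] Vc_carrier[of V C] i1 by (auto simp: Kp_def)
  show m: "ev k (- int j) x \<in> Vc V C" if x: "x \<in> Vc V C" for x
  proof (induction j)
    case 0
    have "x \<in> carrier G" using x Vc_carrier by blast
    then show ?case using x by simp
  next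
    case (Suc j)
    have "x \<in> carrier G" using x Vc_carrier by blast
    then have "ev k (- int (Suc j)) x = ev k (-1) (ev k (- int j) x)" using kA by (simp add: ev_ev)
    then show ?case using one[OF Suc] by simp
  qed
  show "Vc V C \<subseteq> ev k (int j) ` Vc V C"
  proof
    fix x assume x: "x \<in> Vc V C"
    then have "x \<in> carrier G" using Vc_carrier by blast
    then show "x \<in> ev k (int j) ` Vc V C" using mem_ev_image[OF kA _ Vc_carrier[of V C], of x "int j"] m[OF x] by simp
  qed
qed

lemma KpI: assumes "k \<in> K" "\<And>x. x \<in> Vc V C \<Longrightarrow> (ainv k) x \<in> Vc V C" shows "k \<in> Kp V C"
proof -
  have "x \<in> k ` Vc V C" if x: "x \<in> Vc V C" for x
  proof -
    have "x \<in> carrier G" using x Vc_carrier by blast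
    then show ?thesis using image_iff_inv[OF KA[OF assms(1)] _ Vc_carrier, of x V C] assms(2)[OF x] by simp
  qed
  then show ?thesis using assms(1) by (auto simp: Kp_def)
qed

text \<open>For points of \<open>Vc W C\<close> the backward orbit under \<open>k\<close> stays in
  \<open>V\<close> and is thus bounded, so tidiness of \<open>W\<close> for \<open>k\<close> keeps
  it in \<open>W\<close>. Cones found for \<open>V\<close> remain usable after \<open>V\<close> is
  shrunk.\<close>

lemma Kp_mono:
  assumes V: "ok V" and W: "ok W" "W \<subseteq> V" and C: "smon C" and k: "k \<in> Kp V C"
  shows "k \<in> Kp W C"
proof (rule KpI)
  note CF = smonD(5)[OF C]
  show kK: "k \<in> K" using KpD(1)[OF k CF] .
  note kA = KA[OF kK] and kF = KF'[OF kK]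
  have i1: "ev k (-1) = ainv k" using ev_minus[OF kA, of 1] kA by simp
  have base: "(ainv k) u \<in> W" if u: "u \<in> Vc W C" for u
  proof -
    have uV: "u \<in> Vc V C" using u Vc_mono[OF W(2)] by blast
    have "u \<in> pos k W"
    proof (rule tidy_bdd_pos[OF kA okD(3)[OF W(1) kK]])
      show "u \<in> W" using u Vc_subset[OF W(1) C] by blast
      show "bdd V" using bdd_COS[OF okD(1)[OF V]] .
      fix j :: int assume "j \<le> 0"
      then obtain i where "j = - int i" by (metis nonpos_int_cases)
      then show "ev k j u \<in> V" using KpD(2)[OF k CF uV] Vc_subset[OF V C] by blast
    qed
    then have "ev k (-1) u \<in> W" by (rule posD) simp
    then show ?thesis by (simp add: i1)
  qed
  fix x assume x: "x \<in> Vc W C"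
  have xc: "x \<in> carrier G" using x Vc_carrier by blast
  have "(ainv c) ((ainv k) x) \<in> W" if c: "c \<in> C" for c
    using base[OF Vc_expand[OF W(1) C c x]] comm_mem[of "ainv c" "ainv k" W x] c CF kF okD(2)[OF W(1)] xc by auto
  then show "(ainv k) x \<in> Vc W C" using CF okD(4)[OF W(1)] kA xc by (intro VcI) (auto simp: Aut_closed)
qed

text \<open>For \<open>x\<close> in \<open>Vc V C\<close> the points c^(-1)(x) are in
  \<open>Vc V C\<close> again, so irreducibility controls their orbits as well. Commuting
  \<open>c\<close> with \<open>y\<close> shows that y^(-1)(x) stays in
  \<open>Vc V C\<close>.\<close>

lemma irr_Kp:
  assumes V: "ok V" and i: "irr V C" and y: "y \<in> K" shows "y \<in> Kp V C \<or> ainv y \<in> Kp V C"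
proof -
  have C: "smon C" using i by (simp add: irr_def)
  note CF = smonD(5)[OF C]
  have *: "y \<in> Kp V C" if y: "y \<in> K" and s: "Vc V C \<subseteq> pos y V" for y
  proof (rule KpI[OF y])
    fix x assume x: "x \<in> Vc V C"
    have xc: "x \<in> carrier G" using x Vc_carrier by blast
    have i1: "ev y (-1) = ainv y" using ev_minus[OF KA[OF y], of 1] KA[OF y] by simp
    have "(ainv c) ((ainv y) x) \<in> V" if c: "c \<in> C" for c
    proof -
      have "(ainv c) x \<in> pos y V" using Vc_expand[OF V C c x] s by blast
      then have "ev y (-1) ((ainv c) x) \<in> V" by (rule posD) simp
      then show ?thesis using comm_mem[of "ainv c" "ainv y" V x] c CF KF'[OF y] okD(2)[OF V] xc i1 by auto
    qed
    then show "(ainv y) x \<in> Vc V C" using CF okD(4)[OF V] KA[OF y] xc by (intro VcI) (auto simp: Aut_closed)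
  qed
  from i y have "Vc V C \<subseteq> pos y V \<or> Vc V C \<subseteq> neg y V" by (simp add: irr_def)
  then show ?thesis using *[OF y] *[of "ainv y"] y pos_inv[OF KA[OF y]] by auto
qed


text \<open>The intersection from \<open>tidy_root\<close> makes \<open>W\<close> tidy for one more
  \<open>b\<close>. It consists of images of \<open>W\<close> under powers of \<open>b\<close>,
  which commute with \<open>F\<close> on \<open>W\<close>, so earlier tidiness and
  \<open>P\<close>-invariance survive.\<close>

lemma ex_ok_tidy_finite:
  assumes V: "ok V" and n: "n > 0" "\<And>\<phi>. \<phi> \<in> F \<Longrightarrow> ev \<phi> (int n) \<in> K" and B: "finite B" "B \<subseteq> F"
  shows "\<exists>W. ok W \<and> W \<subseteq> V \<and> (\<forall>b\<in>B. tidy b W)"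
  using B
proof (induction B rule: finite_induct)
  case empty then show ?case using V by blast
next
  case (insert b B)
  then obtain W where W: "ok W" "W \<subseteq> V" "\<forall>b\<in>B. tidy b W" by blast
  have bF: "b \<in> F" and bA: "b \<in> Aut G T" using insert FA by auto
  define Y where "Y = (\<Inter>i\<in>{..<n}. ev b (int i) ` W)"
  have tY: "tidy \<phi> Y" if "\<phi> \<in> F" "tidy \<phi> W" for \<phi> unfolding Y_def
    using n that bF okD(2)[OF W(1)] by (intro tidy_INT[OF FA] tidy_Pset_image) auto
  have tb: "tidy b Y" unfolding Y_def by (rule tidy_root[OF bA n(1) okD(3)[OF W(1) n(2)[OF bF]]])
  have "ev b (int 0) ` W = W" using okD(4)[OF W(1)] by simp
  then have YW: "Y \<subseteq> W" using n(1) unfolding Y_def by blast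
  have Yc: "Y \<subseteq> carrier G" using YW okD(4)[OF W(1)] by blast
  have "p ` Y = Y" if p: "p \<in> P" for p
  proof -
    have eW: "ev b (int i) ` W \<subseteq> carrier G" for i using Aut_image_subset okD(4)[OF W(1)] bA by simp
    have "p ` Y = (\<Inter>i\<in>{..<n}. p ` ev b (int i) ` W)" unfolding Y_def
      using n(1) eW by (intro image_INT[of p "carrier G"] Aut_inj[OF FA[OF PF[OF p]]]) auto
    also have "\<dots> = Y" unfolding Y_def using PsetD(2)[OF Pset_image[of "ev b _" W] p] bF okD(2)[OF W(1)] by simp
    finally show ?thesis .
  qed
  then have "ok Y" using tidyD(1)[OF tb] tY KF' okD(3)[OF W(1)] Yc unfolding ok_def Pset_def by blast
  then show ?case using YW W tb tY insert.prems by blast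
qed

text \<open>In each coset of \<open>K\<close> one element \<open>b\<close>, of least index among the positive ones, controls all positive elements.\<close>

lemma irr_minimal_rep:
  assumes V: "ok V" and i: "irr V C" and n: "n > 0" "\<And>\<phi>. \<phi> \<in> F \<Longrightarrow> ev \<phi> (int n) \<in> K" and f: "f \<in> F"
  shows "\<exists>b\<in>F. \<forall>a\<in>F. ainv f \<cdot> a \<in> K \<longrightarrow> ev a (int n) \<in> Kp V C \<longrightarrow>
     ev b (int n) \<in> Kp V C \<and> ainv b \<cdot> a \<in> Kp V C"
proof -
  let ?X = "Vc V C"
  have C: "smon C" using i by (simp add: irr_def)
  note CF = smonD(5)[OF C] and sX = subgroup_Vc[OF okD(5)[OF V] smonD(5)[OF C]]
  have PX: "Pset ?X" using Pset_Vc[OF okD(2)[OF V] CF] .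
  have Xc: "?X \<subseteq> carrier G" by (rule Vc_carrier)
  define S where "S = {a \<in> F. ainv f \<cdot> a \<in> K \<and> ev a (int n) \<in> Kp V C}"
  \<comment> \<open>Positivity is defined in \<open>K\<close> only, so an element of the coset is
    measured through its n-th power.\<close>
  define I where "I a = rel_index G (ev a (int n) ` ?X) ?X" for a
  show ?thesis
  proof (cases "S = {}")
    case True
    then show ?thesis using F_closed(3) unfolding S_def by blast
  next
    case False
    then obtain b where b: "b \<in> S" "\<And>a. a \<in> S \<Longrightarrow> I b \<le> I a"
      using ex_has_least_nat[of "\<lambda>a. a \<in> S" _ I] by blast
    have bF: "b \<in> F" using b by (simp add: S_def)
    have "ainv b \<cdot> a \<in> Kp V C" if a: "a \<in> S" for a
    proof (rule ccontr)
      assume nk: "ainv b \<cdot> a \<notin> Kp V C"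
      have aF: "a \<in> F" using a by (simp add: S_def)
      have cr: "a \<in> carrier AG" "b \<in> carrier AG" "f \<in> carrier AG" using aF bF f FA by (simp_all add: carrier_Aut)
      have "ainv b \<cdot> a = ainv (ainv f \<cdot> b) \<cdot> (ainv f \<cdot> a)"
      proof -
        have "ainv (ainv f \<cdot> b) \<cdot> (ainv f \<cdot> a) = ainv b \<cdot> (f \<cdot> ainv f) \<cdot> a"
          using cr by (simp only: AG.inv_mult_group AG.inv_inv AG.m_assoc AG.inv_closed AG.m_closed)
        then show ?thesis using cr by simp
      qed
      then have kK: "ainv b \<cdot> a \<in> K" using a b(1) by (simp add: S_def)
      \<comment> \<open>If \<open>ainv b \<cdot> a\<close> is not positive, totality makes its
        inverse \<open>g\<close> positive. Then b = a g gives \<open>I b = I g * I a\<close>, and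
        minimality of \<open>b\<close> forces \<open>I g = 1\<close>. So \<open>g\<close> preserves
        the group, and \<open>ainv b \<cdot> a\<close> is positive after all.\<close>
      define g where "g = ainv (ainv b \<cdot> a)"
      have gp: "g \<in> Kp V C" using irr_Kp[OF V i kK] nk unfolding g_def by blast
      have gK: "g \<in> K" using kK by (simp add: g_def)
      note gA = KA[OF gK] and gF = KF'[OF gK]
      have bg: "b = a \<cdot> g" using cr by (simp add: g_def AG.inv_mult_group AG.m_assoc[symmetric])
      have im: "ev b (int n) ` ?X = ev a (int n) ` ev g (int n) ` ?X" unfolding bg by (rule ev_mult_image[OF aF gF PX])
      have ap: "ev a (int n) \<in> Kp V C" using a by (simp add: S_def)
      have anA: "ev a (int n) \<in> Aut G T" using FA[OF aF] by simp
      have Xg: "?X \<subseteq> ev g (int j) ` ?X" for j using KpD(3)[OF gp CF] .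
      have Xa: "?X \<subseteq> ev a (int n) ` ?X" using ap by (simp add: Kp_def)
      have sg: "subgroup (ev g (int n) ` ?X) G" using subgroup_image[of "ev g (int n)"] gA sX by simp
      have "I b = rel_index G (ev a (int n) ` ev g (int n) ` ?X) (ev a (int n) ` ?X) * rel_index G (ev a (int n) ` ?X) ?X"
        unfolding I_def im using anA sg sX
        by (intro rel_index_tower[OF _ _ sX Xa image_mono[OF Xg]]) (auto simp: subgroup_image)
      also have "rel_index G (ev a (int n) ` ev g (int n) ` ?X) (ev a (int n) ` ?X) = I g"
        unfolding I_def using anA sg sX by (intro rel_index_image) auto
      finally have "I b = I g * I a" by (simp add: I_def)
      moreover have "I b \<le> I a" using b(2)[OF a] .
      moreover have "I a > 0" "I g > 0" unfolding I_def using Vc_index_pos[OF V C] aF gF by auto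
      ultimately have "I g = 1" by (metis One_nat_def Suc_leI le_antisym mult_le_cancel2 mult_1)
      then have le: "ev g (int n) ` ?X \<subseteq> ?X" unfolding I_def using rel_index_one_iff[OF sg sX] by simp
      have "g ` ?X \<subseteq> g ` ev g (int (n - 1)) ` ?X" using Xg by (rule image_mono)
      also have "\<dots> = ev g (int n) ` ?X" using ev_image[OF gA Xc, of 1 "int (n - 1)"] gA n(1) by simp
      finally have gX: "g ` ?X \<subseteq> ?X" using le by blast
      have "ainv b \<cdot> a \<in> Kp V C"
        using gX by (intro KpI[OF kK]) (auto simp: g_def[symmetric])
      then show False using nk by simp
    qed
    then show ?thesis using b(1) bF unfolding S_def by blast
  qed
qed

text \<open>\<open>W\<close> is tidy for \<open>a\<close> once its positive and negative parts for
  a^n lie in those for \<open>a\<close>. The positive part for k = a^n is contained in the group of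
  the family of nonnegative powers of \<open>k\<close> times \<open>P\<close>, and
  \<open>splits\<close> covers the latter by groups on which \<open>a\<close> or its inverse is
  controlled by one of the chosen representatives.\<close>

theorem ex_tidy_all:
  assumes V: "ok V" and E: "finite E" "E \<subseteq> K" "full E"
    and n: "n > 0" "\<And>\<phi>. \<phi> \<in> F \<Longrightarrow> ev \<phi> (int n) \<in> K"
    and R: "finite R" "R \<subseteq> F" "\<And>\<phi>. \<phi> \<in> F \<Longrightarrow> \<exists>f\<in>R. ainv f \<cdot> \<phi> \<in> K"
  shows "\<exists>W\<in>COS G T. \<forall>\<phi>\<in>F. tidy \<phi> W"
proof -
  obtain es where es: "set es = E" using finite_list[OF E(1)] by blast
  have "splits V P" using splits_partial[OF V smon_P, of "[]" es] es E by simp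
  then obtain Cs where Cs: "\<forall>C\<in>set Cs. irr V C"
    and spl: "\<And>W D. ok W \<Longrightarrow> D \<subseteq> F \<Longrightarrow> D \<noteq> {} \<Longrightarrow> Vc W (dm D P) \<subseteq> plist G (map (\<lambda>C'. Vc W (dm D C')) Cs)"
    unfolding splits_def by blast
  define good where "good q b \<longleftrightarrow> b \<in> F \<and> (\<forall>a\<in>F. ainv (snd q) \<cdot> a \<in> K \<longrightarrow> ev a (int n) \<in> Kp V (fst q) \<longrightarrow>
     ev b (int n) \<in> Kp V (fst q) \<and> ainv b \<cdot> a \<in> Kp V (fst q))" for q b
  have "\<forall>q\<in>set Cs \<times> R. \<exists>b. good q b"
  proof
    fix q assume q: "q \<in> set Cs \<times> R"
    then have "irr V (fst q)" "snd q \<in> F" using Cs R(2) by auto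
    from irr_minimal_rep[OF V this(1) n this(2)] show "\<exists>b. good q b" unfolding good_def by blast
  qed
  from bchoice[OF this] obtain \<beta> where \<beta>: "\<forall>q\<in>set Cs \<times> R. good q (\<beta> q)" ..
  have "\<beta> ` (set Cs \<times> R) \<subseteq> F" using \<beta> unfolding good_def by blast
  moreover have "finite (\<beta> ` (set Cs \<times> R))" using R(1) by simp
  ultimately obtain W where W: "ok W" "W \<subseteq> V" "\<forall>b\<in>\<beta> ` (set Cs \<times> R). tidy b W"
    using ex_ok_tidy_finite[OF V n, of "\<beta> ` (set Cs \<times> R)"] by blast
  note Wc = okD(4)[OF W(1)] and PW = okD(2)[OF W(1)]
  \<comment> \<open>Let a = b k with \<open>b\<close> the chosen representative and \<open>k\<close>
    positive. Positivity of b^n bounds the backward orbits under \<open>b\<close>, so tidiness of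
    \<open>W\<close> for \<open>b\<close> puts \<open>Vc W C\<close> in \<open>pos b W\<close>. Then
    \<open>x\<close> lies in k^j(Vc W C), hence in k^j b^j(W) = a^j(W).\<close>
  have main: "Vc W C \<subseteq> pos a W" if C: "C \<in> set Cs" and a: "a \<in> F" and ap: "ev a (int n) \<in> Kp V C" for C a
  proof
    fix x assume x: "x \<in> Vc W C"
    have xc: "x \<in> carrier G" using x Vc_carrier by blast
    have sC: "smon C" using Cs C by (simp add: irr_def)
    note CF = smonD(5)[OF sC] and aA = FA[OF a]
    obtain f where f: "f \<in> R" "ainv f \<cdot> a \<in> K" using R(3)[OF a] by blast
    define b where "b = \<beta> (C, f)"
    have Cf: "(C, f) \<in> set Cs \<times> R" using C f by blast
    then have "good (C, f) b" "tidy b W" using \<beta> W(3) unfolding b_def by blast+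
    then have b: "b \<in> F" "ev b (int n) \<in> Kp V C" "ainv b \<cdot> a \<in> Kp V C" "tidy b W"
      using a ap f(2) unfolding good_def by auto
    note bA = FA[OF b(1)]
    define k where "k = ainv b \<cdot> a"
    have kp: "k \<in> Kp W C" using Kp_mono[OF V W(1,2) sC] b(3) by (simp add: k_def)
    have kF: "k \<in> F" using KpD(1)[OF kp CF] KF' by blast
    have hp: "ev b (int n) \<in> Kp W C" using Kp_mono[OF V W(1,2) sC b(2)] .
    have Wb: "Vc W C \<subseteq> pos b W"
    proof
      fix u assume u: "u \<in> Vc W C"
      have uc: "u \<in> carrier G" using u Vc_carrier by blast
      show "u \<in> pos b W"
      proof (rule tidy_bdd_pos[OF bA b(4)])
        show "u \<in> W" using u Vc_subset[OF W(1) sC] by blast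
        show "bdd (\<Union>r\<in>{0..<int n}. ev b r ` W)"
          using bA okD(1)[OF W(1)] by (intro bdd_finite_UN bdd_COS COS_image) auto
        fix j :: int assume "j \<le> 0"
        then have "j div int n \<le> 0" using n(1) div_nonpos_pos_le0[of j "int n"] by simp
        then obtain i where i: "j div int n = - int i" by (metis nonpos_int_cases)
        have "ev (ev b (int n)) (- int i) u \<in> W" using KpD(2)[OF hp CF u] Vc_subset[OF W(1) sC] by blast
        moreover have "ev b (j mod int n) (ev (ev b (int n)) (- int i) u) = ev b j u"
          using bA uc by (simp add: ev_mult ev_ev flip: i)
        moreover have "j mod int n \<in> {0..<int n}" using n(1) by simp
        moreover have "ev b (j mod int n) (ev (ev b (int n)) (- int i) u) \<in> ev b (j mod int n) ` W"
          using \<open>ev (ev b (int n)) (- int i) u \<in> W\<close> by (rule imageI)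
        ultimately show "ev b j u \<in> (\<Union>r\<in>{0..<int n}. ev b r ` W)" by (simp only:) blast
      qed
    qed
    have cr: "a \<in> carrier AG" "b \<in> carrier AG" using aA bA by (simp_all add: carrier_Aut)
    have abk: "a = b \<cdot> k" using cr by (simp add: k_def AG.m_assoc[symmetric])
    have "ev a (- int j) x \<in> W" for j
    proof -
      have "x \<in> ev k (int j) ` Vc W C" using KpD(3)[OF kp CF] x by blast
      moreover have "Vc W C \<subseteq> ev b (int j) ` W"
      proof
        fix u assume u: "u \<in> Vc W C"
        have "u \<in> carrier G" using u Vc_carrier by blast
        moreover have "ev b (- int j) u \<in> W" using posD[of u b W "- int j"] Wb u by auto
        ultimately show "u \<in> ev b (int j) ` W" using mem_ev_image[OF bA _ Wc] by simp
      qed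
      ultimately have "x \<in> ev k (int j) ` ev b (int j) ` W" by blast
      also have "\<dots> = ev b (int j) ` ev k (int j) ` W" using kF b(1) PW by (intro comm_image) auto
      also have "\<dots> = ev a (int j) ` W" unfolding abk by (rule ev_mult_image[OF b(1) kF PW, symmetric])
      finally show ?thesis using mem_ev_image[OF aA xc Wc] by simp
    qed
    then show "x \<in> pos a W" using xc by (simp add: pos_def)
  qed
  have pp: "pos (ev a (int n)) W \<subseteq> pos a W" if a: "a \<in> F" for a
  proof -
    note aA = FA[OF a]
    define k where "k = ev a (int n)"
    have kK: "k \<in> K" using n(2)[OF a] by (simp add: k_def)
    note kA = KA[OF kK] and kF = KF'[OF kK]
    define D where "D = {ev k (int j) | j. True}"
    have D: "D \<subseteq> F" "D \<noteq> {}" using kF by (auto simp: D_def)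
    have "pos k W \<subseteq> Vc W (dm D P)"
    proof
      fix x assume x: "x \<in> pos k W"
      have xc: "x \<in> carrier G" using x pos_carrier by blast
      have "x \<in> (ev k (int j) \<cdot> p) ` W" if "p \<in> P" for j p
      proof -
        have "ev k (- int j) x \<in> W" using posD[OF x] by simp
        then have "x \<in> ev k (int j) ` W" using mem_ev_image[OF kA xc Wc] by simp
        then show ?thesis using mult_image[OF Wc] PsetD(2)[OF PW that] by simp
      qed
      then show "x \<in> Vc W (dm D P)" using xc unfolding Vc_def dm_def D_def by blast
    qed
    also have "\<dots> \<subseteq> plist G (map (\<lambda>C'. Vc W (dm D C')) Cs)" by (rule spl[OF W(1) D])
    also have "\<dots> \<subseteq> pos a W"
    proof (rule plist_subset[OF subgroup_pos[OF aA okD(5)[OF W(1)]]])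
      fix S assume "S \<in> set (map (\<lambda>C'. Vc W (dm D C')) Cs)"
      then obtain C where C: "C \<in> set Cs" "S = Vc W (dm D C)" by auto
      have sC: "smon C" "irr V C" using Cs C by (simp_all add: irr_def)
      note CF = smonD(5)[OF sC(1)]
      show "S \<subseteq> pos a W"
      proof
        fix x assume "x \<in> S"
        then have x: "x \<in> Vc W (dm D C)" using C by simp
        have xc: "x \<in> carrier G" using x Vc_carrier by blast
        have xk: "ev k (- int j) x \<in> Vc W C" for j
        proof -
          have "ev k (- int j) x \<in> c ` W" if c: "c \<in> C" for c
          proof -
            have cW: "c ` W \<subseteq> carrier G" using c CF Aut_image_subset[OF FA Wc] by blast
            have "ev k (int j) \<cdot> c \<in> dm D C" using c unfolding dm_def D_def by blast
            then have "x \<in> (ev k (int j) \<cdot> c) ` W" using x unfolding Vc_def by blast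
            then have "x \<in> ev k (int j) ` c ` W" using mult_image[OF Wc] by simp
            then show ?thesis using mem_ev_image[OF kA xc cW] by simp
          qed
          then show ?thesis using kA xc unfolding Vc_def by simp
        qed
        have x0: "x \<in> Vc W C" using xk[of 0] xc by simp
        show "x \<in> pos a W"
        proof (cases "k \<in> Kp V C")
          case True
          then show ?thesis using main[OF C(1) a] x0 by (auto simp: k_def)
        next
          \<comment> \<open>Now \<open>main\<close> applies to the inverse of \<open>a\<close>. All
            points k^(-j)(x) are in \<open>Vc W C\<close> and thus in \<open>neg a W\<close>, and
            every earlier position of the orbit of \<open>x\<close> under \<open>a\<close> is
            reached from one of them by going forward.\<close>
          case False
          then have "ainv k \<in> Kp V C" using irr_Kp[OF V sC(2) kK] by blast
          moreover have "ainv k = ev (ainv a) (int n)" using aA by (simp add: k_def ev_inv ev_minus)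
          ultimately have "Vc W C \<subseteq> pos (ainv a) W" using main[OF C(1), of "ainv a"] a by simp
          then have neg: "Vc W C \<subseteq> neg a W" by (simp add: pos_inv[OF aA])
          show ?thesis
          proof (rule posI[OF xc])
            fix j :: int assume j: "j \<le> 0"
            have "ev k (- int (nat (- j))) x \<in> neg a W" using xk neg by blast
            moreover have "ev k (- int (nat (- j))) x = ev a (int n * j) x" using j aA by (simp add: k_def ev_mult)
            ultimately have nj: "ev a (int n * j) x \<in> neg a W" by simp
            have "int n * j \<le> 1 * j" using n(1) j by (intro mult_right_mono_neg) auto
            then have "ev a (j - int n * j) (ev a (int n * j) x) \<in> W" using negD[OF nj, of "j - int n * j"] by simp
            then show "ev a j x \<in> W" using aA xc by (simp add: ev_ev)
          qed
        qed
      qed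
    qed
    finally show ?thesis by (simp add: k_def)
  qed
  have "tidy a W" if a: "a \<in> F" for a
  proof -
    note aA = FA[OF a]
    have tk: "tidy (ev a (int n)) W" using okD(3)[OF W(1) n(2)[OF a]] .
    have p: "pos (ev a (int n)) W \<subseteq> pos a W" by (rule pp[OF a])
    have "ev (ainv a) (int n) = ainv (ev a (int n))" using aA by (simp add: ev_inv ev_minus)
    then have q: "neg (ev a (int n)) W \<subseteq> neg a W"
      using pp[of "ainv a"] a aA by (simp add: pos_inv)
    have "\<exists>u\<in>neg a W. \<exists>v\<in>pos a W. x = u \<otimes> v" if "x \<in> W" for x using tidyD(2)[OF tk that] p q by blast
    moreover have "x \<in> pos a W" if x: "x \<in> W" and m: "\<forall>j\<le>m. ev a j x \<in> W" for x m
    proof -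
      have "ev (ev a (int n)) j x \<in> W" if j: "j \<le> - \<bar>m\<bar>" for j
      proof -
        have "int n * j \<le> 1 * j" using n(1) j by (intro mult_right_mono_neg) auto
        then have "int n * j \<le> m" using j by simp
        then show ?thesis using m aA by (simp add: ev_mult)
      qed
      then show ?thesis using tidyD(3)[OF tk x] p by blast
    qed
    ultimately show ?thesis using okD(1)[OF W(1)] unfolding tidy_def tidy_above_def by blast
  qed
  then show ?thesis using okD(1)[OF W(1)] by blast
qed

end


section \<open>Transfer\<close>

context group
begin

text \<open>Covering by finitely many left cosets through representatives; \<open>L\<close> is
  allowed to lie partly outside \<open>F\<close>. \<open>fin_index_iff\<close> relates this to the
  set of cosets.\<close>

definition fin_index :: "'a set \<Rightarrow> 'a set \<Rightarrow> bool" where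
  "fin_index F L \<longleftrightarrow> (\<exists>R. finite R \<and> R \<subseteq> F \<and> (\<forall>f\<in>F. \<exists>r\<in>R. inv r \<otimes> f \<in> L))"

definition lcos :: "'a set \<Rightarrow> 'a set \<Rightarrow> 'a \<Rightarrow> 'a set" where
  "lcos F L x = {y \<in> F. inv x \<otimes> y \<in> L}"

lemma inv_mult_cancel:
  assumes "x \<in> carrier G" "y \<in> carrier G" "z \<in> carrier G"
  shows "inv x \<otimes> z = (inv x \<otimes> y) \<otimes> (inv y \<otimes> z)"
proof -
  have "(inv x \<otimes> y) \<otimes> (inv y \<otimes> z) = inv x \<otimes> (y \<otimes> inv y) \<otimes> z"
    using assms by (simp only: m_assoc inv_closed m_closed)
  then show ?thesis using assms by simp
qed

lemma lcos_eq_iff: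
  assumes F: "subgroup F G" and L: "subgroup L G" and x: "x \<in> F" and y: "y \<in> F"
  shows "lcos F L x = lcos F L y \<longleftrightarrow> inv x \<otimes> y \<in> L"
proof
  note Fc = subgroup.mem_carrier[OF F]
  assume "lcos F L x = lcos F L y"
  moreover have "y \<in> lcos F L y" using y Fc[OF y] subgroup.one_closed[OF L] by (simp add: lcos_def)
  ultimately show "inv x \<otimes> y \<in> L" by (auto simp: lcos_def)
next
  note Fc = subgroup.mem_carrier[OF F]
  have sub: "lcos F L y \<subseteq> lcos F L x" if "inv x \<otimes> y \<in> L" "x \<in> F" "y \<in> F" for x y
  proof
    fix z assume "z \<in> lcos F L y"
    then have z: "z \<in> F" "inv y \<otimes> z \<in> L" by (auto simp: lcos_def)
    have "inv x \<otimes> z \<in> L" using subgroup.m_closed[OF L that(1) z(2)] inv_mult_cancel[of x y z] Fc that z by simp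
    then show "z \<in> lcos F L x" using z by (simp add: lcos_def)
  qed
  assume a: "inv x \<otimes> y \<in> L"
  have "inv (inv x \<otimes> y) \<in> L" using subgroup.m_inv_closed[OF L a] .
  then have "inv y \<otimes> x \<in> L" using Fc[OF x] Fc[OF y] by (simp add: inv_mult_group)
  then show "lcos F L x = lcos F L y" using sub[OF a x y] sub[of y x] x y by blast
qed

lemma fin_index_iff:
  assumes F: "subgroup F G" and L: "subgroup L G"
  shows "fin_index F L \<longleftrightarrow> finite (lcos F L ` F)"
proof
  assume "fin_index F L"
  then obtain R where R: "finite R" "R \<subseteq> F" "\<forall>f\<in>F. \<exists>r\<in>R. inv r \<otimes> f \<in> L" by (auto simp: fin_index_def)
  have "lcos F L ` F \<subseteq> lcos F L ` R"
  proof
    fix S assume "S \<in> lcos F L ` F"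
    then obtain f where f: "f \<in> F" "S = lcos F L f" by blast
    then obtain r where r: "r \<in> R" "inv r \<otimes> f \<in> L" using R by blast
    then have "lcos F L r = lcos F L f" using lcos_eq_iff[OF F L _ f(1)] R by blast
    then show "S \<in> lcos F L ` R" using r f by blast
  qed
  then show "finite (lcos F L ` F)" using R(1) finite_surj by blast
next
  assume "finite (lcos F L ` F)"
  then obtain R where R: "finite R" "R \<subseteq> F" "lcos F L ` F = lcos F L ` R" by (metis finite_subset_image subset_refl)
  have "\<exists>r\<in>R. inv r \<otimes> f \<in> L" if f: "f \<in> F" for f
  proof -
    have "lcos F L f \<in> lcos F L ` R" using R f by blast
    then obtain r where "r \<in> R" "lcos F L r = lcos F L f" by auto
    then show ?thesis using lcos_eq_iff[OF F L _ f] R by blast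
  qed
  then show "fin_index F L" using R by (auto simp: fin_index_def)
qed

text \<open>The core is the kernel of the action of \<open>F\<close> on the cosets of
  \<open>K\<close>, and there are finitely many such actions.\<close>

lemma fin_index_core:
  assumes F: "subgroup F G" and K: "subgroup K G" "K \<subseteq> F" and fi: "fin_index F K"
  shows "\<exists>L. subgroup L G \<and> L \<subseteq> K \<and> (\<forall>f\<in>F. \<forall>k\<in>L. inv f \<otimes> k \<otimes> f \<in> L) \<and> fin_index F L"
proof -
  note Fc = subgroup.mem_carrier[OF F] and Kc = subgroup.mem_carrier[OF K(1)]
  note mF = subgroup.m_closed[OF F] subgroup.m_inv_closed[OF F] and mK = subgroup.m_closed[OF K(1)] subgroup.m_inv_closed[OF K(1)]
  define L where "L = {k \<in> F. \<forall>f\<in>F. inv f \<otimes> k \<otimes> f \<in> K}"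
  have LK: "L \<subseteq> K"
  proof
    fix k assume k: "k \<in> L"
    then have "inv \<one> \<otimes> k \<otimes> \<one> \<in> K" using subgroup.one_closed[OF F] by (auto simp: L_def)
    then show "k \<in> K" using k Fc by (simp add: L_def)
  qed
  have sL: "subgroup L G"
  proof (rule subgroupI)
    show "L \<subseteq> carrier G" using LK Kc by blast
    have "\<one> \<in> L" using subgroup.one_closed[OF F] subgroup.one_closed[OF K(1)] Fc by (simp add: L_def)
    then show "L \<noteq> {}" by blast
    fix x assume x: "x \<in> L"
    have xc: "x \<in> carrier G" using x LK Kc by blast
    have "inv f \<otimes> inv x \<otimes> f \<in> K" if f: "f \<in> F" for f
    proof -
      have "inv (inv f \<otimes> x \<otimes> f) \<in> K" using x f mK by (simp add: L_def)
      then show ?thesis using xc Fc[OF f] by (simp add: inv_mult_group m_assoc)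
    qed
    then show "inv x \<in> L" using x mF by (simp add: L_def)
    fix y assume y: "y \<in> L"
    have yc: "y \<in> carrier G" using y LK Kc by blast
    have "inv f \<otimes> (x \<otimes> y) \<otimes> f \<in> K" if f: "f \<in> F" for f
    proof -
      have fc: "f \<in> carrier G" using Fc[OF f] .
      have "(inv f \<otimes> x \<otimes> f) \<otimes> (inv f \<otimes> y \<otimes> f) \<in> K" using x y f mK by (simp add: L_def)
      moreover have "(inv f \<otimes> x \<otimes> f) \<otimes> (inv f \<otimes> y \<otimes> f) = inv f \<otimes> x \<otimes> (f \<otimes> inv f) \<otimes> y \<otimes> f"
        using xc yc fc by (simp only: m_assoc inv_closed m_closed)
      ultimately show ?thesis using xc yc fc by (simp add: m_assoc)
    qed
    then show "x \<otimes> y \<in> L" using x y mF by (simp add: L_def)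
  qed
  have nL: "inv f \<otimes> k \<otimes> f \<in> L" if f: "f \<in> F" and k: "k \<in> L" for f k
  proof -
    have c: "f \<in> carrier G" "k \<in> carrier G" using f k Fc LK Kc by blast+
    have "inv h \<otimes> (inv f \<otimes> k \<otimes> f) \<otimes> h \<in> K" if h: "h \<in> F" for h
    proof -
      have "inv (f \<otimes> h) \<otimes> k \<otimes> (f \<otimes> h) \<in> K" using k mF(1)[OF f h] by (simp add: L_def)
      then show ?thesis using c Fc[OF h] by (simp add: inv_mult_group m_assoc)
    qed
    moreover have "inv f \<otimes> k \<otimes> f \<in> F" using f k mF by (simp add: L_def)
    ultimately show ?thesis by (simp add: L_def)
  qed
  obtain R where R: "finite R" "R \<subseteq> F" "\<forall>f\<in>F. \<exists>r\<in>R. inv r \<otimes> f \<in> K" using fi by (auto simp: fin_index_def)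
  \<comment> \<open>The action of \<open>f\<close> on the cosets, read off on representatives. Equal
    values of \<open>f\<close> and \<open>g\<close> put \<open>inv f \<otimes> g\<close> in the
    core.\<close>
  define \<Theta> where "\<Theta> f = restrict (\<lambda>r. lcos F K (f \<otimes> r)) R" for f
  have "\<Theta> ` F \<subseteq> R \<rightarrow>\<^sub>E lcos F K ` F" using R(2) mF(1) by (auto simp: \<Theta>_def)
  moreover have "finite (R \<rightarrow>\<^sub>E lcos F K ` F)" using R(1) fi fin_index_iff[OF F K(1)] by (intro finite_PiE) auto
  ultimately have fin: "finite (\<Theta> ` F)" by (rule finite_subset)
  have eq: "lcos F L f = lcos F L g" if fg: "f \<in> F" "g \<in> F" "\<Theta> f = \<Theta> g" for f g
  proof -
    have fgF: "inv f \<otimes> g \<in> F" using fg mF by simp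
    have fc: "f \<in> carrier G" "g \<in> carrier G" using fg Fc by auto
    have "inv h \<otimes> (inv f \<otimes> g) \<otimes> h \<in> K" if h: "h \<in> F" for h
    proof -
      obtain r where r: "r \<in> R" "inv r \<otimes> h \<in> K" using R h by blast
      have c: "r \<in> carrier G" "h \<in> carrier G" using r R(2) h Fc by blast+
      have "lcos F K (f \<otimes> r) = lcos F K (g \<otimes> r)" using fun_cong[OF fg(3), of r] r by (simp add: \<Theta>_def)
      then have "inv (f \<otimes> r) \<otimes> (g \<otimes> r) \<in> K" using lcos_eq_iff[OF F K(1), of "f \<otimes> r" "g \<otimes> r"] fg r R(2) mF by blast
      then have "inv (inv r \<otimes> h) \<otimes> (inv (f \<otimes> r) \<otimes> (g \<otimes> r)) \<otimes> (inv r \<otimes> h) \<in> K" using r mK by blast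
      moreover have "inv (inv r \<otimes> h) \<otimes> (inv (f \<otimes> r) \<otimes> (g \<otimes> r)) \<otimes> (inv r \<otimes> h)
          = inv h \<otimes> (r \<otimes> inv r) \<otimes> inv f \<otimes> g \<otimes> (r \<otimes> inv r) \<otimes> h"
        using c fc by (simp only: inv_mult_group inv_inv m_assoc inv_closed m_closed)
      ultimately show ?thesis using c fc by (simp add: m_assoc)
    qed
    then have "inv f \<otimes> g \<in> L" using fgF by (simp add: L_def)
    then show ?thesis using lcos_eq_iff[OF F sL fg(1,2)] by simp
  qed
  have "lcos F L ` F \<subseteq> (\<lambda>y. lcos F L (inv_into F \<Theta> y)) ` \<Theta> ` F"
  proof
    fix S assume "S \<in> lcos F L ` F"
    then obtain f where f: "f \<in> F" "S = lcos F L f" by blast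
    have "lcos F L (inv_into F \<Theta> (\<Theta> f)) = lcos F L f"
      using f inv_into_into[of "\<Theta> f" \<Theta> F] f_inv_into_f[of "\<Theta> f" \<Theta> F] by (intro eq) auto
    then show "S \<in> (\<lambda>y. lcos F L (inv_into F \<Theta> y)) ` \<Theta> ` F" using f by blast
  qed
  then have "finite (lcos F L ` F)" using fin finite_surj by blast
  then have "fin_index F L" using fin_index_iff[OF F sL] by simp
  then show ?thesis using sL LK nL by blast
qed

text \<open>Among the powers 0, ..., m of \<open>f\<close>, where m is the number of cosets, two
  share a coset. So a positive exponent up to m leads into \<open>L\<close>, and the factorial of m
  serves all elements at once.\<close>

lemma fin_index_exponent:
  assumes F: "subgroup F G" and L: "subgroup L G" and fi: "fin_index F L"
  shows "\<exists>N>0. \<forall>f\<in>F. f [^] (int N) \<in> L"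
proof -
  let ?m = "card (lcos F L ` F)"
  have fin: "finite (lcos F L ` F)" using fi fin_index_iff[OF F L] by simp
  have "f [^] (int (fact ?m)) \<in> L" if f: "f \<in> F" for f
  proof -
    have fc: "f \<in> carrier G" using subgroup.mem_carrier[OF F f] .
    have pF: "f [^] (j::nat) \<in> F" for j using subgroup_int_pow_closed[OF F f, of "int j"] by (simp add: int_pow_int)
    let ?c = "\<lambda>j::nat. lcos F L (f [^] j)"
    have "?c ` {..?m} \<subseteq> lcos F L ` F" using pF by blast
    then have "card (?c ` {..?m}) \<le> ?m" by (rule card_mono[OF fin])
    then have "card (?c ` {..?m}) < card {..?m}" by simp
    then have "\<not> inj_on ?c {..?m}" by (rule pigeonhole)
    then obtain i j where ij: "i \<le> ?m" "j \<le> ?m" "i < j" "?c i = ?c j"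
      unfolding inj_on_def by (metis atMost_iff linorder_neqE_nat)
    have "inv (f [^] i) \<otimes> f [^] j \<in> L" using ij(4) lcos_eq_iff[OF F L pF pF] by blast
    moreover have "f [^] j = f [^] i \<otimes> f [^] (j - i)" using ij fc by (simp add: nat_pow_mult)
    ultimately have d: "f [^] (int (j - i)) \<in> L" using fc by (simp add: m_assoc[symmetric] int_pow_int)
    have "(j - i) dvd fact ?m" using ij by (intro dvd_fact) auto
    then obtain e where e: "fact ?m = (j - i) * e" by blast
    have "(f [^] (int (j - i))) [^] (int e) \<in> L" using subgroup_int_pow_closed[OF L d] .
    then show ?thesis using fc unfolding e by (simp only: int_pow_pow of_nat_mult)
  qed
  then show ?thesis using fact_gt_zero[of ?m] by (intro exI[of _ "fact ?m"]) simp
qed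

text \<open>On \<open>L\<close> the transfer is a sum of values of \<open>lam\<close> at conjugates
  of \<open>k\<close>, which \<open>cent\<close> turns into equal summands, one for each coset. The
  multiple of \<open>lam k\<close> is written as a sum, the target being an arbitrary additive
  abelian group.\<close>

lemma ex_transfer:
  fixes lam :: "'a \<Rightarrow> 'c::ab_group_add"
  assumes F: "subgroup F G" and L: "subgroup L G" "L \<subseteq> F" and fi: "fin_index F L"
    and nL: "\<And>f k. f \<in> F \<Longrightarrow> k \<in> L \<Longrightarrow> inv f \<otimes> k \<otimes> f \<in> L"
    and hom: "\<And>k l. k \<in> L \<Longrightarrow> l \<in> L \<Longrightarrow> lam (k \<otimes> l) = lam k + lam l"
    and cent: "\<And>f k. f \<in> F \<Longrightarrow> k \<in> L \<Longrightarrow> lam (inv f \<otimes> k \<otimes> f) = lam k"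
  shows "\<exists>v n. n > 0 \<and> (\<forall>f\<in>F. \<forall>g\<in>F. v (f \<otimes> g) = v f + v g) \<and> (\<forall>k\<in>L. v k = (\<Sum>i<(n::nat). lam k))"
proof -
  note Fc = subgroup.mem_carrier[OF F]
  note mF = subgroup.m_closed[OF F] subgroup.m_inv_closed[OF F]
  let ?c = "lcos F L"
  define p where "p f = inv_into F ?c (?c f)" for f
  have pF: "p f \<in> F" and pc: "?c (p f) = ?c f" if "f \<in> F" for f
    using that inv_into_into[of "?c f" ?c F] f_inv_into_f[of "?c f" ?c F] by (auto simp: p_def)
  have pL: "inv (p f) \<otimes> f \<in> L" if "f \<in> F" for f using pc[OF that] lcos_eq_iff[OF F L(1) pF[OF that] that] by simp
  have peq: "p f = p g" if "inv f \<otimes> g \<in> L" "f \<in> F" "g \<in> F" for f g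
    using lcos_eq_iff[OF F L(1) that(2,3)] that(1) by (simp add: p_def)
  define R where "R = p ` F"
  have RF: "R \<subseteq> F" using pF by (auto simp: R_def)
  have pR: "p r = r" if rR: "r \<in> R" for r
  proof -
    obtain f where f: "f \<in> F" "r = p f" using rR unfolding R_def by blast
    have "?c r = ?c f" using f pc by simp
    then show ?thesis using f by (simp add: p_def)
  qed
  have "finite (?c ` F)" using fi fin_index_iff[OF F L(1)] by simp
  then have "finite (inv_into F ?c ` ?c ` F)" by (rule finite_imageI)
  then have finR: "finite R" by (simp add: R_def p_def image_image)
  have Rne: "R \<noteq> {}" using subgroup.one_closed[OF F] by (auto simp: R_def)
  \<comment> \<open>For each representative \<open>r\<close>, the summand is the value at the
    element of \<open>L\<close> by which \<open>g \<otimes> r\<close> differs from the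
    representative of its coset.\<close>
  define v where "v g = (\<Sum>r\<in>R. lam (inv (p (g \<otimes> r)) \<otimes> (g \<otimes> r)))" for g
  have "v (g \<otimes> h) = v g + v h" if g: "g \<in> F" and h: "h \<in> F" for g h
  proof -
    let ?s = "\<lambda>r. p (h \<otimes> r)"
    have sR: "?s ` R \<subseteq> R" using h RF mF by (auto simp: R_def)
    have inj: "inj_on ?s R"
    proof (rule inj_onI)
      fix r r' assume r: "r \<in> R" "r' \<in> R" "?s r = ?s r'"
      have rF: "r \<in> F" "r' \<in> F" "h \<otimes> r \<in> F" "h \<otimes> r' \<in> F" using r RF h mF by auto
      have "?c (h \<otimes> r) = ?c (h \<otimes> r')" using pc[OF rF(3)] pc[OF rF(4)] r(3) by simp
      then have "inv (h \<otimes> r) \<otimes> (h \<otimes> r') \<in> L" using lcos_eq_iff[OF F L(1) rF(3,4)] by simp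
      moreover have "inv (h \<otimes> r) \<otimes> (h \<otimes> r') = inv r \<otimes> (inv h \<otimes> h) \<otimes> r'"
        using Fc[OF rF(1)] Fc[OF rF(2)] Fc[OF h] by (simp only: inv_mult_group m_assoc inv_closed m_closed)
      ultimately have "inv r \<otimes> r' \<in> L" using Fc[OF rF(1)] Fc[OF rF(2)] Fc[OF h] by simp
      then have "p r = p r'" using peq rF by blast
      then show "r = r'" using pR r by simp
    qed
    have bij: "bij_betw ?s R R" using inj sR endo_inj_surj[OF finR sR inj] by (simp add: bij_betw_def)
    \<comment> \<open>The cocycle identity. As \<open>?s\<close> permutes the representatives, the
      first summands add up to \<open>v g\<close>.\<close>
    have summand: "lam (inv (p (g \<otimes> h \<otimes> r)) \<otimes> (g \<otimes> h \<otimes> r))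
       = lam (inv (p (g \<otimes> ?s r)) \<otimes> (g \<otimes> ?s r)) + lam (inv (?s r) \<otimes> (h \<otimes> r))" if r: "r \<in> R" for r
    proof -
      have rF: "r \<in> F" "h \<otimes> r \<in> F" "?s r \<in> F" "g \<otimes> ?s r \<in> F" "g \<otimes> h \<otimes> r \<in> F" using r RF h g mF pF by auto
      have c: "g \<in> carrier G" "h \<in> carrier G" "r \<in> carrier G" "?s r \<in> carrier G" using g h rF Fc by auto
      have e: "inv (g \<otimes> ?s r) \<otimes> (g \<otimes> h \<otimes> r) = inv (?s r) \<otimes> (h \<otimes> r)"
      proof -
        have "inv (g \<otimes> ?s r) \<otimes> (g \<otimes> h \<otimes> r) = inv (?s r) \<otimes> (inv g \<otimes> g) \<otimes> (h \<otimes> r)"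
          using c by (simp only: inv_mult_group m_assoc inv_closed m_closed)
        then show ?thesis using c by simp
      qed
      then have "p (g \<otimes> ?s r) = p (g \<otimes> h \<otimes> r)" using peq[OF _ rF(4,5)] pL[OF rF(2)] by simp
      then have "inv (p (g \<otimes> h \<otimes> r)) \<otimes> (g \<otimes> h \<otimes> r) = (inv (p (g \<otimes> ?s r)) \<otimes> (g \<otimes> ?s r)) \<otimes> (inv (?s r) \<otimes> (h \<otimes> r))"
        using inv_mult_cancel[of "p (g \<otimes> ?s r)" "g \<otimes> ?s r" "g \<otimes> h \<otimes> r"] e c Fc[OF pF[OF rF(4)]] by simp
      then show ?thesis using hom[OF pL[OF rF(4)] pL[OF rF(2)]] by simp
    qed
    have "v (g \<otimes> h) = (\<Sum>r\<in>R. lam (inv (p (g \<otimes> ?s r)) \<otimes> (g \<otimes> ?s r))) + v h"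
      unfolding v_def using summand by (simp add: sum.distrib cong: sum.cong)
    also have "(\<Sum>r\<in>R. lam (inv (p (g \<otimes> ?s r)) \<otimes> (g \<otimes> ?s r))) = v g"
      unfolding v_def by (rule sum.reindex_bij_betw[OF bij])
    finally show ?thesis .
  qed
  moreover have "v k = (\<Sum>i<card R. lam k)" if k: "k \<in> L" for k
  proof -
    have "lam (inv (p (k \<otimes> r)) \<otimes> (k \<otimes> r)) = lam k" if r: "r \<in> R" for r
    proof -
      have rF: "r \<in> F" "k \<otimes> r \<in> F" using r RF k L(2) mF by auto
      have c: "r \<in> carrier G" "k \<in> carrier G" using rF k L(2) Fc by auto
      have "inv r \<otimes> (k \<otimes> r) \<in> L" using nL[OF rF(1) k] c by (simp add: m_assoc)
      then have "p r = p (k \<otimes> r)" using peq rF by blast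
      then show ?thesis using cent[OF rF(1) k] pR[OF r] c by (simp add: m_assoc)
    qed
    then have "v k = (\<Sum>r\<in>R. lam k)" unfolding v_def by (rule sum.cong[OF refl])
    also obtain h where "bij_betw h {..<card R} R"
      using finR ex_bij_betw_nat_finite[of R] by (auto simp: atLeast0LessThan)
    then have "(\<Sum>r\<in>R. lam k) = (\<Sum>i<card R. lam k)" by (rule sum.reindex_bij_betw[symmetric])
    finally show ?thesis .
  qed
  moreover have "card R > 0" using finR Rne by (simp add: card_gt_0_iff)
  ultimately show ?thesis by blast
qed

end


section \<open>Bounded conjugacy classes\<close>

lemma (in group) conj_nat_pow:
  assumes "x \<in> carrier G" "y \<in> carrier G"
  shows "(y \<otimes> x \<otimes> inv y) [^] (n::nat) = y \<otimes> x [^] n \<otimes> inv y"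
proof (induction n)
  case 0 then show ?case using assms by simp
next
  case (Suc n)
  have "(y \<otimes> x \<otimes> inv y) [^] Suc n = (y \<otimes> x [^] n \<otimes> inv y) \<otimes> (y \<otimes> x \<otimes> inv y)" using Suc by simp
  also have "\<dots> = y \<otimes> x [^] n \<otimes> (inv y \<otimes> y) \<otimes> x \<otimes> inv y"
    using assms by (simp only: m_assoc inv_closed m_closed nat_pow_closed)
  also have "\<dots> = y \<otimes> x [^] Suc n \<otimes> inv y" using assms by (simp add: m_assoc)
  finally show ?case .
qed

context tdlc
begin

section \<open>Scales, stabilizers and conjugation\<close>

lemma conj_ev:
  assumes "\<phi> \<in> Aut G T" "\<psi> \<in> Aut G T"
  shows "ev (\<psi> \<cdot> \<phi> \<cdot> ainv \<psi>) (int n) = \<psi> \<cdot> ev \<phi> (int n) \<cdot> ainv \<psi>"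
  using AG.conj_nat_pow[of \<phi> \<psi> n] assms by (simp add: carrier_Aut int_pow_int)

lemma conj_image:
  assumes "\<phi> \<in> Aut G T" "\<psi> \<in> Aut G T" "S \<subseteq> carrier G"
  shows "(\<psi> \<cdot> \<phi> \<cdot> ainv \<psi>) ` \<psi> ` S = \<psi> ` \<phi> ` S"
  using mult_image[OF Aut_image_subset[OF assms(2,3)]] inv_image(1)[OF assms(2,3)] mult_image[OF assms(3)] by simp

lemma tidy_conj:
  assumes \<phi>: "\<phi> \<in> Aut G T" and \<psi>: "\<psi> \<in> Aut G T" and t: "tidy \<phi> V"
  shows "tidy (\<psi> \<cdot> \<phi> \<cdot> ainv \<psi>) (\<psi> ` V)"
  using \<phi> \<psi> COS_D(4)[OF tidyD(1)[OF t]]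
  by (intro tidy_image[OF _ \<psi> \<phi> t]) (auto simp: conj_ev conj_image)

lemma aut_scale_conj:
  assumes \<phi>: "\<phi> \<in> Aut G T" and \<psi>: "\<psi> \<in> Aut G T" and Q: "Q \<in> COS G T"
  shows "aut_scale G T (\<psi> \<cdot> \<phi> \<cdot> ainv \<psi>) = aut_scale G T \<phi>"
proof -
  let ?c = "\<psi> \<cdot> \<phi> \<cdot> ainv \<psi>"
  obtain U where "multv \<phi> U" using ex_multv[OF \<phi> Q] by blast
  then have t: "tidy \<phi> U" using tidy_iff_multv[OF \<phi>] by simp
  note U = tidyD(1)[OF t]
  have c: "?c \<in> Aut G T" using \<phi> \<psi> by simp
  have "aut_scale G T ?c = rel_index G (?c ` \<psi> ` U) (\<psi> ` U)"
    using tidy_iff_min[OF c COS_image[OF \<psi> U]] tidy_conj[OF \<phi> \<psi> t] by simp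
  also have "\<dots> = rel_index G (\<phi> ` U) U"
    unfolding conj_image[OF \<phi> \<psi> COS_D(4)[OF U]] using \<phi> \<psi> COS_D(1)[OF U] by (intro rel_index_image) (auto simp: subgroup_image)
  also have "\<dots> = aut_scale G T \<phi>" using tidy_iff_min[OF \<phi> U] t by simp
  finally show ?thesis .
qed

lemma rel_index_inv:
  assumes "\<phi> \<in> Aut G T" "subgroup Q G"
  shows "rel_index G ((ainv \<phi>) ` Q) Q = rel_index G Q (\<phi> ` Q)"
  using rel_index_image[OF assms(1) subgroup_image[of "ainv \<phi>" Q] assms(2)] assms
    inv_image(2)[OF assms(1) subgroup.subset[OF assms(2)]] by simp

lemma image_subset_iff_index:
  assumes "\<phi> \<in> Aut G T" "subgroup Q G"
  shows "rel_index G (\<phi> ` Q) Q = 1 \<longleftrightarrow> \<phi> ` Q \<subseteq> Q" "rel_index G ((ainv \<phi>) ` Q) Q = 1 \<longleftrightarrow> Q \<subseteq> \<phi> ` Q"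
  using assms rel_index_one_iff[OF subgroup_image[OF assms] assms(2)] rel_index_one_iff[OF assms(2) subgroup_image[OF assms]]
  by (simp_all add: rel_index_inv)

text \<open>On a tidy subgroup both scales are indices, and index 1 in both directions means
  equality. So whether \<phi> fixes \<open>Q\<close> does not depend on the choice of the tidy
  \<open>Q\<close>.\<close>

lemma stab_iff_scale:
  assumes \<phi>: "\<phi> \<in> Aut G T" and t: "tidy \<phi> Q"
  shows "\<phi> ` Q = Q \<longleftrightarrow> aut_scale G T \<phi> = 1 \<and> aut_scale G T (ainv \<phi>) = 1"
proof -
  note Q = tidyD(1)[OF t]
  have "aut_scale G T \<phi> = rel_index G (\<phi> ` Q) Q" using tidy_iff_min[OF \<phi> Q] t by simp
  moreover have "aut_scale G T (ainv \<phi>) = rel_index G ((ainv \<phi>) ` Q) Q"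
    using tidy_iff_min[OF _ Q, of "ainv \<phi>"] tidy_inv[OF \<phi> t] \<phi> by simp
  ultimately show ?thesis using image_subset_iff_index[OF \<phi> COS_D(1)[OF Q]] by auto
qed

text \<open>On a tidy subgroup the indices of powers form a geometric progression, which is bounded
  only for ratio 1.\<close>

lemma subset_if_bounded_powers:
  assumes \<phi>: "\<phi> \<in> Aut G T" and t: "tidy \<phi> Q" and M: "\<And>j. rel_index G (ev \<phi> (int j) ` Q) Q \<le> M"
  shows "\<phi> ` Q \<subseteq> Q"
proof -
  note Q = tidyD(1)[OF t]
  have "rel_index G (\<phi> ` Q) Q ^ j \<le> M * 1 ^ j" for j
    using M[of j] tidy_multv[OF \<phi> t] by (simp add: multv_def)
  then have "rel_index G (\<phi> ` Q) Q \<le> 1" by (rule nat_power_growth) simp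
  moreover have "rel_index G (\<phi> ` Q) Q > 0" by (rule rel_index_pos[OF COS_image[OF \<phi> Q] Q])
  ultimately have "rel_index G (\<phi> ` Q) Q = 1" by simp
  then show ?thesis using image_subset_iff_index[OF \<phi> COS_D(1)[OF Q]] by simp
qed

lemma stab_if_bounded_powers:
  assumes \<phi>: "\<phi> \<in> Aut G T" and t: "tidy \<phi> Q"
    and M: "\<And>j. rel_index G (ev \<phi> (int j) ` Q) Q \<le> M" "\<And>j. rel_index G Q (ev \<phi> (int j) ` Q) \<le> M"
  shows "\<phi> ` Q = Q"
proof
  note Q = tidyD(1)[OF t]
  show "\<phi> ` Q \<subseteq> Q" by (rule subset_if_bounded_powers[OF \<phi> t M(1)])
  have "rel_index G (ev (ainv \<phi>) (int j) ` Q) Q \<le> M" for j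
    using M(2)[of j] rel_index_inv[of "ev \<phi> (int j)" Q] \<phi> COS_D(1)[OF Q] by (simp add: ev_inv ev_minus)
  then have "(ainv \<phi>) ` Q \<subseteq> Q" using \<phi> by (intro subset_if_bounded_powers[OF _ tidy_inv[OF \<phi> t]]) auto
  then show "Q \<subseteq> \<phi> ` Q" using image_mono[of "(ainv \<phi>) ` Q" Q \<phi>] inv_image(2)[OF \<phi> COS_D(4)[OF Q]] by simp
qed

lemma rel_index_mult_le:
  assumes "\<phi> \<in> Aut G T" "\<psi> \<in> Aut G T" "Q \<in> COS G T"
  shows "rel_index G ((\<phi> \<cdot> \<psi>) ` Q) Q \<le> rel_index G (\<psi> ` Q) Q * rel_index G (\<phi> ` Q) Q"
    "rel_index G Q ((\<phi> \<cdot> \<psi>) ` Q) \<le> rel_index G Q (\<phi> ` Q) * rel_index G Q (\<psi> ` Q)"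
proof -
  note Q = COS_D[OF assms(3)]
  have i: "rel_index G (\<phi> ` \<psi> ` Q) (\<phi> ` Q) = rel_index G (\<psi> ` Q) Q" "rel_index G (\<phi> ` Q) (\<phi> ` \<psi> ` Q) = rel_index G Q (\<psi> ` Q)"
    using assms Q by (auto intro!: rel_index_image simp: subgroup_image)
  note C = COS_image[OF assms(1,3)] COS_image[OF assms(1) COS_image[OF assms(2,3)]]
  show "rel_index G ((\<phi> \<cdot> \<psi>) ` Q) Q \<le> rel_index G (\<psi> ` Q) Q * rel_index G (\<phi> ` Q) Q"
    using rel_index_triangle[OF C(2,1) assms(3)] i mult_image[OF Q(4)] by simp
  show "rel_index G Q ((\<phi> \<cdot> \<psi>) ` Q) \<le> rel_index G Q (\<phi> ` Q) * rel_index G Q (\<psi> ` Q)"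
    using rel_index_triangle[OF assms(3) C] i mult_image[OF Q(4)] by simp
qed

text \<open>\<open>lam\<close> stands for the quotient of \<open>K\<close> by the stabilizer of
  \<open>Q\<close>, kept abstract as a homomorphism. Besides centrality and transfer, the work is to
  replace \<open>Q\<close> by a subgroup fixed by the kernel of the transfer without losing
  tidiness.\<close>

theorem ex_tidy_bounded_conj:
  fixes lam :: "('a \<Rightarrow> 'a) \<Rightarrow> 'c::ab_group_add"
  assumes Q: "Q \<in> COS G T" and F: "subgroup F AG" and K: "subgroup K AG" "K \<subseteq> F"
    and fi: "AG.fin_index F K" and tK: "\<And>k. k \<in> K \<Longrightarrow> tidy k Q"
    and bd: "\<And>t. t \<in> F \<Longrightarrow> \<exists>M. \<forall>\<psi>\<in>F. rel_index G ((\<psi> \<cdot> t \<cdot> ainv \<psi>) ` Q) Q \<le> M \<and>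
          rel_index G Q ((\<psi> \<cdot> t \<cdot> ainv \<psi>) ` Q) \<le> M"
    and hom: "\<And>k l. k \<in> K \<Longrightarrow> l \<in> K \<Longrightarrow> lam (k \<cdot> l) = lam k + lam l"
    and ker: "\<And>k. k \<in> K \<Longrightarrow> lam k = 0 \<longleftrightarrow> k ` Q = Q"
    and E: "finite E" "E \<subseteq> K" "\<And>k. k \<in> K \<Longrightarrow> \<exists>e\<in>generate AG E. lam e = lam k"
  shows "\<exists>W\<in>COS G T. \<forall>\<phi>\<in>F. tidy \<phi> W"
proof -
  note Qc = COS_D(4)[OF Q] and sQ = COS_D(1)[OF Q]
  have FA: "f \<in> Aut G T" if "f \<in> F" for f using subgroup.mem_carrier[OF F that] by (simp add: carrier_Aut)
  have Fc: "f \<in> carrier AG" if "f \<in> F" for f using subgroup.mem_carrier[OF F that] .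
  note mF = subgroup.m_closed[OF F] subgroup.m_inv_closed[OF F] subgroup.one_closed[OF F]
  note mK = subgroup.m_closed[OF K(1)] subgroup.m_inv_closed[OF K(1)] subgroup.one_closed[OF K(1)]
  have KF: "k \<in> F" if "k \<in> K" for k using K(2) that by blast
  have KA: "k \<in> Aut G T" if "k \<in> K" for k using FA KF that by blast
  have lam1: "lam \<one>\<^bsub>AG\<^esub> = 0" using ker[OF mK(3)] Qc by simp
  have lami: "lam (ainv k) = - lam k" if k: "k \<in> K" for k
    using hom[OF mK(2)[OF k] k] lam1 Fc[OF KF[OF k]] by (simp add: eq_neg_iff_add_eq_0)
  have evK: "ev k j \<in> K" if "k \<in> K" for k j using AG.subgroup_int_pow_closed[OF K(1) that] .
  have lamp: "lam (ev k (int j)) = (\<Sum>i<j. lam k)" if k: "k \<in> K" for k j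
  proof (induction j)
    case 0 then show ?case using lam1 by simp
  next
    case (Suc j)
    have "ev k (int (Suc j)) = ev k (int j) \<cdot> k" using ev_add[OF KA[OF k], of "int j" 1] KA[OF k] by (simp add: add.commute)
    then show ?case using hom[OF evK[OF k] k] Suc by simp
  qed
  have same: "k ` Q = l ` Q" if kl: "k \<in> K" "l \<in> K" "lam k = lam l" for k l
  proof -
    have "lam (ainv l \<cdot> k) = 0" using hom[OF mK(2)[OF kl(2)] kl(1)] lami[OF kl(2)] kl(3) by simp
    then have "(ainv l \<cdot> k) ` Q = Q" using ker[OF mK(1)[OF mK(2)[OF kl(2)] kl(1)]] by simp
    then have "l ` (ainv l) ` k ` Q = l ` Q" using mult_image[OF Qc] by simp
    then show ?thesis using inv_image(2)[OF KA[OF kl(2)] Aut_image_subset[OF KA[OF kl(1)] Qc]] by simp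
  qed
  obtain L where L: "subgroup L AG" "L \<subseteq> K" "\<And>f k. f \<in> F \<Longrightarrow> k \<in> L \<Longrightarrow> ainv f \<cdot> k \<cdot> f \<in> L" "AG.fin_index F L"
    using AG.fin_index_core[OF F K fi] by blast
  have LK: "k \<in> K" if "k \<in> L" for k using L(2) that by blast
  have LF: "L \<subseteq> F" using L(2) K(2) by blast

  \<comment> \<open>A bounded conjugacy class of \<open>t\<close> forces \<open>[t\<^sup>-\<^sup>1, k]\<close> to have bounded powers modulo the stabilizer of \<open>Q\<close>.\<close>
  have cent: "lam (ainv t \<cdot> k \<cdot> t) = lam k" if t: "t \<in> F" and k: "k \<in> L" for t k
  proof -
    let ?u = "ainv t \<cdot> k \<cdot> t"
    have kK: "k \<in> K" and uK: "?u \<in> K" using LK k L(3)[OF t k] by blast+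
    note kA = KA[OF kK] and tA = FA[OF t]
    have cr: "k \<in> carrier AG" "t \<in> carrier AG" using kA tA by (simp_all add: carrier_Aut)
    define q where "q = ?u \<cdot> ainv k"
    have qK: "q \<in> K" unfolding q_def using mK(1)[OF uK mK(2)[OF kK]] .
    obtain M where M: "\<And>\<psi>. \<psi> \<in> F \<Longrightarrow> rel_index G ((\<psi> \<cdot> t \<cdot> ainv \<psi>) ` Q) Q \<le> M \<and>
          rel_index G Q ((\<psi> \<cdot> t \<cdot> ainv \<psi>) ` Q) \<le> M" using bd[OF t] by blast
    let ?i = "ainv t"
    define M' where "M' = M * rel_index G (?i ` Q) Q + rel_index G Q (?i ` Q) * M"
    have main: "rel_index G (ev q (int j) ` Q) Q \<le> M' \<and> rel_index G Q (ev q (int j) ` Q) \<le> M'" for j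
    proof -
      let ?kj = "ev k (int j)"
      let ?c = "?kj \<cdot> t \<cdot> ainv ?kj"
      have kjK: "?kj \<in> K" using evK[OF kK] .
      have cA: "?c \<in> Aut G T" using KA[OF kjK] tA by simp
      have kjc: "?kj \<in> carrier AG" using KA[OF kjK] by (simp add: carrier_Aut)
      have "ev ?u (int j) = ?i \<cdot> ?kj \<cdot> t"
        using conj_ev[OF kA, of ?i j] tA cr by simp
      then have w: "ev ?u (int j) \<cdot> ainv ?kj = ?i \<cdot> ?c" using cr kjc by (simp add: AG.m_assoc)
      \<comment> \<open>\<open>lam\<close> ignores the order of factors, so q^j moves
        \<open>Q\<close> like u^j k^(-j), where u is the conjugate \<open>?u\<close>. The latter is
        t^(-1) times a conjugate of \<open>t\<close>, whose displacement of \<open>Q\<close> is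
        bounded independently of j.\<close>
      have "lam (ev q (int j)) = (\<Sum>i<j. lam ?u + - lam k)"
        using lamp[OF qK] hom[OF uK mK(2)[OF kK]] lami[OF kK] by (simp add: q_def)
      also have "\<dots> = lam (ev ?u (int j)) + lam (ainv ?kj)"
        using lamp[OF uK] lamp[OF kK] lami[OF kjK] by (simp add: sum_subtractf)
      also have "\<dots> = lam (?i \<cdot> ?c)" using hom[OF evK[OF uK, of "int j"] mK(2)[OF kjK]] w by simp
      finally have "ev q (int j) ` Q = (?i \<cdot> ?c) ` Q"
        using same[OF evK[OF qK, of "int j"], of "?i \<cdot> ?c"] mK(1)[OF evK[OF uK, of "int j"] mK(2)[OF kjK]] w by simp
      moreover have "rel_index G ((?i \<cdot> ?c) ` Q) Q \<le> M * rel_index G (?i ` Q) Q"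
        using rel_index_mult_le(1)[OF _ cA Q, of ?i] tA M[OF KF[OF kjK]] by (meson Aut_inv_closed mult_le_mono1 order_trans)
      moreover have "rel_index G Q ((?i \<cdot> ?c) ` Q) \<le> rel_index G Q (?i ` Q) * M"
        using rel_index_mult_le(2)[OF _ cA Q, of ?i] tA M[OF KF[OF kjK]] by (meson Aut_inv_closed mult_le_mono2 order_trans)
      ultimately show ?thesis unfolding M'_def by (simp add: trans_le_add1 trans_le_add2)
    qed
    have "q ` Q = Q" using main by (intro stab_if_bounded_powers[OF KA[OF qK] tK[OF qK]]) blast+
    then have "lam ?u + - lam k = 0" using ker[OF qK] hom[OF uK mK(2)[OF kK]] lami[OF kK] by (simp add: q_def)
    then show ?thesis by simp
  qed

  obtain v and n :: nat where n: "n > 0" and vh: "\<And>f g. f \<in> F \<Longrightarrow> g \<in> F \<Longrightarrow> v (f \<cdot> g) = v f + v g"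
    and vL: "\<And>k. k \<in> L \<Longrightarrow> v k = (\<Sum>i<n. lam k)"
    using AG.ex_transfer[OF F L(1) LF L(4) L(3) hom[OF LK LK] cent] by blast
  have v1: "v \<one>\<^bsub>AG\<^esub> = 0" using vh[OF mF(3) mF(3)] by simp
  have vi: "v (ainv f) = - v f" if f: "f \<in> F" for f
    using vh[OF mF(2)[OF f] f] v1 Fc[OF f] by (simp add: eq_neg_iff_add_eq_0)
  define P where "P = {f \<in> F. v f = 0}"
  \<comment> \<open>The product of \<open>L\<close> and \<open>P\<close>. Its elements will act on a
    subgroup fixed by \<open>P\<close> as elements of \<open>L\<close> do.\<close>
  define K1 where "K1 = {f \<in> F. \<exists>k\<in>L. v f = v k}"
  have sP: "subgroup P AG"
    by (rule AG.subgroupI) (use mF v1 vh vi Fc in \<open>auto simp: P_def\<close>)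
  have sK1: "subgroup K1 AG"
  proof (rule AG.subgroupI)
    show "K1 \<subseteq> carrier AG" using Fc by (auto simp: K1_def)
    show "K1 \<noteq> {}" using mF(3) subgroup.one_closed[OF L(1)] by (auto simp: K1_def)
    show "ainv f \<in> K1" if f: "f \<in> K1" for f
    proof -
      obtain k where k: "k \<in> L" "v f = v k" "f \<in> F" using f by (auto simp: K1_def)
      have "v (ainv f) = v (ainv k)" using vi[of f] vi[of k] k subsetD[OF LF] by simp
      then show ?thesis using k mF subgroup.m_inv_closed[OF L(1) k(1)] unfolding K1_def by blast
    qed
    show "f \<cdot> g \<in> K1" if fg: "f \<in> K1" "g \<in> K1" for f g
    proof -
      obtain k l where k: "k \<in> L" "v f = v k" "f \<in> F" "l \<in> L" "v g = v l" "g \<in> F" using fg by (auto simp: K1_def)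
      have "v (f \<cdot> g) = v (k \<cdot> l)" using vh[of f g] vh[of k l] k subsetD[OF LF] by simp
      then show ?thesis using k mF subgroup.m_closed[OF L(1) k(1,4)] unfolding K1_def by blast
    qed
  qed
  interpret fe: flat_extension G T F P K1
  proof (intro flat_extension.intro flat_extension_axioms.intro tdlc_axioms F sP sK1)
    show "P \<subseteq> K1" using subgroup.one_closed[OF L(1)] v1 by (force simp: P_def K1_def)
    show "K1 \<subseteq> F" by (auto simp: K1_def)
    fix \<phi> \<psi> assume h: "\<phi> \<in> F" "\<psi> \<in> F"
    let ?p = "ainv (\<psi> \<cdot> \<phi>) \<cdot> (\<phi> \<cdot> \<psi>)"
    have "v ?p = 0" using h vh vi mF by simp
    then have "?p \<in> P" using h mF by (simp add: P_def)
    moreover have "\<phi> \<cdot> \<psi> = \<psi> \<cdot> \<phi> \<cdot> ?p" using Fc[OF h(1)] Fc[OF h(2)] by (simp add: AG.m_assoc[symmetric])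
    ultimately show "\<exists>p\<in>P. \<phi> \<cdot> \<psi> = \<psi> \<cdot> \<phi> \<cdot> p" by blast
  qed
  \<comment> \<open>That n times \<open>lam k\<close> vanishes means that k^n fixes
    \<open>Q\<close>. As scales are multiplicative on powers, \<open>k\<close> has scale 1 in both
    directions and fixes \<open>Q\<close> itself.\<close>
  have stab: "k ` Q = Q" if k: "k \<in> L" "v k = 0" for k
  proof -
    have kK: "k \<in> K" using LK k by blast
    note kA = KA[OF kK]
    have "ev k (int n) ` Q = Q" using ker[OF evK[OF kK, of "int n"]] lamp[OF kK, of n] vL[OF k(1)] k(2) by simp
    then have "aut_scale G T (ev k (int n)) = 1" "aut_scale G T (ainv (ev k (int n))) = 1"
      using stab_iff_scale[OF KA[OF evK[OF kK]] tK[OF evK[OF kK]], of "int n"] by blast+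
    moreover have "ainv (ev k (int n)) = ev (ainv k) (int n)" using kA by (simp add: ev_inv ev_minus)
    ultimately have "aut_scale G T k = 1" "aut_scale G T (ainv k) = 1"
      using aut_scale_pow[OF kA Q, of n] aut_scale_pow[OF _ Q, of "ainv k" n] kA n by simp_all
    then show ?thesis using stab_iff_scale[OF kA tK[OF kK]] by blast
  qed
  \<comment> \<open>The orbit of \<open>Q\<close> under \<open>P\<close>. It is finite because
    \<open>P\<close> meets finitely many cosets of \<open>L\<close> and the elements of
    \<open>P\<close> in \<open>L\<close> fix \<open>Q\<close>; its intersection is invariant under
    \<open>P\<close>.\<close>
  define \<Q> where "\<Q> = (\<lambda>p. p ` Q) ` P"
  define V where "V = (\<Inter>Y\<in>\<Q>. Y)"
  have fin: "finite \<Q>"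
  proof -
    have "finite (AG.lcos F L ` F)" using L(4) AG.fin_index_iff[OF F L(1)] by simp
    then have finP: "finite (AG.lcos F L ` P)" by (rule finite_subset[rotated]) (auto simp: P_def)
    have eq: "p ` Q = r ` Q" if pr: "p \<in> P" "r \<in> P" "AG.lcos F L p = AG.lcos F L r" for p r
    proof -
      have pF: "p \<in> F" "r \<in> F" using pr by (auto simp: P_def)
      have "ainv p \<cdot> r \<in> L" using pr AG.lcos_eq_iff[OF F L(1) pF] by simp
      moreover have "v (ainv p \<cdot> r) = 0" using pr pF vh vi mF by (simp add: P_def)
      ultimately have "(ainv p \<cdot> r) ` Q = Q" by (rule stab)
      then have "p ` (ainv p) ` r ` Q = p ` Q" using mult_image[OF Qc] by simp
      then show ?thesis using inv_image(2)[OF FA[OF pF(1)] Aut_image_subset[OF FA[OF pF(2)] Qc]] by simp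
    qed
    have "\<Q> \<subseteq> (\<lambda>y. inv_into P (AG.lcos F L) y ` Q) ` AG.lcos F L ` P"
    proof
      fix Y assume "Y \<in> \<Q>"
      then obtain p where p: "p \<in> P" "Y = p ` Q" by (auto simp: \<Q>_def)
      have "inv_into P (AG.lcos F L) (AG.lcos F L p) ` Q = p ` Q"
        using p inv_into_into[of "AG.lcos F L p" "AG.lcos F L" P] f_inv_into_f[of "AG.lcos F L p" "AG.lcos F L" P]
        by (intro eq) auto
      then show "Y \<in> (\<lambda>y. inv_into P (AG.lcos F L) y ` Q) ` AG.lcos F L ` P" using p by blast
    qed
    then show ?thesis using finP finite_surj by blast
  qed
  have P1: "\<one>\<^bsub>AG\<^esub> \<in> P" using subgroup.one_closed[OF sP] .
  have PF: "p \<in> F" if "p \<in> P" for p using that by (simp add: P_def)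
  have ne: "\<Q> \<noteq> {}" using P1 unfolding \<Q>_def by blast
  have V: "V \<in> COS G T" unfolding V_def using fin ne COS_image[OF FA[OF PF] Q] by (intro COS_INT) (auto simp: \<Q>_def)
  note Vc = COS_D(4)[OF V]
  have psub: "p ` V \<subseteq> V" if p: "p \<in> P" for p
  proof
    fix y assume "y \<in> p ` V"
    then obtain x where x: "x \<in> V" "y = p x" by blast
    have "y \<in> r ` Q" if r: "r \<in> P" for r
    proof -
      have "ainv p \<cdot> r \<in> P" using p r sP by (simp add: subgroup.m_closed subgroup.m_inv_closed)
      then have "x \<in> (ainv p \<cdot> r) ` Q" using x by (auto simp: V_def \<Q>_def)
      then have "y \<in> p ` (ainv p) ` r ` Q" using x mult_image[OF Qc] by auto
      then show ?thesis using inv_image(2)[OF FA[OF PF[OF p]] Aut_image_subset[OF FA[OF PF[OF r]] Qc]] by simp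
    qed
    then show "y \<in> V" by (auto simp: V_def \<Q>_def)
  qed
  have PV: "fe.Pset V" unfolding fe.Pset_def
  proof (intro conjI ballI Vc)
    fix p assume p: "p \<in> P"
    have "V \<subseteq> p ` V" using image_mono[OF psub[OF subgroup.m_inv_closed[OF sP p]], of p] inv_image(2)[OF FA[OF PF[OF p]] Vc] by simp
    then show "p ` V = V" using psub[OF p] by blast
  qed
  \<comment> \<open>By normality of \<open>L\<close> the conjugate p^(-1) k p is in
    \<open>L\<close>, hence tidy on \<open>Q\<close>. Conjugating back makes p(Q) tidy for
    \<open>k\<close>.\<close>
  have tL: "tidy k V" if k: "k \<in> L" for k
  proof -
    note kA = KA[OF LK[OF k]]
    have "tidy k (p ` Q)" if p: "p \<in> P" for p
    proof -
      note pA = FA[OF PF[OF p]]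
      let ?u = "ainv p \<cdot> k \<cdot> p"
      have u: "?u \<in> L" using L(3)[OF PF[OF p] k] .
      have cr: "p \<in> carrier AG" "k \<in> carrier AG" using pA kA by (simp_all add: carrier_Aut)
      have "p \<cdot> ?u \<cdot> ainv p = (p \<cdot> ainv p) \<cdot> k \<cdot> (p \<cdot> ainv p)"
        using cr by (simp only: AG.m_assoc AG.inv_closed AG.m_closed)
      then have "p \<cdot> ?u \<cdot> ainv p = k" using cr by simp
      then show ?thesis using tidy_conj[OF KA[OF LK[OF u]] pA tK[OF LK[OF u]]] by simp
    qed
    then show ?thesis unfolding V_def using fin ne by (intro tidy_INT[OF kA]) (auto simp: \<Q>_def)
  qed
  have "tidy f V" if f: "f \<in> K1" for f
  proof -
    obtain k where k: "k \<in> L" "v f = v k" and fF: "f \<in> F" using f by (auto simp: K1_def)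
    have kF: "k \<in> F" using k LF by blast
    define p where "p = ainv k \<cdot> f"
    have p: "p \<in> P" using k fF kF vh vi mF by (simp add: p_def P_def)
    have fk: "f = k \<cdot> p" using Fc[OF fF] Fc[OF kF] by (simp add: p_def AG.m_assoc[symmetric])
    have "ev f (int m) ` V = ev k (int m) ` V" for m
      unfolding fk fe.ev_mult_image[OF kF PF[OF p] PV]
      using fe.PsetD(2)[OF PV AG.subgroup_int_pow_closed[OF sP p]] by simp
    then have "tidy f (\<one>\<^bsub>AG\<^esub> ` V)" using Vc FA[OF fF] FA[OF kF] Aut_image_subset[of "ev k _" V]
      by (intro tidy_image[OF FA[OF fF] _ FA[OF kF] tL[OF k(1)]]) auto
    then show ?thesis using Vc by simp
  qed
  then have ok: "fe.ok V" using V PV by (simp add: fe.ok_def)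
  obtain N where N: "N > 0" "\<And>f. f \<in> F \<Longrightarrow> ev f (int N) \<in> L" using AG.fin_index_exponent[OF F L(1,4)] by blast
  have LK1: "L \<subseteq> K1" using LF by (auto simp: K1_def)
  \<comment> \<open>Generators of the quotient lie in \<open>K\<close>, perhaps outside
    \<open>L\<close>. Their N-th powers are in \<open>L\<close>, and \<open>full\<close> tolerates
    the passage to powers.\<close>
  define E' where "E' = (\<lambda>e. ev e (int N)) ` E"
  have E'L: "E' \<subseteq> L" using N(2) E(2) K(2) by (auto simp: E'_def)
  have Lcar: "L \<subseteq> carrier AG" using subgroup.subset[OF L(1)] .
  have sg: "subgroup (generate AG E') AG" using AG.generate_is_subgroup[of E'] E'L Lcar by blast
  have genL: "generate AG E' \<subseteq> L" using AG.generate_subgroup_incl[OF E'L L(1)] .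
  \<comment> \<open>As \<open>lam\<close> is a homomorphism into an abelian group, having a matching
    N-th power is a subgroup condition and passes from \<open>E\<close> to all that \<open>E\<close>
    generates.\<close>
  define D where "D = {e \<in> K. \<exists>e'\<in>generate AG E'. lam (ev e (int N)) = lam e'}"
  have "subgroup D AG"
  proof (rule AG.subgroupI)
    show "D \<subseteq> carrier AG" using KA by (auto simp: D_def carrier_Aut)
    have "\<one>\<^bsub>AG\<^esub> \<in> D" using mK(3) subgroup.one_closed[OF sg] by (auto simp: D_def carrier_Aut)
    then show "D \<noteq> {}" by blast
    show "ainv x \<in> D" if x: "x \<in> D" for x
    proof -
      obtain e' where e: "e' \<in> generate AG E'" "lam (ev x (int N)) = lam e'" "x \<in> K" using x by (auto simp: D_def)
      have "ev (ainv x) (int N) = ainv (ev x (int N))" using KA[OF e(3)] by (simp add: ev_inv ev_minus)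
      then have "lam (ev (ainv x) (int N)) = lam (ainv e')" using lami[OF evK[OF e(3)]] lami[OF LK, of e'] e subsetD[OF genL] by simp
      then show ?thesis using e mK(2) subgroup.m_inv_closed[OF sg e(1)] unfolding D_def by blast
    qed
    show "x \<cdot> y \<in> D" if xy: "x \<in> D" "y \<in> D" for x y
    proof -
      obtain e' where e: "e' \<in> generate AG E'" "lam (ev x (int N)) = lam e'" "x \<in> K" using xy by (auto simp: D_def)
      obtain d' where d: "d' \<in> generate AG E'" "lam (ev y (int N)) = lam d'" "y \<in> K" using xy by (auto simp: D_def)
      have "lam (ev (x \<cdot> y) (int N)) = lam (ev x (int N)) + lam (ev y (int N))"
        using lamp[OF mK(1)[OF e(3) d(3)]] lamp[OF e(3)] lamp[OF d(3)] hom[OF e(3) d(3)] by (simp add: sum.distrib)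
      also have "\<dots> = lam (e' \<cdot> d')" using e d hom[OF LK LK, of e' d'] subsetD[OF genL] by simp
      finally show ?thesis using e d mK(1) subgroup.m_closed[OF sg e(1) d(1)] unfolding D_def by blast
    qed
  qed
  moreover have "E \<subseteq> D"
  proof
    fix e assume e: "e \<in> E"
    then have "ev e (int N) \<in> generate AG E'" by (auto simp: E'_def intro: generate.incl)
    then show "e \<in> D" using e E(2) by (auto simp: D_def)
  qed
  ultimately have genD: "generate AG E \<subseteq> D" by (intro AG.generate_subgroup_incl)
  have full: "fe.full E'"
    unfolding fe.full_def
  proof (intro ballI exI conjI)
    show "N > 0" by (rule N(1))
    fix y assume "y \<in> K1"
    then obtain k where k: "k \<in> L" "v y = v k" and yF: "y \<in> F" by (auto simp: K1_def)
    obtain e where e: "e \<in> generate AG E" "lam e = lam k" using E(3)[OF LK[OF k(1)]] by blast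
    obtain e' where e': "e' \<in> generate AG E'" "lam (ev e (int N)) = lam e'" "e \<in> K" using genD e by (auto simp: D_def)
    have e'L: "e' \<in> L" and e'F: "e' \<in> F" using e' genL LF by blast+
    have vp: "v (ev f (int j)) = (\<Sum>i<j. v f)" if f: "f \<in> F" for f j
    proof (induction j)
      case 0 then show ?case using v1 by simp
    next
      case (Suc j)
      have "ev f (int (Suc j)) = ev f (int j) \<cdot> f" using ev_add[OF FA[OF f], of "int j" 1] FA[OF f] by (simp add: add.commute)
      then show ?case using vh[of "ev f (int j)" f] f Suc by simp
    qed
    have "v (ev y (int N)) = v (ev k (int N))" using vp[OF yF] vp[of k] k LF by auto
    also have "\<dots> = (\<Sum>i<n. lam (ev k (int N)))" using vL[OF AG.subgroup_int_pow_closed[OF L(1) k(1)]] .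
    also have "lam (ev k (int N)) = lam e'" using lamp[OF LK[OF k(1)]] lamp[OF e'(3)] e(2) e'(2) by simp
    also have "(\<Sum>i<n. lam e') = v e'" using vL[OF e'L] by simp
    finally have ve: "v (ev y (int N)) = v e'" .
    \<comment> \<open>y^N and \<open>e'\<close> have the same transfer, so they differ by an element
      of the kernel \<open>P\<close>.\<close>
    let ?p = "ainv e' \<cdot> ev y (int N)"
    have "?p \<in> P" using ve vh vi mF e'F yF by (simp add: P_def)
    then have "?p \<in> generate AG (E' \<union> P)" by (auto intro: generate.incl)
    moreover have "e' \<in> generate AG (E' \<union> P)" using e'(1) AG.mono_generate[of E' "E' \<union> P"] by auto
    ultimately have "e' \<cdot> ?p \<in> generate AG (E' \<union> P)" using generate.eng by metis
    then show "ev y (int N) \<in> generate AG (E' \<union> P)"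
      using Fc[OF e'F] Fc[OF fe.F_ev[OF yF]] by (simp add: AG.m_assoc[symmetric])
  qed
  obtain R where R: "finite R" "R \<subseteq> F" "\<forall>f\<in>F. \<exists>r\<in>R. ainv r \<cdot> f \<in> L"
    using L(4) unfolding AG.fin_index_def by blast
  show ?thesis
  proof (rule fe.ex_tidy_all[OF ok _ _ full N(1) _ R(1,2)])
    show "finite E'" using E(1) by (simp add: E'_def)
    show "E' \<subseteq> K1" using E'L LK1 by blast
    show "ev \<phi> (int N) \<in> K1" if "\<phi> \<in> F" for \<phi> using N(2)[OF that] LK1 by blast
    show "\<exists>f\<in>R. ainv f \<cdot> \<phi> \<in> K1" if "\<phi> \<in> F" for \<phi> using R(3) that LK1 by blast
  qed
qed

end


section \<open>Finite index and boundedness of conjugacy classes\<close>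

context group
begin

lemma fin_index_if_finite_rcosets:
  assumes H: "subgroup H G" and K: "subgroup K G" and fin: "finite (rcosets\<^bsub>G\<lparr>carrier := H\<rparr>\<^esub> K)"
  shows "fin_index H K"
proof -
  note Hc = subgroup.mem_carrier[OF H]
  have e: "rcosets\<^bsub>G\<lparr>carrier := H\<rparr>\<^esub> K = (\<lambda>a. K #> a) ` H" by (auto simp: RCOSETS_def r_coset_def)
  have "finite ((\<lambda>a. K #> a) ` H)" using fin unfolding e .
  then obtain R where R: "finite R" "R \<subseteq> H" "(\<lambda>a. K #> a) ` H = (\<lambda>a. K #> a) ` R" by (metis finite_subset_image subset_refl)
  \<comment> \<open>Inversion turns right cosets into left cosets, so inverted representatives
    serve.\<close>
  have "\<exists>r\<in>m_inv G ` R. inv r \<otimes> h \<in> K" if h: "h \<in> H" for h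
  proof -
    have hi: "inv h \<in> H" using subgroup.m_inv_closed[OF H h] .
    then have "K #> inv h \<in> (\<lambda>a. K #> a) ` R" using R(3) by blast
    then obtain r where r: "r \<in> R" "K #> inv h = K #> r" by blast
    have c: "h \<in> carrier G" "r \<in> carrier G" using h r R(2) Hc by blast+
    have "inv h \<in> K #> r" using rcos_self[OF inv_closed[OF c(1)] K] r(2) by simp
    then obtain k where k: "k \<in> K" "inv h = k \<otimes> r" by (auto simp: r_coset_def)
    have kc: "k \<in> carrier G" using subgroup.mem_carrier[OF K k(1)] .
    have "h = inv (k \<otimes> r)" using k(2) c by (metis inv_inv)
    then have "r \<otimes> h = r \<otimes> inv r \<otimes> inv k" using c kc by (simp only: inv_mult_group m_assoc inv_closed)
    then have "inv (inv r) \<otimes> h \<in> K" using c kc subgroup.m_inv_closed[OF K k(1)] by simp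
    then show ?thesis using r by blast
  qed
  moreover have "m_inv G ` R \<subseteq> H" using R(2) subgroup.m_inv_closed[OF H] by blast
  ultimately show ?thesis using R(1) unfolding fin_index_def by blast
qed

lemma fin_index_subset:
  assumes "subgroup H G" "subgroup F G" "subgroup K G" "F \<subseteq> H" "fin_index H K"
  shows "fin_index F K"
proof -
  have "finite (lcos H K ` H)" using fin_index_iff[OF assms(1,3)] assms(5) by simp
  then have "finite ((\<lambda>S. S \<inter> F) ` lcos H K ` F)" using assms(4) by (meson finite_imageI finite_subset image_mono)
  moreover have "(\<lambda>S. S \<inter> F) ` lcos H K ` F = lcos F K ` F"
    using assms(4) unfolding image_image by (intro image_cong) (auto simp: lcos_def)
  ultimately show ?thesis using fin_index_iff[OF assms(2,3)] by simp
qed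

end

context tdlc
begin

text \<open>A set has bounded diameter iff its distances from one point are bounded. Both factors in
  \<open>cos_dist\<close> are at least 1, so a bound on the product bounds each. Passing from
  \<open>V\<close> to \<open>Q\<close> costs a constant factor, as automorphisms preserve
  indices.\<close>

lemma bounded_auts_iff:
  assumes B: "B \<subseteq> Aut G T" and Q: "Q \<in> COS G T"
  shows "bounded_auts G T B \<longleftrightarrow> (\<exists>M::nat. \<forall>\<beta>\<in>B. rel_index G (\<beta> ` Q) Q \<le> M \<and> rel_index G Q (\<beta> ` Q) \<le> M)"
proof
  note sQ = COS_D(1)[OF Q]
  assume "bounded_auts G T B"
  then obtain V and M :: real where V: "V \<in> COS G T" and M: "\<And>\<beta> \<gamma>. \<beta> \<in> B \<Longrightarrow> \<gamma> \<in> B \<Longrightarrow> cos_dist G (\<beta> ` V) (\<gamma> ` V) \<le> M"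
    unfolding bounded_auts_def by blast
  show "\<exists>M::nat. \<forall>\<beta>\<in>B. rel_index G (\<beta> ` Q) Q \<le> M \<and> rel_index G Q (\<beta> ` Q) \<le> M"
  proof (cases "B = {}")
    case False
    then obtain \<gamma> where \<gamma>: "\<gamma> \<in> B" by blast
    note sV = COS_D(1)[OF V]
    have gA: "\<gamma> \<in> Aut G T" using \<gamma> B by blast
    have gV: "\<gamma> ` V \<in> COS G T" using COS_image[OF gA V] .
    define m where "m = nat \<lfloor>exp M\<rfloor>"
    let ?M = "rel_index G Q V * m * rel_index G (\<gamma> ` V) Q + rel_index G Q (\<gamma> ` V) * m * rel_index G V Q"
    have "rel_index G (\<beta> ` Q) Q \<le> ?M \<and> rel_index G Q (\<beta> ` Q) \<le> ?M" if b: "\<beta> \<in> B" for \<beta>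
    proof -
      have bA: "\<beta> \<in> Aut G T" using b B by blast
      have bV: "\<beta> ` V \<in> COS G T" and bQ: "\<beta> ` Q \<in> COS G T" using COS_image[OF bA] V Q by blast+
      let ?a = "rel_index G (\<beta> ` V) (\<gamma> ` V)" and ?b = "rel_index G (\<gamma> ` V) (\<beta> ` V)"
      have pos: "?a > 0" "?b > 0" using rel_index_pos[OF bV gV] rel_index_pos[OF gV bV] .
      have "ln (real (?a * ?b)) \<le> M" using M[OF b \<gamma>] by (simp add: cos_dist_def)
      then have "real (?a * ?b) \<le> exp M" using pos by (metis exp_le_cancel_iff exp_ln of_nat_0_less_iff mult_pos_pos)
      then have ab: "?a * ?b \<le> m" unfolding m_def by (simp add: le_nat_iff le_floor_iff)
      have "?a * 1 \<le> ?a * ?b" "1 * ?b \<le> ?a * ?b" using pos by (auto intro!: mult_le_mono)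
      then have le: "?a \<le> m" "?b \<le> m" using ab by linarith+
      have "rel_index G (\<beta> ` Q) Q \<le> rel_index G (\<beta> ` Q) (\<beta> ` V) * rel_index G (\<beta> ` V) Q" by (rule rel_index_triangle[OF bQ bV Q])
      also have "\<dots> \<le> rel_index G (\<beta> ` Q) (\<beta> ` V) * (?a * rel_index G (\<gamma> ` V) Q)"
        by (rule mult_le_mono2[OF rel_index_triangle[OF bV gV Q]])
      also have "\<dots> \<le> rel_index G Q V * (m * rel_index G (\<gamma> ` V) Q)"
        unfolding rel_index_image[OF bA sQ sV] using le by (intro mult_le_mono) auto
      finally have 1: "rel_index G (\<beta> ` Q) Q \<le> rel_index G Q V * m * rel_index G (\<gamma> ` V) Q" by (simp add: mult_ac)
      have "rel_index G Q (\<beta> ` Q) \<le> rel_index G Q (\<gamma> ` V) * rel_index G (\<gamma> ` V) (\<beta> ` Q)" by (rule rel_index_triangle[OF Q gV bQ])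
      also have "\<dots> \<le> rel_index G Q (\<gamma> ` V) * (?b * rel_index G (\<beta> ` V) (\<beta> ` Q))"
        by (rule mult_le_mono2[OF rel_index_triangle[OF gV bV bQ]])
      also have "\<dots> \<le> rel_index G Q (\<gamma> ` V) * (m * rel_index G V Q)"
        unfolding rel_index_image[OF bA sV sQ] using le by (intro mult_le_mono) auto
      finally have 2: "rel_index G Q (\<beta> ` Q) \<le> rel_index G Q (\<gamma> ` V) * m * rel_index G V Q" by (simp add: mult_ac)
      show ?thesis using 1 2 by (simp add: trans_le_add1 trans_le_add2)
    qed
    then show ?thesis by blast
  qed simp
next
  assume "\<exists>M::nat. \<forall>\<beta>\<in>B. rel_index G (\<beta> ` Q) Q \<le> M \<and> rel_index G Q (\<beta> ` Q) \<le> M"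
  then obtain M :: nat where M: "\<And>\<beta>. \<beta> \<in> B \<Longrightarrow> rel_index G (\<beta> ` Q) Q \<le> M \<and> rel_index G Q (\<beta> ` Q) \<le> M" by blast
  have "cos_dist G (\<beta> ` Q) (\<gamma> ` Q) \<le> ln (real ((M * M) * (M * M)))" if b: "\<beta> \<in> B" "\<gamma> \<in> B" for \<beta> \<gamma>
  proof -
    have C: "\<beta> ` Q \<in> COS G T" "\<gamma> ` Q \<in> COS G T" using COS_image[OF _ Q] b B by blast+
    have "rel_index G (\<beta> ` Q) (\<gamma> ` Q) \<le> M * M"
      using order_trans[OF rel_index_triangle[OF C(1) Q C(2)] mult_le_mono] M b by blast
    moreover have "rel_index G (\<gamma> ` Q) (\<beta> ` Q) \<le> M * M"
      using order_trans[OF rel_index_triangle[OF C(2) Q C(1)] mult_le_mono] M b by blast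
    ultimately have le: "rel_index G (\<beta> ` Q) (\<gamma> ` Q) * rel_index G (\<gamma> ` Q) (\<beta> ` Q) \<le> (M * M) * (M * M)" by (rule mult_le_mono)
    have "rel_index G (\<beta> ` Q) (\<gamma> ` Q) * rel_index G (\<gamma> ` Q) (\<beta> ` Q) > 0" using rel_index_pos[OF C] rel_index_pos[OF C(2,1)] by simp
    then show ?thesis unfolding cos_dist_def using le by (intro ln_mono) (simp_all only: of_nat_0_less_iff of_nat_le_iff)
  qed
  then show "bounded_auts G T B" unfolding bounded_auts_def using Q by blast
qed

lemma FCd_iff:
  assumes H: "subgroup H AG" and Q: "Q \<in> COS G T"
  shows "\<phi> \<in> FCd G T H \<longleftrightarrow> \<phi> \<in> H \<and> (\<exists>M. \<forall>\<psi>\<in>H. rel_index G ((\<psi> \<cdot> \<phi> \<cdot> ainv \<psi>) ` Q) Q \<le> M \<and>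
          rel_index G Q ((\<psi> \<cdot> \<phi> \<cdot> ainv \<psi>) ` Q) \<le> M)"
proof (cases "\<phi> \<in> H")
  case True
  have HA: "\<psi> \<in> Aut G T" if "\<psi> \<in> H" for \<psi> using subgroup.mem_carrier[OF H that] by (simp add: carrier_Aut)
  have "conj_class G T H \<phi> \<subseteq> Aut G T" using HA True by (auto simp: conj_class_def)
  from bounded_auts_iff[OF this Q] show ?thesis using True unfolding FCd_def conj_class_def by blast
qed (simp add: FCd_def)

text \<open>Displacement of \<open>Q\<close> is submultiplicative, inversion exchanges its two
  indices, and conjugation distributes over products.\<close>

lemma subgroup_FCd:
  assumes H: "subgroup H AG" and Q: "Q \<in> COS G T"
  shows "subgroup (FCd G T H) AG"
proof (rule AG.subgroupI)
  note FC = FCd_iff[OF H Q] and sQ = COS_D(1)[OF Q] and Qc = COS_D(4)[OF Q]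
  have HA: "\<psi> \<in> Aut G T" and Hc: "\<psi> \<in> carrier AG" if "\<psi> \<in> H" for \<psi> using subgroup.mem_carrier[OF H that] by (simp_all add: carrier_Aut)
  show "FCd G T H \<subseteq> carrier AG" using Hc by (auto simp: FCd_def)
  have "\<one>\<^bsub>AG\<^esub> \<in> FCd G T H"
    unfolding FC using subgroup.one_closed[OF H] Hc Qc rel_index_one_iff[OF sQ sQ] by (auto intro!: exI[of _ 1])
  then show "FCd G T H \<noteq> {}" by blast
  fix a assume "a \<in> FCd G T H"
  then obtain M where a: "a \<in> H" and M: "\<And>\<psi>. \<psi> \<in> H \<Longrightarrow> rel_index G ((\<psi> \<cdot> a \<cdot> ainv \<psi>) ` Q) Q \<le> M \<and>
          rel_index G Q ((\<psi> \<cdot> a \<cdot> ainv \<psi>) ` Q) \<le> M" unfolding FC by blast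
  have "rel_index G ((\<psi> \<cdot> ainv a \<cdot> ainv \<psi>) ` Q) Q \<le> M \<and>
          rel_index G Q ((\<psi> \<cdot> ainv a \<cdot> ainv \<psi>) ` Q) \<le> M" if p: "\<psi> \<in> H" for \<psi>
  proof -
    let ?c = "\<psi> \<cdot> a \<cdot> ainv \<psi>"
    have cA: "?c \<in> Aut G T" "ainv ?c \<in> Aut G T" using HA a p by simp_all
    have e: "\<psi> \<cdot> ainv a \<cdot> ainv \<psi> = ainv ?c" using Hc[OF a] Hc[OF p] by (simp add: AG.inv_mult_group AG.m_assoc)
    show ?thesis unfolding e using rel_index_inv[OF cA(1) sQ] rel_index_inv[OF cA(2) sQ] M[OF p] cA by (simp add: carrier_Aut)
  qed
  then show "ainv a \<in> FCd G T H" unfolding FC using subgroup.m_inv_closed[OF H a] by blast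
  fix b assume "b \<in> FCd G T H"
  then obtain M' where b: "b \<in> H" and M': "\<And>\<psi>. \<psi> \<in> H \<Longrightarrow> rel_index G ((\<psi> \<cdot> b \<cdot> ainv \<psi>) ` Q) Q \<le> M' \<and>
          rel_index G Q ((\<psi> \<cdot> b \<cdot> ainv \<psi>) ` Q) \<le> M'" unfolding FC by blast
  have "rel_index G ((\<psi> \<cdot> (a \<cdot> b) \<cdot> ainv \<psi>) ` Q) Q \<le> M' * M \<and>
          rel_index G Q ((\<psi> \<cdot> (a \<cdot> b) \<cdot> ainv \<psi>) ` Q) \<le> M' * M" if p: "\<psi> \<in> H" for \<psi>
  proof -
    let ?c = "\<psi> \<cdot> a \<cdot> ainv \<psi>" and ?d = "\<psi> \<cdot> b \<cdot> ainv \<psi>"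
    have cA: "?c \<in> Aut G T" "?d \<in> Aut G T" using HA a b p by simp_all
    have "?c \<cdot> ?d = \<psi> \<cdot> a \<cdot> (ainv \<psi> \<cdot> \<psi>) \<cdot> b \<cdot> ainv \<psi>"
      using Hc[OF a] Hc[OF b] Hc[OF p] by (simp only: AG.m_assoc AG.inv_closed AG.m_closed)
    then have e: "\<psi> \<cdot> (a \<cdot> b) \<cdot> ainv \<psi> = ?c \<cdot> ?d"
      using Hc[OF a] Hc[OF b] Hc[OF p] by (simp add: AG.m_assoc)
    have "rel_index G ((?c \<cdot> ?d) ` Q) Q \<le> M' * M"
      using order_trans[OF rel_index_mult_le(1)[OF cA Q] mult_le_mono] M[OF p] M'[OF p] by blast
    moreover have "rel_index G Q ((?c \<cdot> ?d) ` Q) \<le> M * M'"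
      using order_trans[OF rel_index_mult_le(2)[OF cA Q] mult_le_mono] M[OF p] M'[OF p] by blast
    ultimately show ?thesis unfolding e by (simp add: mult.commute)
  qed
  then show "a \<cdot> b \<in> FCd G T H" unfolding FC using subgroup.m_closed[OF H a b] by blast
qed

lemma FCd_conj:
  assumes H: "subgroup H AG" and Q: "Q \<in> COS G T" and x: "x \<in> H" and a: "a \<in> FCd G T H"
  shows "x \<cdot> a \<cdot> ainv x \<in> FCd G T H"
proof -
  note FC = FCd_iff[OF H Q]
  have Hc: "\<psi> \<in> carrier AG" if "\<psi> \<in> H" for \<psi> using subgroup.mem_carrier[OF H that] .
  obtain M where aH: "a \<in> H" and M: "\<And>\<psi>. \<psi> \<in> H \<Longrightarrow> rel_index G ((\<psi> \<cdot> a \<cdot> ainv \<psi>) ` Q) Q \<le> M \<and>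
          rel_index G Q ((\<psi> \<cdot> a \<cdot> ainv \<psi>) ` Q) \<le> M" using a unfolding FC by blast
  have "\<psi> \<cdot> (x \<cdot> a \<cdot> ainv x) \<cdot> ainv \<psi> = (\<psi> \<cdot> x) \<cdot> a \<cdot> ainv (\<psi> \<cdot> x)" if "\<psi> \<in> H" for \<psi>
    using Hc[OF that] Hc[OF x] Hc[OF aH] by (simp add: AG.inv_mult_group AG.m_assoc)
  then show ?thesis unfolding FC using M subgroup.m_closed[OF H] subgroup.m_inv_closed[OF H] x aH by (intro conjI exI[of _ M]) auto
qed

section \<open>Flat subgroups and their quotients\<close>

lemma flat_tidy:
  assumes "flat G T K" "K \<subseteq> Aut G T" shows "\<exists>Q\<in>COS G T. \<forall>k\<in>K. tidy k Q"
  using assms tidy_iff_min unfolding flat_def by blast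

lemma tidy_flat:
  assumes "W \<in> COS G T" "K \<subseteq> Aut G T" "\<forall>k\<in>K. tidy k W" shows "flat G T K"
  using assms tidy_iff_min unfolding flat_def by blast

text \<open>Conjugates by elements of \<open>K\<close> displace the common tidy subgroup equally. A
  general conjugator is r k with \<open>r\<close> from finitely many representatives, which adds a
  factor depending on \<open>r\<close> only.\<close>

lemma flat_fin_index_subset_FCd:
  assumes H: "subgroup H AG" and K: "subgroup K AG" "K \<subseteq> H" and fl: "flat G T K" and fi: "AG.fin_index H K"
  shows "K \<subseteq> FCd G T H"
proof
  have HA: "\<psi> \<in> Aut G T" and Hc: "\<psi> \<in> carrier AG" if "\<psi> \<in> H" for \<psi> using subgroup.mem_carrier[OF H that] by (simp_all add: carrier_Aut)
  have KH: "k \<in> H" if "k \<in> K" for k using K(2) that by blast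
  obtain Q where Q: "Q \<in> COS G T" and t: "\<And>k. k \<in> K \<Longrightarrow> tidy k Q" using flat_tidy[OF fl] K(2) HA by blast
  note sQ = COS_D(1)[OF Q]
  note mK = subgroup.m_closed[OF K(1)] subgroup.m_inv_closed[OF K(1)]
  obtain R where R: "finite R" "R \<subseteq> H" "\<forall>h\<in>H. \<exists>r\<in>R. ainv r \<cdot> h \<in> K" using fi unfolding AG.fin_index_def by blast
  fix \<phi> assume \<phi>: "\<phi> \<in> K"
  note pA = HA[OF KH[OF \<phi>]]
  have sc: "rel_index G (k ` Q) Q = aut_scale G T k" if "k \<in> K" for k using tidy_iff_min[OF HA[OF KH[OF that]] Q] t[OF that] by simp
  let ?s = "aut_scale G T \<phi>" and ?t = "aut_scale G T (ainv \<phi>)"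
  \<comment> \<open>Conjugation by \<open>r\<close> contributes one index for \<open>r\<close> and
    one for its inverse. The two scales are added so that one number bounds both directions.\<close>
  define B where "B r = rel_index G (r ` Q) Q * rel_index G Q (r ` Q) * (?s + ?t)" for r
  have "rel_index G ((\<psi> \<cdot> \<phi> \<cdot> ainv \<psi>) ` Q) Q \<le> (\<Sum>r\<in>R. B r) \<and>
          rel_index G Q ((\<psi> \<cdot> \<phi> \<cdot> ainv \<psi>) ` Q) \<le> (\<Sum>r\<in>R. B r)" if p: "\<psi> \<in> H" for \<psi>
  proof -
    obtain r where r: "r \<in> R" "ainv r \<cdot> \<psi> \<in> K" using R(3) p by blast
    have rH: "r \<in> H" using r R(2) by blast
    note rA = HA[OF rH]
    define k where "k = ainv r \<cdot> \<psi>"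
    have kK: "k \<in> K" using r by (simp add: k_def)
    note kA = HA[OF KH[OF kK]]
    let ?c = "k \<cdot> \<phi> \<cdot> ainv k"
    have cK: "?c \<in> K" using mK kK \<phi> by simp
    note cA = HA[OF KH[OF cK]]
    have pr: "\<psi> = r \<cdot> k" using Hc[OF rH] Hc[OF p] by (simp add: k_def AG.m_assoc[symmetric])
    have e: "\<psi> \<cdot> \<phi> \<cdot> ainv \<psi> = r \<cdot> (?c \<cdot> ainv r)"
      unfolding pr using Hc[OF rH] Hc[OF KH[OF kK]] Hc[OF KH[OF \<phi>]] by (simp add: AG.inv_mult_group AG.m_assoc)
    have c1: "rel_index G (?c ` Q) Q = ?s" using sc[OF cK] aut_scale_conj[OF pA kA Q] by simp
    have ci: "ainv ?c = k \<cdot> ainv \<phi> \<cdot> ainv k"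
      using Hc[OF KH[OF kK]] Hc[OF KH[OF \<phi>]] by (simp add: AG.inv_mult_group AG.m_assoc)
    have c2: "rel_index G Q (?c ` Q) = ?t"
      using rel_index_inv[OF cA sQ] sc[OF mK(2)[OF cK]] aut_scale_conj[OF _ kA Q, of "ainv \<phi>"] pA ci by simp
    have i1: "rel_index G ((ainv r) ` Q) Q = rel_index G Q (r ` Q)" using rel_index_inv[OF rA sQ] .
    have i2: "rel_index G Q ((ainv r) ` Q) = rel_index G (r ` Q) Q"
      using rel_index_inv[of "ainv r" Q] rA sQ Hc[OF rH] by simp
    have ciA: "?c \<cdot> ainv r \<in> Aut G T" and iA: "ainv r \<in> Aut G T" using cA rA by simp_all
    have "rel_index G ((r \<cdot> (?c \<cdot> ainv r)) ` Q) Q \<le> (rel_index G Q (r ` Q) * ?s) * rel_index G (r ` Q) Q"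
      using order_trans[OF rel_index_mult_le(1)[OF rA ciA Q] mult_le_mono1[OF rel_index_mult_le(1)[OF cA iA Q]]] by (simp add: i1 c1)
    also have "\<dots> \<le> B r" unfolding B_def by (simp add: algebra_simps)
    finally have 1: "rel_index G ((\<psi> \<cdot> \<phi> \<cdot> ainv \<psi>) ` Q) Q \<le> B r" unfolding e .
    have "rel_index G Q ((r \<cdot> (?c \<cdot> ainv r)) ` Q) \<le> rel_index G Q (r ` Q) * (?t * rel_index G (r ` Q) Q)"
      using order_trans[OF rel_index_mult_le(2)[OF rA ciA Q] mult_le_mono2[OF rel_index_mult_le(2)[OF cA iA Q]]] by (simp add: i2 c2)
    also have "\<dots> \<le> B r" unfolding B_def by (simp add: algebra_simps)
    finally have 2: "rel_index G Q ((\<psi> \<cdot> \<phi> \<cdot> ainv \<psi>) ` Q) \<le> B r" unfolding e .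
    have "B r \<le> (\<Sum>r\<in>R. B r)" using R(1) r(1) by (intro member_le_sum) auto
    then show ?thesis using 1 2 by linarith
  qed
  then show "\<phi> \<in> FCd G T H" unfolding FCd_iff[OF H Q] using KH[OF \<phi>] by blast
qed

lemma flat_one_eq:
  assumes "K \<subseteq> Aut G T" "\<forall>k\<in>K. tidy k Q"
  shows "flat_one G T K = {k \<in> K. k ` Q = Q}"
  using assms stab_iff_scale unfolding flat_one_def by blast

lemma flat_one_normal:
  assumes K: "subgroup K AG" and Q: "Q \<in> COS G T" and t: "\<forall>k\<in>K. tidy k Q"
  shows "flat_one G T K \<lhd> AG\<lparr>carrier := K\<rparr>"
proof -
  have KA: "k \<in> Aut G T" if "k \<in> K" for k using subgroup.mem_carrier[OF K that] by (simp add: carrier_Aut)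
  note mK = subgroup.m_closed[OF K] subgroup.m_inv_closed[OF K] subgroup.one_closed[OF K]
  note Qc = COS_D(4)[OF Q]
  have fo: "flat_one G T K = {k \<in> K. k ` Q = Q}" using KA t by (intro flat_one_eq) auto
  have gK: "group (AG\<lparr>carrier := K\<rparr>)" using subgroup.subgroup_is_group[OF K AG.group_axioms] .
  have "subgroup (flat_one G T K) AG"
  proof (rule AG.subgroupI)
    show "flat_one G T K \<subseteq> carrier AG" using KA by (auto simp: fo carrier_Aut)
    have "\<one>\<^bsub>AG\<^esub> \<in> flat_one G T K" using mK(3) Qc by (simp add: fo)
    then show "flat_one G T K \<noteq> {}" by blast
    show "ainv a \<in> flat_one G T K" if "a \<in> flat_one G T K" for a
      using that mK(2) KA inv_image(1)[OF KA Qc, of a] by (simp add: fo)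
    show "a \<cdot> b \<in> flat_one G T K" if "a \<in> flat_one G T K" "b \<in> flat_one G T K" for a b
      using that mK(1) mult_image[OF Qc] by (simp add: fo)
  qed
  then have s: "subgroup (flat_one G T K) (AG\<lparr>carrier := K\<rparr>)"
    using AG.subgroup_incl[OF _ K] by (auto simp: flat_one_def)
  show ?thesis unfolding group.normal_inv_iff[OF gK]
  proof (intro conjI ballI s)
    fix x h assume x: "x \<in> carrier (AG\<lparr>carrier := K\<rparr>)" and h: "h \<in> flat_one G T K"
    have xK: "x \<in> K" and hK: "h \<in> K" using x h by (simp_all add: flat_one_def)
    have c: "x \<in> carrier AG" "h \<in> carrier AG" using KA xK hK by (simp_all add: carrier_Aut)
    let ?c = "x \<cdot> h \<cdot> ainv x"
    have "ainv ?c = x \<cdot> ainv h \<cdot> ainv x" using c by (simp add: AG.inv_mult_group AG.m_assoc)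
    then have "?c \<in> flat_one G T K" using h mK xK hK aut_scale_conj[OF _ KA[OF xK] Q] KA[OF hK] by (simp add: flat_one_def)
    then show "x \<otimes>\<^bsub>AG\<lparr>carrier := K\<rparr>\<^esub> h \<otimes>\<^bsub>AG\<lparr>carrier := K\<rparr>\<^esub> inv\<^bsub>AG\<lparr>carrier := K\<rparr>\<^esub> x \<in> flat_one G T K"
      using AG.m_inv_consistent[OF K xK] by simp
  qed
qed

text \<open>\<open>lam\<close> is the quotient map by \<open>flat_one\<close>, which is the
  stabilizer of \<open>Q\<close> by tidiness, followed by the isomorphism with a free abelian group.
  \<open>E\<close> consists of lifts of a basis.\<close>

lemma flat_finite_rank_hom:
  assumes K: "subgroup K AG" and Q: "Q \<in> COS G T" and t: "\<forall>k\<in>K. tidy k Q" and fr: "flat_finite_rank G T K"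
  shows "\<exists>(lam :: ('a \<Rightarrow> 'a) \<Rightarrow> (nat \<Rightarrow>\<^sub>0 int)) E. (\<forall>k\<in>K. \<forall>l\<in>K. lam (k \<cdot> l) = lam k + lam l) \<and>
     (\<forall>k\<in>K. lam k = 0 \<longleftrightarrow> k ` Q = Q) \<and> finite E \<and> E \<subseteq> K \<and> (\<forall>k\<in>K. \<exists>e\<in>generate AG E. lam e = lam k)"
proof -
  let ?K = "AG\<lparr>carrier := K\<rparr>" and ?N = "flat_one G T K"
  have KA: "k \<in> Aut G T" if "k \<in> K" for k using subgroup.mem_carrier[OF K that] by (simp add: carrier_Aut)
  note mK = subgroup.m_closed[OF K] subgroup.m_inv_closed[OF K] subgroup.one_closed[OF K]
  have fo: "?N = {k \<in> K. k ` Q = Q}" using KA t by (intro flat_one_eq) auto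
  have nor: "?N \<lhd> ?K" using flat_one_normal[OF K Q t] .
  interpret N: normal ?N ?K using nor .
  obtain S :: "nat set" and h where S: "finite S" and h: "h \<in> iso (?K Mod ?N) (free_Abelian_group S)"
    using fr unfolding flat_finite_rank_def is_iso_def by blast
  interpret gh: group_hom "?K Mod ?N" "free_Abelian_group S" h
    using h N.factorgroup_is_group by (auto simp: group_hom_def group_hom_axioms_def iso_def)
  define lam where "lam k = h (?N #>\<^bsub>?K\<^esub> k)" for k
  have car: "?N #>\<^bsub>?K\<^esub> k \<in> carrier (?K Mod ?N)" if "k \<in> K" for k
    using that by (auto simp: FactGroup_def RCOSETS_def)
  have hom: "lam (k \<cdot> l) = lam k + lam l" if kl: "k \<in> K" "l \<in> K" for k l
  proof -
    have "(?N #>\<^bsub>?K\<^esub> k) \<otimes>\<^bsub>?K Mod ?N\<^esub> (?N #>\<^bsub>?K\<^esub> l) = ?N #>\<^bsub>?K\<^esub> (k \<cdot> l)"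
      using N.rcos_sum[of k l] kl by (simp add: FactGroup_def)
    then show ?thesis using gh.hom_mult[OF car[OF kl(1)] car[OF kl(2)]] by (simp add: lam_def)
  qed
  have ker: "lam k = 0 \<longleftrightarrow> k ` Q = Q" if k: "k \<in> K" for k
  proof -
    have "lam k = 0 \<longleftrightarrow> h (?N #>\<^bsub>?K\<^esub> k) = h ?N" using gh.hom_one by (simp add: lam_def FactGroup_def)
    also have "\<dots> \<longleftrightarrow> ?N #>\<^bsub>?K\<^esub> k = ?N"
    proof -
      have "inj_on h (carrier (?K Mod ?N))" using h by (auto simp: iso_def bij_betw_def)
      moreover have "?N \<in> carrier (?K Mod ?N)" using gh.G.one_closed by (simp add: FactGroup_def)
      ultimately show ?thesis using inj_on_eq_iff[OF _ car[OF k]] by blast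
    qed
    also have "\<dots> \<longleftrightarrow> k \<in> ?N"
      using N.coset_join1[of ?N k] N.coset_join2[of k ?N] N.subgroup_axioms k by auto
    finally show ?thesis using k by (simp add: fo)
  qed
  have surj: "\<exists>k\<in>K. lam k = frag_of s" if s: "s \<in> S" for s
  proof -
    have "frag_of s \<in> h ` carrier (?K Mod ?N)" using h s by (simp add: iso_def bij_betw_def)
    then obtain Y where Y: "Y \<in> carrier (?K Mod ?N)" "frag_of s = h Y" by blast
    then obtain k where "k \<in> K" "Y = ?N #>\<^bsub>?K\<^esub> k" by (auto simp: FactGroup_def RCOSETS_def)
    then show ?thesis using Y by (auto simp: lam_def)
  qed
  then obtain g where g: "\<And>s. s \<in> S \<Longrightarrow> g s \<in> K \<and> lam (g s) = frag_of s" by metis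
  define E where "E = g ` S"
  have EK: "E \<subseteq> K" using g by (auto simp: E_def)
  have gK: "generate AG E \<subseteq> K" using AG.generate_subgroup_incl[OF EK K] .
  have sg: "subgroup (generate AG E) AG" using AG.generate_is_subgroup[of E] EK subgroup.subset[OF K] by blast
  have lam1: "lam \<one>\<^bsub>AG\<^esub> = 0" using hom[OF mK(3) mK(3)] by simp
  have lami: "lam (ainv k) = - lam k" if k: "k \<in> K" for k
    using hom[OF k mK(2)[OF k]] lam1 KA[OF k] by (simp add: carrier_Aut eq_neg_iff_add_eq_0 add.commute)
  \<comment> \<open>Only values of \<open>lam\<close> are claimed to be reached: lifts of a basis
    generate \<open>K\<close> up to the kernel.\<close>
  have "\<exists>e\<in>generate AG E. lam e = x" if x: "Poly_Mapping.keys x \<subseteq> S" for x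
  proof (rule free_Abelian_group_induct[OF x])
    show "\<exists>e\<in>generate AG E. lam e = 0" using lam1 subgroup.one_closed[OF sg] by blast
  next
    fix x y assume "\<exists>e\<in>generate AG E. lam e = x" "\<exists>e\<in>generate AG E. lam e = y"
    then obtain e d where e: "e \<in> generate AG E" "lam e = x" "d \<in> generate AG E" "lam d = y" by blast
    have "lam (e \<cdot> ainv d) = x - y" using e hom[of e "ainv d"] lami[of d] mK subsetD[OF gK] by simp
    moreover have "e \<cdot> ainv d \<in> generate AG E" using e sg by (simp add: subgroup.m_closed subgroup.m_inv_closed)
    ultimately show "\<exists>e\<in>generate AG E. lam e = x - y" by blast
  next
    fix s assume "s \<in> S"
    then show "\<exists>e\<in>generate AG E. lam e = frag_of s" using g[of s] generate.incl[of "g s" E AG] by (auto simp: E_def)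
  qed
  moreover have "Poly_Mapping.keys (lam k) \<subseteq> S" if "k \<in> K" for k
    using gh.hom_closed[OF car[OF that]] by (simp add: lam_def)
  ultimately have gen: "\<exists>e\<in>generate AG E. lam e = lam k" if "k \<in> K" for k using that by blast
  have fE: "finite E" using S by (simp add: E_def)
  show ?thesis by (rule exI[of _ lam], rule exI[of _ E]) (use hom ker fE EK gen in blast)
qed

end

theorem theorem6:
  fixes G :: "('a,'b) monoid_scheme" and T :: "'a topology" and H :: "('a \<Rightarrow> 'a) set"
  assumes "tdlc_group G T"
    and "subgroup H (aut_group G T)"
    and "virtually_flat_finite_rank G T H"
  shows "subgroup (FCd G T H) ((aut_group G T)\<lparr>carrier := H\<rparr>)
       \<and> FCd G T H \<lhd> (aut_group G T)\<lparr>carrier := H\<rparr>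
       \<and> flat G T (FCd G T H)
       \<and> finite (rcosets\<^bsub>(aut_group G T)\<lparr>carrier := H\<rparr>\<^esub> (FCd G T H))
       \<and> (\<forall>K. subgroup K ((aut_group G T)\<lparr>carrier := H\<rparr>)
              \<and> flat G T K
              \<and> finite (rcosets\<^bsub>(aut_group G T)\<lparr>carrier := H\<rparr>\<^esub> K)
              \<longrightarrow> K \<subseteq> FCd G T H)"
proof -
  have "group G" using assms(1) by (simp add: tdlc_group_def)
  then interpret tdlc G T using assms(1) by (simp add: tdlc_def tdlc_axioms_def)
  let ?H = "AG\<lparr>carrier := H\<rparr>" and ?F = "FCd G T H"
  note H = assms(2)
  have gH: "group ?H" using subgroup.subgroup_is_group[OF H AG.group_axioms] .
  have HA: "\<psi> \<in> Aut G T" if "\<psi> \<in> H" for \<psi> using subgroup.mem_carrier[OF H that] by (simp add: carrier_Aut)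
  have contain: "L \<subseteq> ?F" if "subgroup L ?H" "flat G T L" "finite (rcosets\<^bsub>?H\<^esub> L)" for L
  proof -
    have sL: "subgroup L AG" using AG.incl_subgroup[OF H that(1)] .
    moreover have "L \<subseteq> H" using subgroup.subset[OF that(1)] by simp
    ultimately show ?thesis using flat_fin_index_subset_FCd[OF H sL _ that(2)] AG.fin_index_if_finite_rcosets[OF H sL that(3)] by blast
  qed
  obtain K where K: "subgroup K ?H" "finite (rcosets\<^bsub>?H\<^esub> K)" "flat_finite_rank G T K"
    using assms(3) unfolding virtually_flat_finite_rank_def by blast
  have fK: "flat G T K" using K(3) by (simp add: flat_finite_rank_def)
  have sK: "subgroup K AG" using AG.incl_subgroup[OF H K(1)] .
  have KH: "K \<subseteq> H" using subgroup.subset[OF K(1)] by simp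
  have KF: "K \<subseteq> ?F" using contain[OF K(1) fK K(2)] .
  obtain Q where Q: "Q \<in> COS G T" and tK: "\<forall>k\<in>K. tidy k Q" using flat_tidy[OF fK] KH HA by blast
  have sF: "subgroup ?F AG" using subgroup_FCd[OF H Q] .
  have FH: "?F \<subseteq> H" by (auto simp: FCd_def)
  have sFH: "subgroup ?F ?H" using AG.subgroup_incl[OF sF H FH] .
  moreover have "?F \<lhd> ?H"
    unfolding group.normal_inv_iff[OF gH] using sFH FCd_conj[OF H Q] AG.m_inv_consistent[OF H] by simp
  moreover have "finite (rcosets\<^bsub>?H\<^esub> ?F)"
  proof -
    \<comment> \<open>As \<open>K\<close> is contained in the subgroup, each coset of the latter is
      its product with a coset of \<open>K\<close>.\<close>
    have "rcosets\<^bsub>?H\<^esub> ?F \<subseteq> (\<lambda>S. ?F <#>\<^bsub>AG\<^esub> S) ` (rcosets\<^bsub>?H\<^esub> K)"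
    proof
      fix Y assume "Y \<in> rcosets\<^bsub>?H\<^esub> ?F"
      then obtain a where a: "a \<in> H" "Y = ?F #>\<^bsub>AG\<^esub> a" by (auto simp: RCOSETS_def r_coset_def)
      have aC: "a \<in> carrier AG" using HA[OF a(1)] by (simp add: carrier_Aut)
      have "?F <#>\<^bsub>AG\<^esub> (K #>\<^bsub>AG\<^esub> a) = (?F <#>\<^bsub>AG\<^esub> K) #>\<^bsub>AG\<^esub> a"
        using AG.setmult_rcos_assoc[OF subgroup.subset[OF sF] subgroup.subset[OF sK] aC] .
      also have "?F <#>\<^bsub>AG\<^esub> K = ?F" using AG.set_mult_subgroup_idem[OF sF] AG.subgroup_incl[OF sK sF KF] by simp
      finally have "Y = ?F <#>\<^bsub>AG\<^esub> (K #>\<^bsub>AG\<^esub> a)" using a by simp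
      moreover have "K #>\<^bsub>AG\<^esub> a \<in> rcosets\<^bsub>?H\<^esub> K" using a by (auto simp: RCOSETS_def r_coset_def)
      ultimately show "Y \<in> (\<lambda>S. ?F <#>\<^bsub>AG\<^esub> S) ` (rcosets\<^bsub>?H\<^esub> K)" by blast
    qed
    then show ?thesis using K(2) finite_surj by blast
  qed
  moreover have "flat G T ?F"
  proof -
    have fi: "AG.fin_index ?F K"
      using AG.fin_index_subset[OF H sF sK FH] AG.fin_index_if_finite_rcosets[OF H sK K(2)] by blast
    obtain lam :: "('a \<Rightarrow> 'a) \<Rightarrow> (nat \<Rightarrow>\<^sub>0 int)" and E where lam: "\<forall>k\<in>K. \<forall>l\<in>K. lam (k \<cdot> l) = lam k + lam l"
      "\<forall>k\<in>K. lam k = 0 \<longleftrightarrow> k ` Q = Q" "finite E" "E \<subseteq> K" "\<forall>k\<in>K. \<exists>e\<in>generate AG E. lam e = lam k"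
      using flat_finite_rank_hom[OF sK Q tK K(3)] by blast
    have bd: "\<exists>M. \<forall>\<psi>\<in>?F. rel_index G ((\<psi> \<cdot> t \<cdot> ainv \<psi>) ` Q) Q \<le> M \<and>
          rel_index G Q ((\<psi> \<cdot> t \<cdot> ainv \<psi>) ` Q) \<le> M" if "t \<in> ?F" for t
      using that FH unfolding FCd_iff[OF H Q] by blast
    have "\<exists>W\<in>COS G T. \<forall>\<phi>\<in>?F. tidy \<phi> W"
      by (rule ex_tidy_bounded_conj[OF Q sF sK KF fi _ bd, where lam = lam and E = E]) (use tK lam in blast)+
    then show ?thesis using tidy_flat FH HA by blast
  qed
  ultimately show ?thesis using contain by blast
qed

end
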